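(* Let $0<T\le\infty$ and let $\{X(t):0\le t<T\}$ be a zero-mean Gaussian process of dimension $m\times1$ with $X(0)=0$ and covariance kernel $$\Gamma(t,s)=\begin{cases} s(\alpha-\beta t), & 0\le s\le t<T,\\ t(\alpha-\beta s), & 0\le t<s<T,\end{cases}$$ where $\beta$ and $\alpha-\beta t$, for each $0<t<T$, are symmetric positive definite. If samples $X(t_i)=x_i$ are known for $0<t_1<t_2<\dots<t_n<T$ ($n\ge2$), then $$\hat\alpha=\frac1{n-1}\sum_{i=1}^{n-1}\frac{(t_{i+1}x_i-t_ix_{i+1})(t_{i+1}x_i-t_ix_{i+1})^T}{t_it_{i+1}(t_{i+1}-t_i)}\qquad\text{and}\qquad \hat\beta=\frac{\hat\alpha}{t_n}-\frac{x_nx_n^T}{t_n^2}$$ are the unique maximum-likelihood, jointly sufficient, unbiased estimators of the parameter matrices $\alpha$ and $\beta$.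
   Context: $\Gamma(t,s)=E[X(t)X^T(s)]$, and $\alpha,\beta$ are constant real $m\times m$ matrices. Estimators are jointly sufficient, respectively maximum likelihood, if they are jointly sufficient for, respectively maximize, the joint density $p(x_1,\dots,x_n)$ of $(X(t_1),\dots,X(t_n))$, factored as $p(x_1,\dots,x_n)=p_1(x_1,\dots,x_{n-1}\mid x_n)\,p_2(x_n)$, where $p_1$ is the conditional density of $(X(t_1),\dots,X(t_{n-1}))$ given $X(t_n)=x_n$ and $p_2$ is the density of $X(t_n)$. With $\Sigma=\Gamma(t_n,t_n)=t_n(\alpha-\beta t_n)$, the density $p_2$ is understood in the following generalized sense, which also covers singular $\Sigma$: $$p_2(x_n)=(2\pi)^{-\mathrm{Rank}(\Sigma)/2}|\Sigma|_+^{-1/2}\exp\!\big(-\tfrac12\mathrm{tr}(\Sigma^-x_nx_n^T)\big)\ \text{ if } N^Tx_n=0,\qquad p_2(x_n)=0\ \text{ otherwise},$$ where $|\Sigma|_+$ is the product of the nonzero eigenvalues of $\Sigma$, $\Sigma^-$ is any generalized inverse of $\Sigma$, and $N$ is an $m\times(m-\mathrm{Rank}(\Sigma))$ matrix of rank $m-\mathrm{Rank}(\Sigma)$ with $N^T\Sigma=0$ (no condition if $\mathrm{Rank}(\Sigma)=m$). An estimator is unbiased if its expectation, with $x_i$ replaced by $X(t_i)$, equals the parameter matrix.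
   Formalization: "Maximize" is taken over symmetric α, β with α−βt positive semidefinite on [0,t_n], with ranks of α and Σ at most those of the estimates, and positive density at the sample; without the rank bound the generalized density is unbounded for m≥2 and no maximizer exists. *)

theory Defs
  imports "HOL-Probability.Probability"
begin

section \<open>Matrices\<close>

definition outer :: "real^'i \<Rightarrow> real^'j \<Rightarrow> real^'j^'i" where
  "outer x y = (\<chi> i j. x $ i * y $ j)"

definition pos_def :: "real^'i^'i \<Rightarrow> bool" where
  "pos_def A \<longleftrightarrow> transpose A = A \<and> (\<forall>v. v \<noteq> 0 \<longrightarrow> 0 < v \<bullet> (A *v v))"

definition pos_semidef :: "real^'i^'i \<Rightarrow> bool" where
  "pos_semidef A \<longleftrightarrow> transpose A = A \<and> (\<forall>v. 0 \<le> v \<bullet> (A *v v))"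

text \<open>An arbitrary generalized inverse; by \<open>trace_ginv_unique\<close> below, the densities do not
  depend on the choice.\<close>

definition is_ginv :: "real^'i^'i \<Rightarrow> real^'i^'i \<Rightarrow> bool" where
  "is_ginv A G \<longleftrightarrow> A ** G ** A = A"

definition ginv :: "real^'i^'i \<Rightarrow> real^'i^'i" where
  "ginv A = (SOME G. is_ginv A G)"

lemma is_ginv_ginv: "is_ginv A (ginv A)"
proof -
  have "linear ((*v) A)" by simp
  from linear_exists_right_inverse_on[OF this subspace_UNIV]
  obtain g where g: "linear g" "\<forall>v\<in>range ((*v) A). A *v g v = v" by auto
  have "A ** matrix g ** A = A"
    by (subst matrix_eq)
      (use g in \<open>simp add: matrix_vector_mul_assoc[symmetric] matrix_works\<close>)
  then show ?thesis unfolding ginv_def is_ginv_def by (rule someI)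
qed

text \<open>The product of the nonzero eigenvalues, repeated according to multiplicity.  It is only
  used for symmetric matrices, whose geometric and algebraic multiplicities agree.\<close>

definition pdet :: "real^'i^'i \<Rightarrow> real" where
  "pdet A = (\<Prod>l\<in>{l. l \<noteq> 0 \<and> (\<exists>v. v \<noteq> 0 \<and> A *v v = l *\<^sub>R v)}. l ^ dim {v. A *v v = l *\<^sub>R v})"

section \<open>Gaussian densities and processes\<close>

text \<open>The set \<open>N\<close> consists of the columns of a matrix of full rank \<open>m - rank S\<close>
  with \<open>N\<^sup>T S = 0\<close>.\<close>

definition null_columns :: "real^'i^'i \<Rightarrow> (real^'i) set \<Rightarrow> bool" where
  "null_columns S N \<longleftrightarrow>
     independent N \<and> card N = CARD('i) - rank S \<and> (\<forall>v\<in>N. v v* S = 0)"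

text \<open>The density at \<open>x\<close> of the centred normal law with possibly singular covariance matrix \<open>S\<close>,
  with respect to Lebesgue measure on the range of \<open>S\<close>.\<close>

definition gauss_density :: "real^'i^'i \<Rightarrow> real^'i \<Rightarrow> real" where
  "gauss_density S x =
     (if \<exists>N. null_columns S N \<and> (\<forall>v\<in>N. v \<bullet> x = 0)
      then (2 * pi) powr (- (real (rank S) / 2)) * pdet S powr (- (1 / 2))
             * exp (- (1 / 2) * trace (ginv S ** outer x x))
      else 0)"

text \<open>Neither the choice of \<open>N\<close> nor that of the generalized inverse matters.\<close>

lemma null_columns_support:
  fixes S :: "real^'i^'i"
  assumes sym: "transpose S = S" and N: "null_columns S N"
  shows "(\<forall>v\<in>N. v \<bullet> x = 0) \<longleftrightarrow> x \<in> range ((*v) S)"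
proof -
  let ?R = "range ((*v) S)"
  have subR: "subspace ?R"
    by (intro linear_subspace_image) auto
  have K: "v v* S = 0 \<longleftrightarrow> v \<in> ?R\<^sup>\<bottom>" for v
    by (auto simp: orthogonal_comp_def orthogonal_def dot_lmul_matrix[symmetric] inner_commute)
      (metis dot_lmul_matrix inner_eq_zero_iff inner_commute)
  have "?R\<^sup>\<bottom> = {y \<in> UNIV. \<forall>x\<in>?R. orthogonal x y}"
    by (auto simp: orthogonal_comp_def)
  moreover have "dim {y \<in> (UNIV :: (real^'i) set). \<forall>x\<in>?R. orthogonal x y} + dim ?R = dim (UNIV :: (real^'i) set)"
    by (intro dim_subspace_orthogonal_to_vectors subR) auto
  ultimately have "dim (?R\<^sup>\<bottom>) + rank S = CARD('i)"
    by (simp add: rank_dim_range)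
  then have "card N = dim (?R\<^sup>\<bottom>)" using N by (simp add: null_columns_def)
  moreover have "N \<subseteq> ?R\<^sup>\<bottom>" "independent N" using N K by (auto simp: null_columns_def)
  ultimately have "?R\<^sup>\<bottom> \<subseteq> span N"
    by (intro card_ge_dim_independent) auto
  then have spanN: "span N = ?R\<^sup>\<bottom>"
    using \<open>N \<subseteq> ?R\<^sup>\<bottom>\<close> by (simp add: span_minimal subspace_orthogonal_comp subset_antisym)
  have "(\<forall>v\<in>N. v \<bullet> x = 0) \<longleftrightarrow> (\<forall>v\<in>span N. orthogonal x v)"
    by (metis orthogonal_def inner_commute span_base orthogonal_to_span)
  also have "\<dots> \<longleftrightarrow> x \<in> ?R\<^sup>\<bottom>\<^sup>\<bottom>"
    by (auto simp: spanN orthogonal_comp_def orthogonal_commute)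
  also have "?R\<^sup>\<bottom>\<^sup>\<bottom> = ?R"
    by (rule orthogonal_comp_self[OF subR])
  finally show ?thesis .
qed

lemma trace_ginv_unique:
  fixes S :: "real^'i^'i"
  assumes sym: "transpose S = S" and G: "is_ginv S G" "is_ginv S H"
    and x: "x \<in> range ((*v) S)"
  shows "trace (G ** outer x x) = trace (H ** outer x x)"
proof -
  obtain u where u: "x = S *v u" using x by auto
  have "trace (G ** outer x x) = u \<bullet> (S *v u)" if "is_ginv S G" for G
  proof -
    have "trace (G ** outer x x) = x \<bullet> (G *v x)"
      by (simp add: trace_def outer_def matrix_matrix_mult_def inner_vec_def
          matrix_vector_mult_def sum_distrib_left mult_ac)
    also have "\<dots> = u \<bullet> (S *v (G *v (S *v u)))"
      by (metis u sym dot_lmul_matrix vector_transpose_matrix inner_commute)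
    also have "\<dots> = u \<bullet> (S *v u)"
      using that by (simp add: is_ginv_def matrix_vector_mul_assoc matrix_mul_assoc)
    finally show ?thesis .
  qed
  then show ?thesis using G by simp
qed

definition normal_rv :: "'w measure \<Rightarrow> ('w \<Rightarrow> real) \<Rightarrow> bool" where
  "normal_rv M Y \<longleftrightarrow> Y \<in> borel_measurable M \<and>
     (\<exists>\<mu> \<sigma>. (0 < \<sigma> \<and> distributed M lborel Y (normal_density \<mu> \<sigma>)) \<or> (AE w in M. Y w = \<mu>))"

definition centred_gaussian_process ::
    "'w measure \<Rightarrow> real set \<Rightarrow> (real \<Rightarrow> 'w \<Rightarrow> real^'m) \<Rightarrow> (real \<Rightarrow> real \<Rightarrow> real^'m^'m) \<Rightarrow> bool" where
  "centred_gaussian_process M I X \<Gamma> \<longleftrightarrow>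
     prob_space M \<and>
     (\<forall>t\<in>I. X t \<in> borel_measurable M) \<and>
     (\<forall>F a. finite F \<and> F \<subseteq> I \<longrightarrow> normal_rv M (\<lambda>w. \<Sum>t\<in>F. a t \<bullet> X t w)) \<and>
     (\<forall>t\<in>I. (LINT w|M. X t w) = 0) \<and>
     (\<forall>t\<in>I. \<forall>s\<in>I. (LINT w|M. outer (X t w) (X s w)) = \<Gamma> t s)"

section \<open>The model\<close>

definition cov_kernel :: "real^'m^'m \<Rightarrow> real^'m^'m \<Rightarrow> real \<Rightarrow> real \<Rightarrow> real^'m^'m" where
  "cov_kernel \<alpha> \<beta> t s =
     (if s \<le> t then s *\<^sub>R (\<alpha> - t *\<^sub>R \<beta>) else t *\<^sub>R (\<alpha> - s *\<^sub>R \<beta>))"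

definition params :: "ereal \<Rightarrow> ((real^'m^'m) \<times> (real^'m^'m)) set" where
  "params T = {(\<alpha>, \<beta>). pos_def \<beta> \<and> (\<forall>t. 0 < t \<and> ereal t < T \<longrightarrow> pos_def (\<alpha> - t *\<^sub>R \<beta>))}"

text \<open>A sample is a function \<open>x :: nat \<Rightarrow> real^'m\<close> of which only \<open>x 1, \<dots>, x n\<close> matter.
  The density \<open>cond_density\<close> of the first \<open>n - 1\<close> observations given the last one is that of a
  normal law on a space of dimension \<open>(n - 1) m\<close>, with the usual conditional mean
  \<open>\<Gamma>\<^sub>1\<^sub>n \<Sigma>\<^sup>- x\<^sub>n\<close> and conditional covariance \<open>\<Gamma>\<^sub>1\<^sub>1 - \<Gamma>\<^sub>1\<^sub>n \<Sigma>\<^sup>- \<Gamma>\<^sub>n\<^sub>1\<close>.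
  Its coordinates are indexed by \<open>'k \<times> 'm\<close>, where \<open>'k\<close> is a type with \<open>n - 1\<close> elements,
  identified with \<open>{1..<n}\<close> by the bijection \<open>e\<close>.\<close>

definition cond_mean ::
    "('k::finite \<Rightarrow> nat) \<Rightarrow> nat \<Rightarrow> (nat \<Rightarrow> real) \<Rightarrow> real^'m^'m \<Rightarrow> real^'m^'m \<Rightarrow> real^'m \<Rightarrow> real^('k \<times> 'm)" where
  "cond_mean e n t \<alpha> \<beta> y =
     (\<chi> p. (cov_kernel \<alpha> \<beta> (t (e (fst p))) (t n) *v
              (ginv (cov_kernel \<alpha> \<beta> (t n) (t n)) *v y)) $ snd p)"

definition cond_cov ::
    "('k::finite \<Rightarrow> nat) \<Rightarrow> nat \<Rightarrow> (nat \<Rightarrow> real) \<Rightarrow> real^'m^'m \<Rightarrow> real^'m^'m \<Rightarrow> real^('k \<times> 'm)^('k \<times> 'm)" where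
  "cond_cov e n t \<alpha> \<beta> =
     (\<chi> p q. (cov_kernel \<alpha> \<beta> (t (e (fst p))) (t (e (fst q)))
              - cov_kernel \<alpha> \<beta> (t (e (fst p))) (t n) ** ginv (cov_kernel \<alpha> \<beta> (t n) (t n))
                  ** cov_kernel \<alpha> \<beta> (t n) (t (e (fst q)))) $ snd p $ snd q)"

definition cond_density ::
    "('k::finite \<Rightarrow> nat) \<Rightarrow> nat \<Rightarrow> (nat \<Rightarrow> real) \<Rightarrow> real^'m^'m \<Rightarrow> real^'m^'m \<Rightarrow> (nat \<Rightarrow> real^'m) \<Rightarrow> real" where
  "cond_density e n t \<alpha> \<beta> x =
     gauss_density (cond_cov e n t \<alpha> \<beta>)
       ((\<chi> p. x (e (fst p)) $ snd p) - cond_mean e n t \<alpha> \<beta> (x n))"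

definition joint_density ::
    "('k::finite \<Rightarrow> nat) \<Rightarrow> nat \<Rightarrow> (nat \<Rightarrow> real) \<Rightarrow> real^'m^'m \<Rightarrow> real^'m^'m \<Rightarrow> (nat \<Rightarrow> real^'m) \<Rightarrow> real" where
  "joint_density e n t \<alpha> \<beta> x =
     cond_density e n t \<alpha> \<beta> x * gauss_density (cov_kernel \<alpha> \<beta> (t n) (t n)) (x n)"

section \<open>Estimators\<close>

definition alpha_hat :: "nat \<Rightarrow> (nat \<Rightarrow> real) \<Rightarrow> (nat \<Rightarrow> real^'m) \<Rightarrow> real^'m^'m" where
  "alpha_hat n t x =
     (1 / real (n - 1)) *\<^sub>R (\<Sum>i = 1..n - 1.
        (1 / (t i * t (i + 1) * (t (i + 1) - t i))) *\<^sub>R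
          outer (t (i + 1) *\<^sub>R x i - t i *\<^sub>R x (i + 1)) (t (i + 1) *\<^sub>R x i - t i *\<^sub>R x (i + 1)))"

definition beta_hat :: "nat \<Rightarrow> (nat \<Rightarrow> real) \<Rightarrow> (nat \<Rightarrow> real^'m) \<Rightarrow> real^'m^'m" where
  "beta_hat n t x = (1 / t n) *\<^sub>R alpha_hat n t x - (1 / (t n)\<^sup>2) *\<^sub>R outer (x n) (x n)"

text \<open>The parameters, possibly degenerate, for which \<open>cov_kernel \<alpha> \<beta>\<close> is a covariance kernel up to
  the last sampling time \<open>\<tau>\<close>.  The values of the estimators are of this kind, but in general not in
  \<open>params T\<close>: \<open>\<Sigma>\<close> is estimated by \<open>x\<^sub>n x\<^sub>n\<^sup>T\<close>.\<close>

definition closed_params :: "real \<Rightarrow> ((real^'m^'m) \<times> (real^'m^'m)) set" where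
  "closed_params \<tau> = {(\<alpha>, \<beta>). transpose \<beta> = \<beta> \<and> (\<forall>t\<in>{0..\<tau>}. pos_semidef (\<alpha> - t *\<^sub>R \<beta>))}"

text \<open>The density of a singular normal law refers to Lebesgue measure on its support, so densities
  of laws of different ranks do not have a common dominating measure; as numbers, they are
  unbounded near any singular covariance matrix when the rank is allowed to increase.  Hence the
  maximum of the likelihood is taken over the parameters whose ranks are not larger,
  and the sample must have positive density.  The restriction on the ranks
  is void when the estimates have full rank.\<close>

definition max_likelihood ::
    "('k::finite \<Rightarrow> nat) \<Rightarrow> nat \<Rightarrow> (nat \<Rightarrow> real) \<Rightarrow>
     ((nat \<Rightarrow> real^'m) \<Rightarrow> real^'m^'m) \<Rightarrow> ((nat \<Rightarrow> real^'m) \<Rightarrow> real^'m^'m) \<Rightarrow> bool" where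
  "max_likelihood e n t A B \<longleftrightarrow>
     (\<forall>x. (A x, B x) \<in> closed_params (t n) \<and> 0 < joint_density e n t (A x) (B x) x \<and>
        (\<forall>(a, b) \<in> closed_params (t n).
           rank a \<le> rank (A x) \<and>
           rank (cov_kernel a b (t n) (t n)) \<le> rank (cov_kernel (A x) (B x) (t n) (t n)) \<longrightarrow>
           joint_density e n t a b x \<le> joint_density e n t (A x) (B x) x))"

text \<open>A statistic \<open>S\<close> is sufficient for a family of laws if the conditional probabilities given \<open>S\<close>
  do not depend on the parameter.\<close>

definition sufficient ::
    "'p set \<Rightarrow> 'x measure \<Rightarrow> ('p \<Rightarrow> 'x measure) \<Rightarrow> ('x \<Rightarrow> 'y::topological_space) \<Rightarrow> bool" where
  "sufficient \<Theta> L P S \<longleftrightarrow>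
     S \<in> borel_measurable L \<and>
     (\<forall>\<theta>\<in>\<Theta>. prob_space (P \<theta>) \<and> sets (P \<theta>) = sets L) \<and>
     (\<forall>E\<in>sets L. \<exists>\<phi>\<in>borel_measurable borel. \<forall>\<theta>\<in>\<Theta>. AE x in P \<theta>.
        real_cond_exp (P \<theta>) (vimage_algebra (space L) S borel) (indicator E) x = \<phi> (S x))"

definition sample_measure :: "nat \<Rightarrow> (nat \<Rightarrow> real^'m) measure" where
  "sample_measure n = (\<Pi>\<^sub>M i\<in>{1..n}. lborel)"

definition jointly_sufficient ::
    "ereal \<Rightarrow> ('k::finite \<Rightarrow> nat) \<Rightarrow> nat \<Rightarrow> (nat \<Rightarrow> real) \<Rightarrow>
     ((nat \<Rightarrow> real^'m) \<Rightarrow> real^'m^'m) \<Rightarrow> ((nat \<Rightarrow> real^'m) \<Rightarrow> real^'m^'m) \<Rightarrow> bool" where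
  "jointly_sufficient T e n t A B \<longleftrightarrow>
     sufficient (params T) (sample_measure n)
       (\<lambda>(a, b). density (sample_measure n) (joint_density e n t a b))
       (\<lambda>x. (A x, B x))"

definition sample :: "nat \<Rightarrow> (nat \<Rightarrow> real) \<Rightarrow> (real \<Rightarrow> 'w \<Rightarrow> real^'m) \<Rightarrow> 'w \<Rightarrow> nat \<Rightarrow> real^'m" where
  "sample n t X w = (\<lambda>i\<in>{1..n}. X (t i) w)"

definition unbiased ::
    "'w measure \<Rightarrow> ('w \<Rightarrow> 'x) \<Rightarrow> ('x \<Rightarrow> 'b::{banach, second_countable_topology}) \<Rightarrow> 'b \<Rightarrow> bool" where
  "unbiased M Y A a \<longleftrightarrow> integrable M (\<lambda>w. A (Y w)) \<and> (LINT w|M. A (Y w)) = a"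

end

(*
  Put Z_n = X(t_n) and, for i < n, Z_i = (t_{i+1} X(t_i) - t_i X(t_{i+1})) / sqrt (t_i t_{i+1} (t_{i+1} - t_i)).
  The covariance kernel makes the Z_i uncorrelated with covariances alpha (i < n) and
  Sigma = t_n (alpha - beta t_n) (i = n), and the conditional covariance of the first n - 1 observations
  given the last is K (x) alpha, with K the covariance of a Brownian bridge.  The map x -> z has constant
  Jacobian and whitens K, so the joint density is, up to a power of det L depending on rank alpha only,
  the product of the normal densities of the z_i.

  Since (alpha, beta) -> (alpha, Sigma) is a bijection of the closed parameter set onto pairs of positive
  semidefinite matrices, the likelihood splits into two separate problems for one covariance matrix, which
  the empirical covariances solve.  Sufficiency holds because the joint density depends on the sample only
  through sum_{i<n} z_i z_i^T and x_n x_n^T, and unbiasedness follows from E Z_i Z_i^T = alpha, E Z_n Z_n^T = Sigma.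
  That the sample has the stated law is checked on the characteristic function of (Z_1, ..., Z_n).
*)
theory Submission
  imports Defs
begin

section \<open>Symmetric matrices and orthonormal eigenbases\<close>

text \<open>The variables Z_i come from time inversion: for positive times X(t)/t has covariance
  alpha / max(t, s) - beta, so in the time u = 1/t its increments are uncorrelated, and Z_i is the
  increment between 1/t_{i+1} and 1/t_i divided by the square root of the elapsed time. The obstacle
  is degeneracy. The fitted Sigma has rank at most 1 and the fitted alpha rank at most n - 1, so the
  comparison of likelihoods cannot rely on inverses or determinants. Range, rank, pseudo-determinant
  and density are instead read off an orthonormal eigenbasis in which zero eigenvalues are allowed.
  Positive density puts the samples into the range of a competitor, so its rank is at least that of
  the estimate; the restriction on ranks gives the opposite inequality, and at equal rank the powers
  of det L agree. For uniqueness, a maximizer of too large rank is beaten by a matrix of the same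
  rank that adds suitable eigenvalues to the empirical covariance.\<close>

lemma linear_coeff_zero_if_quadratic_nonneg:
  fixes p q :: real
  assumes "\<And>s. 0 \<le> 2 * s * p + s\<^sup>2 * q"
  shows "p = 0"
proof (rule ccontr)
  assume p: "p \<noteq> 0"
  \<comment> \<open>\<open>d\<close> bounds \<open>q\<close> and is positive, so the upper bound
    \<open>2 * s * p + s\<^sup>2 * d\<close> has its minimum \<open>- p\<^sup>2 / d\<close> at
    \<open>s = - p / d\<close>, whatever the sign of \<open>q\<close>.\<close>
  define d where "d = \<bar>q\<bar> + 1"
  have d: "0 < d" "q \<le> d" by (auto simp: d_def)
  define s where "s = - p / d"
  have "2 * s * p + s\<^sup>2 * q \<le> 2 * s * p + s\<^sup>2 * d"
    using d by (intro add_left_mono mult_left_mono) auto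
  also have "\<dots> = - (p\<^sup>2 / d)"
    using d by (simp add: s_def power2_eq_square field_simps)
  also have "\<dots> < 0" using p d by simp
  finally show False using assms[of s] by simp
qed

text \<open>A maximizer of the Rayleigh quotient on the unit sphere of \<open>V\<close> is an
  eigenvector: the first variation vanishes in every direction of \<open>V\<close>, and invariance
  of \<open>V\<close> puts the residual \<open>c v - f v\<close> itself among those
  directions.\<close>

lemma self_adjoint_eigenvector:
  fixes f :: "'a::euclidean_space \<Rightarrow> 'a"
  assumes lin: "linear f" and adj: "\<And>x y. f x \<bullet> y = x \<bullet> f y"
    and V: "subspace V" "f ` V \<subseteq> V" "V \<noteq> {0}"
  obtains v c where "v \<in> V" "norm v = 1" "f v = c *\<^sub>R v"
proof -
  interpret linear f by fact
  obtain v0 where v0: "v0 \<in> V" "v0 \<noteq> 0" using V subspace_0 by blast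
  let ?S = "sphere 0 1 \<inter> V"
  have "compact ?S" by (intro compact_Int_closed closed_subspace V) auto
  moreover have "(1 / norm v0) *\<^sub>R v0 \<in> ?S" using v0 V by (auto intro: subspace_scale)
  moreover have "continuous_on ?S (\<lambda>x. x \<bullet> f x)"
    by (intro continuous_intros linear_continuous_on linear_conv_bounded_linear[THEN iffD1] lin)
  ultimately obtain v where v: "v \<in> ?S" "\<And>x. x \<in> ?S \<Longrightarrow> x \<bullet> f x \<le> v \<bullet> f v"
    using continuous_attains_sup[of ?S "\<lambda>x. x \<bullet> f x"] by blast
  define c where "c = v \<bullet> f v"
  have q: "0 \<le> c * (w \<bullet> w) - w \<bullet> f w" if w: "w \<in> V" for w
  proof (cases "w = 0")
    case False
    have "(1 / norm w) *\<^sub>R w \<in> ?S" using w V False by (auto intro: subspace_scale)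
    from v(2)[OF this] have "(w \<bullet> f w) / (norm w)\<^sup>2 \<le> c"
      by (simp add: c_def scale power2_eq_square)
    then show ?thesis using False by (simp add: field_simps power2_norm_eq_inner)
  qed (simp add: zero)
  have vv: "v \<bullet> v = 1" using v by (simp add: norm_eq_1)
  have "(c *\<^sub>R v - f v) \<bullet> w = 0" if w: "w \<in> V" for w
  proof (rule linear_coeff_zero_if_quadratic_nonneg[where q = "c * (w \<bullet> w) - w \<bullet> f w"])
    fix s
    \<comment> \<open>Along \<open>v + s w\<close> the form in \<open>q\<close> has no constant
      term, because \<open>c * (v \<bullet> v) - v \<bullet> f v = 0\<close>. Self-adjointness
      merges the two mixed terms.\<close>
    have "v + s *\<^sub>R w \<in> V" using v w V by (auto intro: subspace_add subspace_scale)
    from q[OF this] show "0 \<le> 2 * s * ((c *\<^sub>R v - f v) \<bullet> w) + s\<^sup>2 * (c * (w \<bullet> w) - w \<bullet> f w)"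
      using adj[of v w] adj[of w v] vv
      by (simp add: add scale inner_add_left inner_add_right inner_diff_left algebra_simps
          power2_eq_square c_def[symmetric] inner_commute)
  qed
  moreover have "c *\<^sub>R v - f v \<in> V"
    using v(1) V by (intro subspace_diff subspace_scale) auto
  ultimately have "f v = c *\<^sub>R v" by fastforce
  then show thesis using that[of v c] v by auto
qed

text \<open>Induction on the dimension: by self-adjointness the complement of an eigenvector inside
  an invariant subspace is again invariant. This is why an invariant \<open>V\<close> takes the
  place of the whole space.\<close>

lemma self_adjoint_eigenbasis:
  fixes f :: "'a::euclidean_space \<Rightarrow> 'a"
  assumes lin: "linear f" and adj: "\<And>x y. f x \<bullet> y = x \<bullet> f y"
    and V: "subspace V" "f ` V \<subseteq> V"
  shows "\<exists>B. pairwise orthogonal B \<and> span B = V \<and> (\<forall>v\<in>B. norm v = 1 \<and> (\<exists>c. f v = c *\<^sub>R v))"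
  using V
proof (induction "dim V" arbitrary: V rule: less_induct)
  case less
  show ?case
  proof (cases "V = {0}")
    case True
    then show ?thesis by (intro exI[of _ "{}"]) auto
  next
    case False
    obtain v c where v: "v \<in> V" "norm v = 1" "f v = c *\<^sub>R v"
      using self_adjoint_eigenvector[OF lin adj less.prems False] by blast
    have vv: "v \<bullet> v = 1" using v by (simp add: norm_eq_1)
    define W where "W = {x \<in> V. x \<bullet> v = 0}"
    have W: "subspace W"
      using less.prems(1) unfolding W_def subspace_def by (auto simp: inner_add_left)
    have fW: "f ` W \<subseteq> W"
      using less.prems(2) adj v by (auto simp: W_def)
    have "v \<notin> W" "W \<subseteq> V" using vv by (auto simp: W_def)
    then have "W \<subset> V" using v(1) by blast
    then have "dim W < dim V"
      using W less.prems(1) by (metis dim_psubset span_eq_iff)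
    from less.hyps[OF this W fW] obtain B where
      B: "pairwise orthogonal B" "span B = W" "\<And>w. w \<in> B \<Longrightarrow> norm w = 1 \<and> (\<exists>c. f w = c *\<^sub>R w)"
      by blast
    have BW: "B \<subseteq> W" using B(2) span_superset by blast
    have "span (insert v B) = V"
    proof
      show "span (insert v B) \<subseteq> V"
        using BW v less.prems(1) by (intro span_minimal) (auto simp: W_def)
      show "V \<subseteq> span (insert v B)"
      proof
        fix x assume x: "x \<in> V"
        have "x - (x \<bullet> v) *\<^sub>R v \<in> span B"
          unfolding B(2) W_def using x v vv less.prems(1)
          by (auto intro: subspace_diff subspace_scale simp: inner_diff_left)
        then show "x \<in> span (insert v B)" using span_breakdown_eq by blast
      qed
    qed
    moreover have "pairwise orthogonal (insert v B)"
      using B(1) BW by (auto simp: pairwise_insert W_def orthogonal_def inner_commute)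
    ultimately show ?thesis using B(3) v by (intro exI[of _ "insert v B"]) auto
  qed
qed

section \<open>Orthonormal families indexed by the coordinates, and eigensystems\<close>

definition orthonormal :: "('i \<Rightarrow> real^'i) \<Rightarrow> bool" where
  "orthonormal b \<longleftrightarrow> (\<forall>j k. b j \<bullet> b k = (if j = k then 1 else 0))"

text \<open>As \<open>b\<close> and \<open>l\<close> are indexed by the coordinate type,
  \<open>b\<close> has as many members as the dimension and so is a basis, and \<open>l\<close>
  lists the eigenvalues with multiplicity. Zero eigenvalues stay in the list; they record the
  kernel.\<close>

definition eigensystem :: "real^'i^'i \<Rightarrow> ('i \<Rightarrow> real^'i) \<Rightarrow> ('i \<Rightarrow> real) \<Rightarrow> bool" where
  "eigensystem A b l \<longleftrightarrow> orthonormal b \<and> (\<forall>j. A *v b j = l j *\<^sub>R b j)"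

lemma orthonormal_inj: "orthonormal b \<Longrightarrow> inj b"
  unfolding orthonormal_def inj_def by (metis one_neq_zero)

lemma orthonormal_pairwise: "orthonormal b \<Longrightarrow> pairwise orthogonal (b ` J)"
  unfolding orthonormal_def pairwise_def orthogonal_def by (metis imageE)

lemma orthonormal_independent: "orthonormal b \<Longrightarrow> independent (b ` J)"
  using orthonormal_pairwise[of b J]
  by (intro pairwise_orthogonal_independent) (auto simp: orthonormal_def, metis inner_zero_left one_neq_zero)

lemma orthonormal_dim_span: "orthonormal b \<Longrightarrow> dim (span (b ` J)) = card J"
  by (metis orthonormal_independent orthonormal_inj card_image dim_eq_card_independent dim_span
      inj_on_subset subset_UNIV)

lemma orthonormal_expand:
  fixes b :: "'i::finite \<Rightarrow> real^'i"
  assumes "orthonormal b"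
  shows "(\<Sum>j\<in>UNIV. (b j \<bullet> x) *\<^sub>R b j) = x"
proof -
  have "span (range b) = UNIV"
    using orthonormal_dim_span[OF assms, of UNIV] by (simp add: dim_eq_full[symmetric])
  then have "(\<Sum>v\<in>range b. (x \<bullet> v) *\<^sub>R v) = x"
    using assms
    by (intro orthonormal_basis_expand orthonormal_pairwise) (auto simp: orthonormal_def norm_eq_1)
  then show ?thesis
    by (simp add: sum.reindex[OF orthonormal_inj[OF assms]] inner_commute)
qed

lemma orthonormal_inner:
  fixes b :: "'i::finite \<Rightarrow> real^'i"
  assumes "orthonormal b"
  shows "x \<bullet> y = (\<Sum>j\<in>UNIV. (b j \<bullet> x) * (b j \<bullet> y))"
  by (subst (1) orthonormal_expand[OF assms, of x, symmetric]) (simp add: inner_sum_left)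

lemma orthonormal_coord:
  fixes b :: "'i::finite \<Rightarrow> real^'i"
  assumes "orthonormal b"
  shows "b j \<bullet> (\<Sum>k\<in>UNIV. c k *\<^sub>R b k) = c j"
proof -
  have "b j \<bullet> (\<Sum>k\<in>UNIV. c k *\<^sub>R b k) = (\<Sum>k\<in>UNIV. if j = k then c k else 0)"
    unfolding inner_sum_right using assms
    by (intro sum.cong refl) (simp only: orthonormal_def inner_scaleR_right, simp)
  then show ?thesis by simp
qed

lemma orthonormal_eqI:
  fixes b :: "'i::finite \<Rightarrow> real^'i"
  assumes "orthonormal b" "\<And>j. b j \<bullet> x = b j \<bullet> y"
  shows "x = y"
proof -
  have "x = (\<Sum>j\<in>UNIV. (b j \<bullet> x) *\<^sub>R b j)" by (rule orthonormal_expand[OF assms(1), symmetric])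
  also have "\<dots> = y" unfolding assms(2) by (rule orthonormal_expand[OF assms(1)])
  finally show ?thesis .
qed

lemma symmetric_inner:
  fixes A :: "real^'i^'i"
  assumes "transpose A = A"
  shows "(A *v x) \<bullet> y = x \<bullet> (A *v y)"
  by (metis assms dot_lmul_matrix inner_commute vector_transpose_matrix)

theorem symmetric_eigensystem:
  fixes A :: "real^'i^'i"
  assumes "transpose A = A"
  obtains b l where "eigensystem A b l"
proof -
  obtain B where B: "pairwise orthogonal B" "span B = (UNIV :: (real^'i) set)"
    "\<And>v. v \<in> B \<Longrightarrow> norm v = 1 \<and> (\<exists>c. A *v v = c *\<^sub>R v)"
    using self_adjoint_eigenbasis[of "(*v) A" UNIV] symmetric_inner[OF assms] by auto
  have ind: "independent B" using B by (intro pairwise_orthogonal_independent) force+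
  have "card B = CARD('i)"
    by (metis B(2) DIM_cart DIM_real dim_UNIV dim_span ind dim_eq_card_independent mult.right_neutral)
  then obtain b where b: "bij_betw b (UNIV :: 'i set) B"
    using finite_same_card_bij[of "UNIV :: 'i set" B] independent_imp_finite[OF ind] by auto
  define l where "l j = (SOME c. A *v b j = c *\<^sub>R b j)" for j
  have bB: "b j \<in> B" for j using b by (auto simp: bij_betw_def)
  have "A *v b j = l j *\<^sub>R b j" for j
    unfolding l_def using B(3)[OF bB[of j]] by (intro someI_ex[of "\<lambda>c. A *v b j = c *\<^sub>R b j"]) auto
  moreover have "orthonormal b"
    unfolding orthonormal_def
  proof (intro allI)
    fix j k
    show "b j \<bullet> b k = (if j = k then 1 else 0)"
      using B(3)[OF bB[of j]] B(1) bB[of j] bB[of k] bij_betw_imp_inj_on[OF b]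
      by (auto simp: norm_eq_1 pairwise_def orthogonal_def inj_eq)
  qed
  ultimately show thesis by (intro that[of b l]) (auto simp: eigensystem_def)
qed

context
  fixes A :: "real^'i^'i" and b l
  assumes eig: "eigensystem A b l"
begin

lemma eigensystem_orthonormal: "orthonormal b"
  using eig by (simp add: eigensystem_def)

lemma eigensystem_mult: "A *v x = (\<Sum>j\<in>UNIV. (l j * (b j \<bullet> x)) *\<^sub>R b j)"
proof -
  have "A *v x = A *v (\<Sum>j\<in>UNIV. (b j \<bullet> x) *\<^sub>R b j)"
    by (simp add: orthonormal_expand[OF eigensystem_orthonormal])
  also have "\<dots> = (\<Sum>j\<in>UNIV. (b j \<bullet> x) *\<^sub>R (A *v b j))"
    by (simp add: linear_sum[of "(*v) A"] matrix_vector_mult_scaleR)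
  finally show ?thesis using eig by (simp add: eigensystem_def mult.commute)
qed

lemma eigensystem_coord: "b j \<bullet> (A *v x) = l j * (b j \<bullet> x)"
  by (simp add: eigensystem_mult orthonormal_coord[OF eigensystem_orthonormal])

lemma eigensystem_quadratic: "x \<bullet> (A *v y) = (\<Sum>j\<in>UNIV. l j * (b j \<bullet> x) * (b j \<bullet> y))"
  unfolding orthonormal_inner[OF eigensystem_orthonormal, of x "A *v y"]
  by (intro sum.cong refl) (simp only: eigensystem_coord mult_ac)

lemma eigensystem_symmetric: "transpose A = A"
proof -
  have "(A *v x) \<bullet> y = x \<bullet> (A *v y)" for x y
    by (subst inner_commute) (simp add: eigensystem_quadratic mult_ac)
  then have "y \<bullet> (transpose A *v x) = y \<bullet> (A *v x)" for x y
    by (metis dot_lmul_matrix inner_commute vector_transpose_matrix transpose_transpose)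
  then show ?thesis by (subst matrix_eq) (metis vector_eq_ldot)
qed

lemma eigensystem_eigenvalue: "l j = b j \<bullet> (A *v b j)"
  using eigensystem_orthonormal by (simp add: eigensystem_coord orthonormal_def)

lemma eigensystem_subspace: "{x. \<forall>j. j \<notin> J \<longrightarrow> b j \<bullet> x = 0} = span (b ` J)"
proof
  show "span (b ` J) \<subseteq> {x. \<forall>j. j \<notin> J \<longrightarrow> b j \<bullet> x = 0}"
    using eigensystem_orthonormal
    by (intro span_minimal) (auto simp: orthonormal_def subspace_def inner_add_right)
  show "{x. \<forall>j. j \<notin> J \<longrightarrow> b j \<bullet> x = 0} \<subseteq> span (b ` J)"
  proof
    fix x assume x: "x \<in> {x. \<forall>j. j \<notin> J \<longrightarrow> b j \<bullet> x = 0}"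
    have "x = (\<Sum>j\<in>UNIV. (b j \<bullet> x) *\<^sub>R b j)"
      by (simp add: orthonormal_expand[OF eigensystem_orthonormal])
    also have "\<dots> \<in> span (b ` J)"
      using x by (intro span_sum) (metis (mono_tags, lifting) image_eqI mem_Collect_eq scale_zero_left span_base span_scale span_zero)
    finally show "x \<in> span (b ` J)" .
  qed
qed

lemma eigensystem_range: "range ((*v) A) = {x. \<forall>j. l j = 0 \<longrightarrow> b j \<bullet> x = 0}"
proof
  show "range ((*v) A) \<subseteq> {x. \<forall>j. l j = 0 \<longrightarrow> b j \<bullet> x = 0}"
    by (auto simp: eigensystem_coord)
  show "{x. \<forall>j. l j = 0 \<longrightarrow> b j \<bullet> x = 0} \<subseteq> range ((*v) A)"
  proof
    fix x assume x: "x \<in> {x. \<forall>j. l j = 0 \<longrightarrow> b j \<bullet> x = 0}"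
    \<comment> \<open>Where \<open>l j = 0\<close> the quotient is 0 by convention, and so is the
      coordinate \<open>b j \<bullet> x\<close> that it has to reproduce.\<close>
    have "A *v (\<Sum>j\<in>UNIV. ((b j \<bullet> x) / l j) *\<^sub>R b j) = x"
      using x by (intro orthonormal_eqI[OF eigensystem_orthonormal])
        (simp add: eigensystem_coord orthonormal_coord[OF eigensystem_orthonormal])
    then show "x \<in> range ((*v) A)" by (metis rangeI)
  qed
qed

lemma eigensystem_rank: "rank A = card {j. l j \<noteq> 0}"
proof -
  have "range ((*v) A) = span (b ` {j. l j \<noteq> 0})"
    unfolding eigensystem_range eigensystem_subspace[symmetric] by auto
  then show ?thesis
    by (simp only: rank_dim_range orthonormal_dim_span[OF eigensystem_orthonormal])
qed

text \<open>An eigenspace is spanned by the \<open>b j\<close> with that eigenvalue, so its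
  dimension counts indices. Grouping the product over \<open>j\<close> by the value of
  \<open>l j\<close> gives the powers in \<open>pdet\<close>.\<close>

lemma eigensystem_pdet: "pdet A = (\<Prod>j | l j \<noteq> 0. l j)"
proof -
  have E: "{v. A *v v = c *\<^sub>R v} = span (b ` {j. l j = c})" for c
  proof -
    have "A *v v = c *\<^sub>R v \<longleftrightarrow> (\<forall>j. j \<notin> {j. l j = c} \<longrightarrow> b j \<bullet> v = 0)" for v
    proof -
      have "A *v v = c *\<^sub>R v \<longleftrightarrow> (\<forall>j. b j \<bullet> (A *v v) = b j \<bullet> (c *\<^sub>R v))"
        using orthonormal_eqI[OF eigensystem_orthonormal, of "A *v v" "c *\<^sub>R v"] by metis
      also have "\<dots> \<longleftrightarrow> (\<forall>j. j \<notin> {j. l j = c} \<longrightarrow> b j \<bullet> v = 0)"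
        by (auto simp: eigensystem_coord)
      finally show ?thesis .
    qed
    then show ?thesis using eigensystem_subspace[of "{j. l j = c}"] by auto
  qed
  have D: "dim {v. A *v v = c *\<^sub>R v} = card {j. l j = c}" for c
    unfolding E by (rule orthonormal_dim_span[OF eigensystem_orthonormal])
  have ex: "(\<exists>v. v \<noteq> 0 \<and> A *v v = c *\<^sub>R v) \<longleftrightarrow> c \<in> range l" for c
  proof
    assume "\<exists>v. v \<noteq> 0 \<and> A *v v = c *\<^sub>R v"
    then have "span (b ` {j. l j = c}) \<noteq> {0}" using E[of c] by blast
    then have "{j. l j = c} \<noteq> {}" using span_empty by fastforce
    then show "c \<in> range l" by auto
  next
    assume "c \<in> range l"
    then obtain j where j: "c = l j" by auto
    then have "A *v b j = c *\<^sub>R b j" "b j \<noteq> 0"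
      using eig eigensystem_orthonormal by (auto simp: eigensystem_def orthonormal_def) (metis inner_zero_left one_neq_zero)
    then show "\<exists>v. v \<noteq> 0 \<and> A *v v = c *\<^sub>R v" by blast
  qed
  have "pdet A = (\<Prod>c\<in>l ` {j. l j \<noteq> 0}. c ^ card {j. l j = c})"
    unfolding pdet_def D ex by (intro prod.cong) auto
  also have "\<dots> = (\<Prod>c\<in>l ` {j. l j \<noteq> 0}. \<Prod>j | j \<in> {j. l j \<noteq> 0} \<and> l j = c. l j)"
  proof (intro prod.cong refl)
    fix c assume "c \<in> l ` {j. l j \<noteq> 0}"
    then have "{j. j \<in> {j. l j \<noteq> 0} \<and> l j = c} = {j. l j = c}" by auto
    then show "c ^ card {j. l j = c} = (\<Prod>j | j \<in> {j. l j \<noteq> 0} \<and> l j = c. l j)" by simp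
  qed
  also have "\<dots> = (\<Prod>j | l j \<noteq> 0. l j)"
    by (rule prod.image_gen[symmetric]) auto
  finally show ?thesis .
qed

text \<open>The kernel part of the eigenbasis is an admissible \<open>N\<close>. As all admissible
  choices test the same condition by \<open>null_columns_support\<close>, the existential quantifier
  in \<open>gauss_density\<close> becomes a condition on coordinates.\<close>

lemma eigensystem_null_columns: "null_columns A (b ` {j. l j = 0})"
proof -
  have "card (b ` {j. l j = 0}) = card {j. l j = 0}"
    using orthonormal_inj[OF eigensystem_orthonormal] by (simp add: card_image inj_on_subset)
  moreover have "card {j. l j = 0} + card {j. l j \<noteq> 0} = CARD('i)"
    by (subst card_Un_disjoint[symmetric]) (auto intro: arg_cong[where f = card])
  moreover have "b j v* A = l j *\<^sub>R b j" for j
    using eig eigensystem_symmetric unfolding eigensystem_def by (metis vector_transpose_matrix)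
  ultimately show ?thesis
    unfolding null_columns_def eigensystem_rank
    by (auto simp: orthonormal_independent[OF eigensystem_orthonormal])
qed

text \<open>Terms with \<open>l j = 0\<close> vanish in the exponent, because \<open>x / 0 = 0\<close>.\<close>

lemma eigensystem_gauss_density:
  "gauss_density A x = (if \<forall>j. l j = 0 \<longrightarrow> b j \<bullet> x = 0
     then (2 * pi) powr (- (real (card {j. l j \<noteq> 0}) / 2)) * (\<Prod>j | l j \<noteq> 0. l j) powr (- (1 / 2))
        * exp (- (1 / 2) * (\<Sum>j\<in>UNIV. (b j \<bullet> x)\<^sup>2 / l j)) else 0)"
proof -
  have supp: "(\<exists>N. null_columns A N \<and> (\<forall>v\<in>N. v \<bullet> x = 0)) \<longleftrightarrow> (\<forall>j. l j = 0 \<longrightarrow> b j \<bullet> x = 0)"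
    using null_columns_support[OF eigensystem_symmetric, of _ x] eigensystem_null_columns
    by (auto simp: eigensystem_range)
  have "trace (ginv A ** outer x x) = (\<Sum>j\<in>UNIV. (b j \<bullet> x)\<^sup>2 / l j)"
    if x: "\<forall>j. l j = 0 \<longrightarrow> b j \<bullet> x = 0"
  proof -
    obtain u where u: "x = A *v u" using x eigensystem_range by blast
    have "trace (ginv A ** outer x x) = x \<bullet> (ginv A *v x)"
      by (simp add: trace_def outer_def matrix_matrix_mult_def inner_vec_def
          matrix_vector_mult_def sum_distrib_left mult_ac)
    also have "\<dots> = u \<bullet> (A *v (ginv A *v (A *v u)))"
      by (simp add: u symmetric_inner[OF eigensystem_symmetric])
    also have "\<dots> = u \<bullet> (A *v u)"
      using is_ginv_ginv[of A] by (simp add: is_ginv_def matrix_vector_mul_assoc matrix_mul_assoc)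
    also have "\<dots> = (\<Sum>j\<in>UNIV. (b j \<bullet> x)\<^sup>2 / l j)"
      unfolding eigensystem_quadratic
      by (intro sum.cong refl) (simp add: u eigensystem_coord power2_eq_square)
    finally show ?thesis .
  qed
  then show ?thesis
    unfolding gauss_density_def supp eigensystem_rank eigensystem_pdet by simp
qed

lemma eigensystem_pos_semidef: "pos_semidef A \<longleftrightarrow> (\<forall>j. 0 \<le> l j)"
proof
  assume "pos_semidef A"
  then show "\<forall>j. 0 \<le> l j" by (simp add: pos_semidef_def eigensystem_eigenvalue)
next
  assume "\<forall>j. 0 \<le> l j"
  then show "pos_semidef A"
    by (simp add: pos_semidef_def eigensystem_symmetric eigensystem_quadratic sum_nonneg mult.assoc)
qed

lemma eigensystem_pos_def:
  assumes "pos_def A"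
  shows "0 < l j"
proof -
  have "b j \<noteq> 0" using eigensystem_orthonormal unfolding orthonormal_def by (metis inner_zero_left one_neq_zero)
  then show ?thesis using assms by (simp add: pos_def_def eigensystem_eigenvalue)
qed

end

section \<open>Kronecker products and the joint density\<close>

text \<open>The first index is the sampling time and the second the coordinate of an observation,
  which is the layout of \<open>cond_cov\<close>.\<close>

definition kron :: "real^'k^'k \<Rightarrow> real^'m^'m \<Rightarrow> real^('k \<times> 'm)^('k \<times> 'm)" where
  "kron K A = (\<chi> p q. K $ fst p $ fst q * A $ snd p $ snd q)"

definition tensor :: "real^'k \<Rightarrow> real^'m \<Rightarrow> real^('k \<times> 'm)" where
  "tensor u v = (\<chi> p. u $ fst p * v $ snd p)"

lemma sum_UNIV_prod: "(\<Sum>p\<in>UNIV. f p) = (\<Sum>i\<in>UNIV. \<Sum>j\<in>UNIV. f (i, j))"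
  for f :: "'k::finite \<times> 'm::finite \<Rightarrow> 'c::comm_monoid_add"
  by (simp add: sum.cartesian_product UNIV_Times_UNIV)

lemma inner_tensor: "tensor u v \<bullet> y = (\<Sum>i\<in>UNIV. u $ i * (v \<bullet> (\<chi> j. y $ (i, j))))"
  by (simp add: inner_vec_def tensor_def sum_UNIV_prod sum_distrib_left mult_ac)

lemma inner_tensor_tensor: "tensor u v \<bullet> tensor u' v' = (u \<bullet> u') * (v \<bullet> v')"
  by (simp add: inner_vec_def tensor_def sum_UNIV_prod sum_product mult_ac)

lemma kron_mult_tensor: "kron K A *v tensor u v = tensor (K *v u) (A *v v)"
  by (simp add: vec_eq_iff kron_def tensor_def matrix_vector_mult_def sum_UNIV_prod sum_product mult_ac)

lemma tensor_scaleR: "tensor (c *\<^sub>R u) (d *\<^sub>R v) = (c * d) *\<^sub>R tensor u v"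
  by (simp add: vec_eq_iff tensor_def)

lemma eigensystem_kron:
  assumes "eigensystem K u \<kappa>" "eigensystem A v l"
  shows "eigensystem (kron K A) (\<lambda>p. tensor (u (fst p)) (v (snd p))) (\<lambda>p. \<kappa> (fst p) * l (snd p))"
  using assms
  by (auto simp: eigensystem_def orthonormal_def inner_tensor_tensor kron_mult_tensor tensor_scaleR
      prod_eq_iff)

text \<open>The matrix with rows \<open>u i\<close> is orthogonal and diagonalizes \<open>K\<close>;
  its determinant enters twice and has square 1.\<close>

lemma det_eigensystem:
  fixes K :: "real^'i^'i"
  assumes "eigensystem K u \<kappa>"
  shows "det K = (\<Prod>i\<in>UNIV. \<kappa> i)"
proof -
  define Q :: "real^'i^'i" where "Q = (\<chi> i. u i)"
  have on: "orthonormal u" using assms by (simp add: eigensystem_def)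
  have QQ: "Q ** transpose Q = mat 1"
    using on by (simp add: Q_def vec_eq_iff matrix_matrix_mult_def transpose_def mat_def
        inner_vec_def orthonormal_def)
  then have "det Q * det Q = 1" by (metis det_I det_mul det_transpose)
  moreover have "Q ** K ** transpose Q = (\<chi> i j. if i = j then \<kappa> j else 0)"
  proof -
    have "(Q ** K ** transpose Q) $ i $ j = u i \<bullet> (K *v u j)" for i j
      by (simp add: matrix_mul_assoc[symmetric]) 
        (simp add: matrix_matrix_mult_def Q_def transpose_def inner_vec_def matrix_vector_mult_def)
    moreover have "u i \<bullet> (K *v u j) = (if i = j then \<kappa> j else 0)" for i j
      using on assms by (simp add: eigensystem_def orthonormal_def)
    ultimately show ?thesis by (simp add: vec_eq_iff)
  qed
  then have "det (Q ** K ** transpose Q) = (\<Prod>i\<in>UNIV. \<kappa> i)"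
    by (subst det_diagonal) auto
  ultimately show ?thesis by (simp add: det_mul mult_ac)
qed

text \<open>The quadratic form of \<open>K\<^sup>-\<^sup>1 = L\<^sup>T L\<close>, for \<open>L K L\<^sup>T = 1\<close>.\<close>

lemma eigensystem_whitened_quadratic:
  fixes K L :: "real^'k^'k"
  assumes K: "eigensystem K u \<kappa>" and L: "L ** K ** transpose L = mat 1"
  shows "(\<Sum>i\<in>UNIV. (u i \<bullet> s)\<^sup>2 / \<kappa> i) = (L *v s) \<bullet> (L *v s)" and "\<kappa> i \<noteq> 0"
    and "(det L)\<^sup>2 * (\<Prod>i\<in>UNIV. \<kappa> i) = 1"
proof -
  have "K ** transpose L ** L = mat 1"
    using L by (metis matrix_left_right_inverse matrix_mul_assoc)
  \<comment> \<open>\<open>r\<close> is the inverse of \<open>K\<close> applied to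
    \<open>s\<close>.\<close>
  define r where "r = transpose L *v (L *v s)"
  have s: "s = K *v r"
    unfolding r_def by (metis \<open>K ** transpose L ** L = mat 1\<close> matrix_vector_mul_assoc matrix_vector_mul_lid)
  have "(u i \<bullet> s)\<^sup>2 / \<kappa> i = \<kappa> i * (u i \<bullet> r) * (u i \<bullet> r)" for i
    unfolding s eigensystem_coord[OF K] by (simp add: power2_eq_square)
  then have "(\<Sum>i\<in>UNIV. (u i \<bullet> s)\<^sup>2 / \<kappa> i) = r \<bullet> (K *v r)"
    by (simp add: eigensystem_quadratic[OF K])
  also have "\<dots> = r \<bullet> s" by (simp add: s[symmetric])
  also have "\<dots> = (L *v s) \<bullet> (L *v s)" by (simp add: r_def dot_lmul_matrix)
  finally show "(\<Sum>i\<in>UNIV. (u i \<bullet> s)\<^sup>2 / \<kappa> i) = (L *v s) \<bullet> (L *v s)" .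
  have "det (L ** K ** transpose L) = 1" by (simp add: L)
  then show det: "(det L)\<^sup>2 * (\<Prod>i\<in>UNIV. \<kappa> i) = 1"
    by (simp add: det_mul det_eigensystem[OF K] power2_eq_square mult_ac)
  show "\<kappa> i \<noteq> 0"
  proof
    assume "\<kappa> i = 0"
    then have "(\<Prod>i\<in>UNIV. \<kappa> i) = 0" by (intro prod_zero) auto
    then show False using det by (simp only: mult_zero_right zero_neq_one)
  qed
qed

text \<open>Whitening acts on the time index alone. The support of the law is the tensor product of
  the whole time space with the range of \<open>A\<close>; there, applying \<open>L\<close> to the
  time index has determinant \<open>det L\<close> to the power \<open>rank A\<close>, which is the
  factor in front.\<close>

lemma gauss_density_kron:
  fixes K L :: "real^'k^'k" and A :: "real^'m^'m"
  assumes K: "pos_semidef K" and L: "L ** K ** transpose L = mat 1" and A: "pos_semidef A"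
  shows "gauss_density (kron K A) y =
    \<bar>det L\<bar> ^ rank A * (\<Prod>k\<in>UNIV. gauss_density A (\<Sum>i\<in>UNIV. L $ k $ i *\<^sub>R (\<chi> j. y $ (i, j))))"
proof -
  obtain u \<kappa> where u: "eigensystem K u \<kappa>"
    using K symmetric_eigensystem unfolding pos_semidef_def by blast
  obtain v l where v: "eigensystem A v l"
    using A symmetric_eigensystem unfolding pos_semidef_def by blast
  note W = eigensystem_whitened_quadratic[OF u L]
  have l: "0 \<le> l j" for j using A eigensystem_pos_semidef[OF v] by blast
  define Y where "Y i = (\<chi> j. y $ (i, j))" for i
  define Z where "Z k = (\<Sum>i\<in>UNIV. L $ k $ i *\<^sub>R Y i)" for k
  \<comment> \<open>Coordinate \<open>j\<close>, along \<open>v j\<close>, of all observations at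
    once, as a vector over the times: \<open>L\<close> acts on these vectors one \<open>j\<close> at
    a time.\<close>
  define s where "s j = (\<chi> i. v j \<bullet> Y i)" for j
  have vZ: "v j \<bullet> Z k = (L *v s j) $ k" for j k
    by (simp add: Z_def s_def inner_sum_right matrix_vector_mult_def)
  have ten: "tensor (u i) (v j) \<bullet> y = u i \<bullet> s j" for i j
    unfolding inner_tensor s_def Y_def[symmetric] by (simp add: inner_vec_def)
  have inj: "L *v x = 0 \<longleftrightarrow> x = 0" for x
  proof
    assume "L *v x = 0"
    have "(K ** transpose L) ** L = mat 1"
      using L by (metis matrix_left_right_inverse matrix_mul_assoc)
    then have "x = (K ** transpose L) *v (L *v x)" by (simp add: matrix_vector_mul_assoc)
    then show "x = 0" using \<open>L *v x = 0\<close> by simp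
  qed simp
  \<comment> \<open>All \<open>\<kappa> i\<close> are nonzero, so only the zeros of \<open>l\<close>
    count, and for each of them the invertible \<open>L\<close> preserves whether \<open>s j\<close>
    vanishes.\<close>
  have supp: "(\<forall>p. \<kappa> (fst p) * l (snd p) = 0 \<longrightarrow> tensor (u (fst p)) (v (snd p)) \<bullet> y = 0) \<longleftrightarrow>
      (\<forall>k j. l j = 0 \<longrightarrow> v j \<bullet> Z k = 0)"
  proof -
    have "(\<forall>p. \<kappa> (fst p) * l (snd p) = 0 \<longrightarrow> tensor (u (fst p)) (v (snd p)) \<bullet> y = 0) \<longleftrightarrow>
        (\<forall>j. l j = 0 \<longrightarrow> (\<forall>i. u i \<bullet> s j = 0))"
      using W(2) by (auto simp: ten)
    also have "\<dots> \<longleftrightarrow> (\<forall>j. l j = 0 \<longrightarrow> s j = 0)"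
      using orthonormal_eqI[OF eigensystem_orthonormal[OF u], of "s _" 0] by auto
    also have "\<dots> \<longleftrightarrow> (\<forall>j. l j = 0 \<longrightarrow> L *v s j = 0)" by (simp add: inj)
    also have "\<dots> \<longleftrightarrow> (\<forall>k j. l j = 0 \<longrightarrow> v j \<bullet> Z k = 0)" by (auto simp: vec_eq_iff vZ)
    finally show ?thesis .
  qed
  show ?thesis
  proof (cases "\<forall>k j. l j = 0 \<longrightarrow> v j \<bullet> Z k = 0")
    case False
    then obtain k where k: "\<not> (\<forall>j. l j = 0 \<longrightarrow> v j \<bullet> Z k = 0)" by blast
    have "gauss_density A (Z k) = 0"
      unfolding eigensystem_gauss_density[OF v] by (rule if_not_P[OF k])
    then have Z0: "(\<Prod>k\<in>UNIV. gauss_density A (Z k)) = 0" by (intro prod_zero) auto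
    have "gauss_density (kron K A) y = 0"
      unfolding eigensystem_gauss_density[OF eigensystem_kron[OF u v]] supp by (rule if_not_P[OF False])
    then have "gauss_density (kron K A) y = \<bar>det L\<bar> ^ rank A * (\<Prod>k\<in>UNIV. gauss_density A (Z k))"
      unfolding Z0 by simp
    then show ?thesis by (simp only: Z_def Y_def)
  next
    case True
    define J where "J = {j. l j \<noteq> 0}"
    define D where "D = (\<Prod>j\<in>J. l j)"
    have P: "0 < D" unfolding D_def J_def using l by (intro prod_pos) (simp add: less_le)
    have detL: "det L \<noteq> 0" using W(3) by auto
    then have kap: "(\<Prod>i\<in>UNIV. \<kappa> i) = 1 / (det L)\<^sup>2"
      using W(3) by (simp add: field_simps)
    have set: "{p. \<kappa> (fst p) * l (snd p) \<noteq> 0} = UNIV \<times> J"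
      using W(2) by (auto simp: J_def)
    have card: "card {p. \<kappa> (fst p) * l (snd p) \<noteq> 0} = CARD('k) * card J"
      unfolding set by (simp add: card_cartesian_product)
    have "(\<Prod>p | \<kappa> (fst p) * l (snd p) \<noteq> 0. \<kappa> (fst p) * l (snd p))
        = (\<Prod>i\<in>UNIV. \<Prod>j\<in>J. \<kappa> i * l j)"
      unfolding set by (simp add: prod.cartesian_product case_prod_beta)
    also have "\<dots> = (1 / (det L)\<^sup>2) ^ card J * D ^ CARD('k)"
      by (simp add: prod.distrib D_def kap[symmetric] prod_power_distrib)
    finally have pd: "(\<Prod>p | \<kappa> (fst p) * l (snd p) \<noteq> 0. \<kappa> (fst p) * l (snd p)) =
        (1 / (det L)\<^sup>2) ^ card J * D ^ CARD('k)" .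
    \<comment> \<open>The determinant of \<open>K\<close> is \<open>1 / (det L)\<^sup>2\<close>;
      with exponent \<open>card J\<close> and then -1/2 it becomes the Jacobian factor.\<close>
    have "((1 / (det L)\<^sup>2) ^ card J * D ^ CARD('k)) powr (- (1 / 2)) =
        ((1 / (det L)\<^sup>2) ^ card J) powr (- (1 / 2)) * (D ^ CARD('k)) powr (- (1 / 2))"
      by (rule powr_mult)
    moreover have "((1 / (det L)\<^sup>2) ^ card J) powr (- (1 / 2)) = \<bar>det L\<bar> ^ card J"
    proof -
      have "1 / (det L)\<^sup>2 = \<bar>det L\<bar> powr (-2)"
        using detL by (simp add: powr_minus powr_numeral divide_inverse)
      then show ?thesis
        using detL by (simp add: powr_realpow[symmetric] powr_powr)
    qed
    moreover have "(D ^ CARD('k)) powr (- (1 / 2)) = (D powr (- (1 / 2))) ^ CARD('k)"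
      using P by (simp add: powr_realpow[symmetric] powr_powr mult.commute)
    ultimately have pw: "((1 / (det L)\<^sup>2) ^ card J * D ^ CARD('k)) powr (- (1 / 2)) =
        \<bar>det L\<bar> ^ card J * (D powr (- (1 / 2))) ^ CARD('k)" by simp
    have tp: "(2 * pi) powr (- (real (CARD('k) * card J) / 2)) =
        ((2 * pi) powr (- (real (card J) / 2))) ^ CARD('k)"
      by (simp add: powr_realpow[symmetric] powr_powr mult.commute)
    have "(\<Sum>p\<in>UNIV. (tensor (u (fst p)) (v (snd p)) \<bullet> y)\<^sup>2 / (\<kappa> (fst p) * l (snd p)))
        = (\<Sum>i\<in>UNIV. \<Sum>j\<in>UNIV. (u i \<bullet> s j)\<^sup>2 / \<kappa> i / l j)"
      by (simp add: sum_UNIV_prod ten)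
    \<comment> \<open>For fixed \<open>j\<close> the sum over the time eigenvectors is the inverse
      quadratic form of \<open>K\<close> at \<open>s j\<close>, that is, the squared norm of the
      whitened vector.\<close>
    also have "\<dots> = (\<Sum>j\<in>UNIV. (\<Sum>i\<in>UNIV. (u i \<bullet> s j)\<^sup>2 / \<kappa> i) / l j)"
      by (subst sum.swap) (simp add: sum_divide_distrib)
    also have "\<dots> = (\<Sum>j\<in>UNIV. (\<Sum>k\<in>UNIV. (v j \<bullet> Z k)\<^sup>2) / l j)"
      unfolding W(1) vZ by (simp add: inner_vec_def[of "L *v _"] power2_eq_square)
    also have "\<dots> = (\<Sum>k\<in>UNIV. \<Sum>j\<in>UNIV. (v j \<bullet> Z k)\<^sup>2 / l j)"
      unfolding sum_divide_distrib by (rule sum.swap)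
    finally have q: "(\<Sum>p\<in>UNIV. (tensor (u (fst p)) (v (snd p)) \<bullet> y)\<^sup>2 / (\<kappa> (fst p) * l (snd p)))
        = (\<Sum>k\<in>UNIV. \<Sum>j\<in>UNIV. (v j \<bullet> Z k)\<^sup>2 / l j)" .
    have e: "exp (- (1 / 2) * (\<Sum>k\<in>UNIV. \<Sum>j\<in>UNIV. (v j \<bullet> Z k)\<^sup>2 / l j)) =
        (\<Prod>k\<in>UNIV. exp (- (1 / 2) * (\<Sum>j\<in>UNIV. (v j \<bullet> Z k)\<^sup>2 / l j)))"
      by (simp add: sum_distrib_left exp_sum)
    have "gauss_density (kron K A) y =
        (2 * pi) powr (- (real (CARD('k) * card J) / 2)) * ((1 / (det L)\<^sup>2) ^ card J * D ^ CARD('k)) powr (- (1 / 2))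
        * exp (- (1 / 2) * (\<Sum>k\<in>UNIV. \<Sum>j\<in>UNIV. (v j \<bullet> Z k)\<^sup>2 / l j))"
      using True unfolding eigensystem_gauss_density[OF eigensystem_kron[OF u v]] supp pd card q by simp
    also have "\<dots> = \<bar>det L\<bar> ^ card J * (\<Prod>k\<in>UNIV. (2 * pi) powr (- (real (card J) / 2)) * D powr (- (1 / 2))
        * exp (- (1 / 2) * (\<Sum>j\<in>UNIV. (v j \<bullet> Z k)\<^sup>2 / l j)))"
      unfolding pw tp e by (simp add: prod.distrib power_mult_distrib)
    also have "\<dots> = \<bar>det L\<bar> ^ rank A * (\<Prod>k\<in>UNIV. gauss_density A (Z k))"
      using True unfolding eigensystem_gauss_density[OF v] eigensystem_rank[OF v] J_def[symmetric] D_def[symmetric]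
      by (intro arg_cong2[where f = "(*)"] refl prod.cong) simp
    finally show ?thesis by (simp add: Z_def Y_def)
  qed
qed

text \<open>A triangular determinant over an index type without order: \<open>g\<close> supplies the
  order. A permutation with nonzero product never lowers \<open>g\<close>, but it preserves the sum
  of the values of \<open>g\<close>, so it fixes \<open>g\<close> pointwise and is the
  identity.\<close>

lemma det_eq_prod_diag_if_graded:
  fixes L :: "real^'k^'k" and g :: "'k \<Rightarrow> nat"
  assumes inj: "inj g" and L: "\<And>i j. L $ i $ j \<noteq> 0 \<Longrightarrow> g i \<le> g j"
  shows "det L = (\<Prod>i\<in>UNIV. L $ i $ i)"
proof -
  have "(\<Prod>i\<in>UNIV. L $ i $ p i) = 0" if p: "p permutes UNIV" "p \<noteq> id" for p :: "'k \<Rightarrow> 'k"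
  proof (rule ccontr)
    assume "(\<Prod>i\<in>UNIV. L $ i $ p i) \<noteq> 0"
    then have le: "g i \<le> g (p i)" for i using L by (simp add: prod_zero_iff)
    have "(\<Sum>i\<in>UNIV. g (p i)) = (\<Sum>i\<in>UNIV. g i)"
      using sum.permute[OF p(1), of g] by (simp add: comp_def)
    then have "g (p i) = g i" for i
      using sum_mono_inv[of g UNIV "\<lambda>i. g (p i)" i] le by simp
    then show False using inj p(2) by (auto simp: inj_def fun_eq_iff)
  qed
  then have "det L = (\<Sum>p\<in>{id}. of_int (sign p) * (\<Prod>i\<in>UNIV. L $ i $ p i))"
    unfolding det_def by (intro sum.mono_neutral_right) (auto simp: finite_permutations permutes_id)
  then show ?thesis by (simp add: sign_id)
qed

lemma scaleR_matrix_mult: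
  fixes A :: "real^'j^'i" and B :: "real^'k^'j"
  shows "(c *\<^sub>R A) ** B = c *\<^sub>R (A ** B)" "A ** (c *\<^sub>R B) = c *\<^sub>R (A ** B)"
  by (simp_all add: vec_eq_iff matrix_matrix_mult_def sum_distrib_left mult_ac)

lemma matrix_diff_vec: "(A - B) *v x = A *v x - B *v x" for A B :: "real^'j^'i"
  by (simp add: vec_eq_iff matrix_vector_mult_def left_diff_distrib sum_subtractf)

lemma scaleR_matrix_vec: "(c *\<^sub>R A) *v x = c *\<^sub>R (A *v x)" for A :: "real^'j^'i"
  by (simp add: vec_eq_iff matrix_vector_mult_def sum_distrib_left mult_ac)

lemma transpose_diff: "transpose (A - B) = transpose A - transpose B" for A B :: "real^'j^'i"
  by (simp add: vec_eq_iff transpose_def)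

lemma transpose_scaleR: "transpose (c *\<^sub>R A) = c *\<^sub>R transpose A" for A :: "real^'j^'i"
  by (simp add: vec_eq_iff transpose_def)

lemma pos_semidef_scaleR: "pos_semidef A \<Longrightarrow> 0 \<le> c \<Longrightarrow> pos_semidef (c *\<^sub>R A)"
  by (simp add: pos_semidef_def transpose_scaleR scaleR_matrix_vec)

text \<open>\<open>a - u b\<close> is a convex combination of \<open>a\<close> and
  \<open>a - \<tau> b\<close>, so the two end points decide.\<close>

lemma closed_params_iff:
  assumes "0 < \<tau>"
  shows "(a, b) \<in> closed_params \<tau> \<longleftrightarrow> pos_semidef a \<and> pos_semidef (\<tau> *\<^sub>R (a - \<tau> *\<^sub>R b))"
proof
  assume *: "(a, b) \<in> closed_params \<tau>"
  then have "pos_semidef (a - s *\<^sub>R b)" if "s \<in> {0..\<tau>}" for s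
    using that unfolding closed_params_def by blast
  from this[of 0] this[of \<tau>] assms
  show "pos_semidef a \<and> pos_semidef (\<tau> *\<^sub>R (a - \<tau> *\<^sub>R b))"
    by (simp add: pos_semidef_scaleR)
next
  assume "pos_semidef a \<and> pos_semidef (\<tau> *\<^sub>R (a - \<tau> *\<^sub>R b))"
  then have a: "pos_semidef a" and s: "pos_semidef (\<tau> *\<^sub>R (a - \<tau> *\<^sub>R b))" by auto
  have ta: "transpose a = a" using a by (simp add: pos_semidef_def)
  have tb: "transpose b = b"
    using s ta assms by (simp add: pos_semidef_def transpose_diff transpose_scaleR)
  have "pos_semidef (a - u *\<^sub>R b)" if u: "u \<in> {0..\<tau>}" for u
  proof -
    have "0 \<le> v \<bullet> ((a - u *\<^sub>R b) *v v)" for v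
    proof -
      have 1: "0 \<le> v \<bullet> (a *v v)" using a by (simp add: pos_semidef_def)
      have "0 \<le> v \<bullet> ((\<tau> *\<^sub>R (a - \<tau> *\<^sub>R b)) *v v)" using s by (simp add: pos_semidef_def)
      then have 2: "0 \<le> v \<bullet> (a *v v) - \<tau> * (v \<bullet> (b *v v))"
        using assms by (simp add: scaleR_matrix_vec matrix_diff_vec inner_diff_right zero_le_mult_iff)
      have "u * (\<tau> * (v \<bullet> (b *v v))) \<le> u * (v \<bullet> (a *v v))"
        using u 2 by (intro mult_left_mono) auto
      also have "\<dots> \<le> \<tau> * (v \<bullet> (a *v v))"
        using u 1 by (intro mult_right_mono) auto
      finally have "\<tau> * (u * (v \<bullet> (b *v v))) \<le> \<tau> * (v \<bullet> (a *v v))" by (simp add: mult_ac)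
      then show ?thesis
        using assms by (simp add: scaleR_matrix_vec matrix_diff_vec inner_diff_right)
    qed
    then show ?thesis using ta tb by (simp add: pos_semidef_def transpose_diff transpose_scaleR)
  qed
  then show "(a, b) \<in> closed_params \<tau>" using tb by (simp add: closed_params_def)
qed

section \<open>Sampling times and the whitening of a Brownian bridge\<close>

locale sampling_times =
  fixes n :: nat and t :: "nat \<Rightarrow> real" and e :: "'k::finite \<Rightarrow> nat"
  assumes n_ge_2: "2 \<le> n" and t_1_pos: "0 < t 1"
    and t_less_Suc: "\<And>i. 1 \<le> i \<Longrightarrow> i < n \<Longrightarrow> t i < t (i + 1)"
    and bij_e: "bij_betw e UNIV {1..<n}"
begin

lemma t_less: "1 \<le> i \<Longrightarrow> i < j \<Longrightarrow> j \<le> n \<Longrightarrow> t i < t j"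
proof (induction j)
  case (Suc j)
  then show ?case using t_less_Suc[of j] by (cases "i = j") auto
qed simp

lemma t_le: "1 \<le> i \<Longrightarrow> i \<le> j \<Longrightarrow> j \<le> n \<Longrightarrow> t i \<le> t j"
  using t_less[of i j] by (cases "i = j") auto

lemma t_pos: "1 \<le> i \<Longrightarrow> i \<le> n \<Longrightarrow> 0 < t i"
  using t_le[of 1 i] t_1_pos by simp

lemma t_n_pos: "0 < t n" using t_pos[of n] n_ge_2 by simp

lemma e_range: "1 \<le> e i" "e i < n"
  using bij_e by (auto simp: bij_betw_def)

lemma e_inj: "e i = e j \<longleftrightarrow> i = j"
  using bij_e by (auto simp: bij_betw_def inj_eq)

text \<open>The normalization in the estimator: \<open>step_var i\<close> times
  \<open>\<alpha>\<close> is the covariance of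
  \<open>t (i + 1) X (t i) - t i X (t (i + 1))\<close>.\<close>

definition step_var :: "nat \<Rightarrow> real" where
  "step_var i = t i * t (i + 1) * (t (i + 1) - t i)"

lemma step_var_pos: "1 \<le> i \<Longrightarrow> i < n \<Longrightarrow> 0 < step_var i"
  using t_pos[of i] t_pos[of "i + 1"] t_less_Suc[of i] by (simp add: step_var_def)

text \<open>The covariance of a Brownian bridge on \<open>[0, t n]\<close> at the times \<open>t i\<close>.\<close>

definition bridge_cov :: "nat \<Rightarrow> nat \<Rightarrow> real" where
  "bridge_cov i j = min (t i) (t j) - t i * t j / t n"

lemma bridge_cov_n: "1 \<le> i \<Longrightarrow> i \<le> n \<Longrightarrow> bridge_cov n i = 0"
  using t_le[of i n] t_n_pos by (simp add: bridge_cov_def)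

definition bridge :: "real^'k^'k" where
  "bridge = (\<chi> i j. bridge_cov (e i) (e j))"

text \<open>The coefficients of \<open>incr\<close> as a matrix. The row of the time with index
  \<open>n - 1\<close> has only its diagonal entry, because \<open>n\<close> is not in the range of
  \<open>e\<close>.\<close>

definition whiten :: "real^'k^'k" where
  "whiten = (\<chi> i j. (if e j = e i then t (e i + 1) else if e j = e i + 1 then - t (e i) else 0)
     / sqrt (step_var (e i)))"

text \<open>A function that vanishes at \<open>n\<close> makes up for the missing column, so that
  the row of \<open>n - 1\<close> has the same form as the others.\<close>

lemma sum_whiten:
  fixes f :: "nat \<Rightarrow> 'v::real_vector"
  assumes "f n = 0"
  shows "(\<Sum>j\<in>UNIV. whiten $ i $ j *\<^sub>R f (e j)) =
    (1 / sqrt (step_var (e i))) *\<^sub>R (t (e i + 1) *\<^sub>R f (e i) - t (e i) *\<^sub>R f (e i + 1))"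
proof -
  define k where "k = e i"
  have k: "1 \<le> k" "k < n" using e_range by (auto simp: k_def)
  let ?g = "\<lambda>j. ((if j = k then t (k + 1) else if j = k + 1 then - t k else 0) / sqrt (step_var k)) *\<^sub>R f j"
  have "(\<Sum>j\<in>UNIV. whiten $ i $ j *\<^sub>R f (e j)) = (\<Sum>j\<in>UNIV. ?g (e j))"
    unfolding whiten_def k_def by simp
  also have "\<dots> = (\<Sum>j\<in>{1..<n}. ?g j)"
    by (rule sum.reindex_bij_betw[OF bij_e])
  also have "\<dots> = (\<Sum>j\<in>{1..n}. ?g j)"
    using assms by (intro sum.mono_neutral_left) auto
  also have "\<dots> = (\<Sum>j\<in>{k, k + 1}. ?g j)"
    using k by (intro sum.mono_neutral_right) auto
  also have "\<dots> = (1 / sqrt (step_var k)) *\<^sub>R (t (k + 1) *\<^sub>R f k - t k *\<^sub>R f (k + 1))"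
    by (simp add: scaleR_diff_right)
  finally show ?thesis by (simp add: k_def)
qed

text \<open>After one whitening difference the covariance is proportional to \<open>t j\<close> up
  to index \<open>i\<close> and zero afterwards. Both the density and the moments of the increments
  rest on this computation.\<close>

lemma min_step_left:
  assumes "1 \<le> i" "i < n" "1 \<le> j" "j \<le> n"
  shows "t (i + 1) * min (t i) (t j) - t i * min (t (i + 1)) (t j) =
    (if j \<le> i then t j * (t (i + 1) - t i) else 0)"
  using assms t_le[of j i] t_le[of j "i + 1"] t_le[of i j] t_le[of "i + 1" j]
  by (cases "j \<le> i") (auto simp: min_absorb1 min_absorb2 algebra_simps)

text \<open>Up to \<open>i\<close> the function \<open>h\<close> is proportional to
  \<open>t\<close>, which the difference annihilates, and beyond \<open>i\<close> it is zero. Only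
  the drop from \<open>i\<close> to \<open>i + 1\<close> survives, and the normalization makes its
  contribution 1.\<close>

lemma min_step_right:
  assumes "1 \<le> i" "i < n" "1 \<le> j" "j < n"
  defines "h \<equiv> \<lambda>j. if j \<le> i then t j * (t (i + 1) - t i) / sqrt (step_var i) else 0"
  shows "(t (j + 1) * h j - t j * h (j + 1)) / sqrt (step_var j) = (if i = j then 1 else 0)"
proof -
  have "t (i + 1) * (t i * (t (i + 1) - t i)) / (sqrt (step_var i) * sqrt (step_var i)) = 1"
  proof -
    have "sqrt (step_var i) * sqrt (step_var i) = step_var i"
      using step_var_pos[of i] assms by simp
    moreover have "t (i + 1) * (t i * (t (i + 1) - t i)) = step_var i" by (simp add: step_var_def)
    ultimately show ?thesis using step_var_pos[of i] assms by simp
  qed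
  then show ?thesis by (auto simp: h_def)
qed

lemma whiten_bridge: "whiten ** bridge ** transpose whiten = mat 1"
proof -
  \<comment> \<open>The clause for \<open>n\<close> meets the hypothesis of
    \<open>sum_whiten\<close>. It agrees with the general formula below, as the bridge is pinned at
    \<open>t n\<close>.\<close>
  define h where "h i j = (if j = n then 0 else
    (t (i + 1) * bridge_cov i j - t i * bridge_cov (i + 1) j) / sqrt (step_var i))" for i j
  have WB: "(whiten ** bridge) $ i $ j = h (e i) (e j)" for i j
    using sum_whiten[of "\<lambda>k. bridge_cov k (e j)" i] bridge_cov_n[of "e j"] e_range[of j]
    by (simp add: matrix_matrix_mult_def bridge_def h_def)
  have WBW: "(whiten ** bridge ** transpose whiten) $ i $ j =
      (t (e j + 1) * h (e i) (e j) - t (e j) * h (e i) (e j + 1)) / sqrt (step_var (e j))" for i j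
    using sum_whiten[of "\<lambda>k. h (e i) k" j] WB
    by (simp add: matrix_matrix_mult_def[of "whiten ** bridge"] transpose_def mult.commute h_def)
  have h: "h i j = (if j \<le> i then t j * (t (i + 1) - t i) / sqrt (step_var i) else 0)"
    if "1 \<le> i" "i < n" "1 \<le> j" "j \<le> n" for i j
  proof -
    have "t (i + 1) * bridge_cov i j - t i * bridge_cov (i + 1) j =
        t (i + 1) * min (t i) (t j) - t i * min (t (i + 1)) (t j)"
      by (simp add: bridge_cov_def algebra_simps)
    also have "\<dots> = (if j \<le> i then t j * (t (i + 1) - t i) else 0)"
      using that by (rule min_step_left)
    finally show ?thesis using that by (simp add: h_def)
  qed
  have D: "(t (j + 1) * h i j - t j * h i (j + 1)) / sqrt (step_var j) = (if i = j then 1 else 0)"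
    if "1 \<le> i" "i < n" "1 \<le> j" "j < n" for i j
    using min_step_right[OF that] that by (simp only: h le_add2 Suc_eq_plus1[symmetric] Suc_le_eq le_SucI One_nat_def less_imp_le)
  have "(whiten ** bridge ** transpose whiten) $ i $ j = (if i = j then 1 else 0)" for i j
    unfolding WBW D[OF e_range e_range] e_inj ..
  then show ?thesis by (simp add: vec_eq_iff mat_def)
qed

text \<open>By \<open>whiten_bridge\<close> the inverse of \<open>bridge\<close> is
  \<open>transpose whiten ** whiten\<close>, so the quadratic form is a squared norm.\<close>

lemma bridge_pos_semidef: "pos_semidef bridge"
proof -
  have sym: "transpose bridge = bridge"
    by (simp add: vec_eq_iff transpose_def bridge_def bridge_cov_def min.commute mult.commute)
  have "0 \<le> v \<bullet> (bridge *v v)" for v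
  proof -
    have "(transpose whiten ** whiten) ** bridge = mat 1"
      using whiten_bridge by (metis matrix_left_right_inverse matrix_mul_assoc)
    then have v: "v = transpose whiten *v (whiten *v (bridge *v v))"
      by (simp only: matrix_vector_mul_assoc matrix_mul_assoc matrix_vector_mul_lid)
    have "v \<bullet> (bridge *v v) = (whiten *v (bridge *v v)) \<bullet> (whiten *v (bridge *v v))"
      by (subst v) (simp add: dot_lmul_matrix)
    then show ?thesis by simp
  qed
  then show ?thesis using sym by (simp add: pos_semidef_def)
qed

text \<open>Graded by \<open>e\<close>, the matrix is upper triangular.\<close>

lemma det_whiten: "det whiten = (\<Prod>i\<in>{1..<n}. t (i + 1) / sqrt (step_var i))"
proof -
  have "det whiten = (\<Prod>i\<in>UNIV. whiten $ i $ i)"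
    using e_inj by (intro det_eq_prod_diag_if_graded[of e]) (auto simp: whiten_def inj_def split: if_splits)
  also have "\<dots> = (\<Prod>i\<in>UNIV. t (e i + 1) / sqrt (step_var (e i)))" by (simp add: whiten_def)
  also have "\<dots> = (\<Prod>i\<in>{1..<n}. t (i + 1) / sqrt (step_var i))"
    by (rule prod.reindex_bij_betw[OF bij_e, of "\<lambda>i. t (i + 1) / sqrt (step_var i)"])
  finally show ?thesis .
qed

lemma det_whiten_pos: "0 < det whiten"
  unfolding det_whiten using t_pos step_var_pos by (intro prod_pos) auto

definition incr :: "(nat \<Rightarrow> real^'m) \<Rightarrow> nat \<Rightarrow> real^'m" where
  "incr x i = (if i = n then x n
     else (1 / sqrt (step_var i)) *\<^sub>R (t (i + 1) *\<^sub>R x i - t i *\<^sub>R x (i + 1)))"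

lemma cov_kernel_n: "cov_kernel a b (t n) (t n) = t n *\<^sub>R (a - t n *\<^sub>R b)"
  by (simp add: cov_kernel_def)

text \<open>Proportionality to \<open>\<Sigma>\<close> is the reason that the conditional mean is
  \<open>(t i / t n) x n\<close> on the range of \<open>\<Sigma>\<close>, for every generalized
  inverse.\<close>

lemma cov_kernel_left_n:
  assumes "1 \<le> i" "i < n"
  shows "cov_kernel a b (t i) (t n) = (t i / t n) *\<^sub>R cov_kernel a b (t n) (t n)"
    and "cov_kernel a b (t n) (t i) = (t i / t n) *\<^sub>R cov_kernel a b (t n) (t n)"
  using t_less[of i n] t_n_pos assms by (auto simp: cov_kernel_def)

text \<open>By proportionality the correction is \<open>t i * t j / (t n)\<^sup>2\<close> times
  \<open>\<Sigma> \<Sigma>\<^sup>- \<Sigma> = \<Sigma>\<close>. The terms with \<open>b\<close>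
  cancel, and the covariance of a bridge is left as coefficient of \<open>a\<close>.\<close>

lemma cond_cov_eq: "cond_cov e n t a b = kron bridge a"
proof -
  let ?S = "cov_kernel a b (t n) (t n)"
  have "cov_kernel a b (t i) (t j) - cov_kernel a b (t i) (t n) ** ginv ?S ** cov_kernel a b (t n) (t j)
      = bridge_cov i j *\<^sub>R a" if "1 \<le> i" "i < n" "1 \<le> j" "j < n" for i j
  proof -
    have "?S ** ginv ?S ** ?S = ?S" using is_ginv_ginv[of ?S] by (simp add: is_ginv_def)
    then have P: "cov_kernel a b (t i) (t n) ** ginv ?S ** cov_kernel a b (t n) (t j)
        = (t i / t n * (t j / t n)) *\<^sub>R ?S"
      using that by (simp only: cov_kernel_left_n scaleR_matrix_mult scaleR_scaleR mult.commute)
    show ?thesis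
      unfolding P unfolding cov_kernel_n using t_n_pos
      by (simp add: bridge_cov_def cov_kernel_def min_def vec_eq_iff field_simps)
  qed
  then show ?thesis
    using e_range by (simp add: cond_cov_def kron_def bridge_def vec_eq_iff)
qed

theorem joint_density_eq:
  assumes ab: "(a, b) \<in> closed_params (t n)"
  shows "joint_density e n t a b x =
    det whiten ^ rank a * (\<Prod>i\<in>{1..<n}. gauss_density a (incr x i))
      * gauss_density (t n *\<^sub>R (a - t n *\<^sub>R b)) (x n)"
proof -
  let ?S = "cov_kernel a b (t n) (t n)"
  have a: "pos_semidef a" and S: "pos_semidef ?S"
    using ab closed_params_iff[OF t_n_pos] by (auto simp: cov_kernel_n)
  have tS: "transpose ?S = ?S" using S by (simp add: pos_semidef_def)
  show ?thesis
  \<comment> \<open>Outside the range of \<open>\<Sigma>\<close> both sides vanish through their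
    last factor; inside it \<open>\<Sigma> \<Sigma>\<^sup>-\<close> fixes
    \<open>x n\<close>.\<close>
  proof (cases "x n \<in> range ((*v) ?S)")
    case False
    then have "gauss_density ?S (x n) = 0"
      using null_columns_support[OF tS] by (auto simp: gauss_density_def)
    then show ?thesis by (simp add: joint_density_def cov_kernel_n)
  next
    case True
    then obtain u where u: "x n = ?S *v u" by auto
    have g: "?S *v (ginv ?S *v x n) = x n"
      using is_ginv_ginv[of ?S] by (simp add: u is_ginv_def matrix_vector_mul_assoc matrix_mul_assoc)
    \<comment> \<open>The residual from the conditional mean, extended to \<open>n\<close>, where it
      vanishes.\<close>
    define f where "f i = x i - (t i / t n) *\<^sub>R x n" for i
    have fn: "f n = 0" using t_n_pos by (simp add: f_def)
    let ?y = "(\<chi> p. x (e (fst p)) $ snd p) - cond_mean e n t a b (x n)"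
    have y: "(\<chi> j. ?y $ (i, j)) = f (e i)" for i
      using e_range[of i] g
      by (simp add: vec_eq_iff cond_mean_def f_def cov_kernel_left_n scaleR_matrix_vec)
    have z: "(\<Sum>i\<in>UNIV. whiten $ k $ i *\<^sub>R f (e i)) = incr x (e k)" for k
    proof -
      \<comment> \<open>The conditional mean is linear in the time, and the whitening difference
        annihilates such terms.\<close>
      have "t (e k + 1) *\<^sub>R f (e k) - t (e k) *\<^sub>R f (e k + 1) =
          t (e k + 1) *\<^sub>R x (e k) - t (e k) *\<^sub>R x (e k + 1)"
        by (simp add: f_def algebra_simps)
      then show ?thesis
        using e_range[of k] by (simp add: sum_whiten[of f, OF fn] incr_def)
    qed
    have "cond_density e n t a b x = \<bar>det whiten\<bar> ^ rank a * (\<Prod>k\<in>UNIV. gauss_density a (incr x (e k)))"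
      unfolding cond_density_def cond_cov_eq gauss_density_kron[OF bridge_pos_semidef whiten_bridge a] y z
      by simp
    also have "(\<Prod>k\<in>UNIV. gauss_density a (incr x (e k))) = (\<Prod>i\<in>{1..<n}. gauss_density a (incr x i))"
      by (rule prod.reindex_bij_betw[OF bij_e])
    finally show ?thesis
      using det_whiten_pos by (simp add: joint_density_def cov_kernel_n)
  qed
qed

end

section \<open>Maximum likelihood for one covariance matrix\<close>

lemma outer_mult_vec: "outer x y *v v = (y \<bullet> v) *\<^sub>R x"
  by (simp add: vec_eq_iff outer_def matrix_vector_mult_def inner_vec_def sum_distrib_left mult_ac)

lemma matrix_sum_vec: "(\<Sum>i\<in>I. A i) *v v = (\<Sum>i\<in>I. A i *v v)" for A :: "'a \<Rightarrow> real^'j^'i"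
  by (induction I rule: infinite_finite_induct) (simp_all add: matrix_vector_mult_add_rdistrib)

lemma eigensystem_spectral:
  fixes w :: "'i::finite \<Rightarrow> real^'i"
  assumes "orthonormal w"
  shows "eigensystem (\<Sum>k\<in>UNIV. c k *\<^sub>R outer (w k) (w k)) w c"
proof -
  have "(\<Sum>k\<in>UNIV. c k *\<^sub>R outer (w k) (w k)) *v w j = c j *\<^sub>R w j" for j
  proof -
    have "(\<Sum>k\<in>UNIV. c k *\<^sub>R outer (w k) (w k)) *v w j = (\<Sum>k\<in>UNIV. if k = j then c k *\<^sub>R w k else 0)"
      unfolding matrix_sum_vec using assms
      by (intro sum.cong refl) (simp add: scaleR_matrix_vec outer_mult_vec orthonormal_def)
    then show ?thesis by simp
  qed
  then show ?thesis using assms by (simp add: eigensystem_def)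
qed

lemma eigensystem_unique:
  assumes "eigensystem A b l" "eigensystem B b l"
  shows "A = B"
  unfolding matrix_eq[of A] by (simp add: eigensystem_mult[OF assms(1)] eigensystem_mult[OF assms(2)])

definition lik :: "'s set \<Rightarrow> ('s \<Rightarrow> real^'i) \<Rightarrow> real^'i^'i \<Rightarrow> real" where
  "lik I z a = (\<Prod>i\<in>I. gauss_density a (z i))"

text \<open>Second moments about 0, since the mean is known; hence the division by
  \<open>card I\<close>.\<close>

definition emp_cov :: "'s set \<Rightarrow> ('s \<Rightarrow> real^'i) \<Rightarrow> real^'i^'i" where
  "emp_cov I z = (1 / real (card I)) *\<^sub>R (\<Sum>i\<in>I. outer (z i) (z i))"

lemma gauss_density_nonneg: "0 \<le> gauss_density S x"
  by (simp add: gauss_density_def)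

lemma lik_nonneg: "0 \<le> lik I z a"
  unfolding lik_def by (intro prod_nonneg gauss_density_nonneg)

context
  fixes I :: "'s set" and z :: "'s \<Rightarrow> real^'i"
  assumes I: "finite I" "I \<noteq> {}"
begin

lemma card_I_pos: "0 < real (card I)"
  using I by (simp add: card_gt_0_iff)

lemma emp_cov_quadratic: "v \<bullet> (emp_cov I z *v v) = (\<Sum>i\<in>I. (v \<bullet> z i)\<^sup>2) / card I"
  by (simp add: emp_cov_def scaleR_matrix_vec matrix_sum_vec outer_mult_vec inner_sum_right
      power2_eq_square inner_commute sum_divide_distrib)

lemma pos_semidef_emp_cov: "pos_semidef (emp_cov I z)"
proof -
  have "transpose (emp_cov I z) = emp_cov I z"
    by (simp add: emp_cov_def transpose_def outer_def vec_eq_iff mult.commute)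
  then show ?thesis
    unfolding pos_semidef_def emp_cov_quadratic by (simp add: sum_nonneg)
qed

lemma emp_cov_kernel:
  assumes "v \<bullet> (emp_cov I z *v v) = 0" "i \<in> I"
  shows "v \<bullet> z i = 0"
proof -
  have "(\<Sum>i\<in>I. (v \<bullet> z i)\<^sup>2) = 0"
    using assms(1) card_I_pos by (simp add: emp_cov_quadratic)
  then show ?thesis using assms(2) I by (subst (asm) sum_nonneg_eq_0_iff) auto
qed

text \<open>In an eigenbasis of \<open>a\<close> the log-likelihood is explicit and sees the sample
  only through \<open>emp_cov\<close>. The last sum is the trace of the empirical covariance times
  the inverse of \<open>a\<close> on its range.\<close>

lemma ln_lik:
  assumes a: "pos_semidef a" "eigensystem a v l"
    and supp: "\<And>i j. i \<in> I \<Longrightarrow> l j = 0 \<Longrightarrow> v j \<bullet> z i = 0"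
  shows "0 < lik I z a"
    and "ln (lik I z a) = - (real (card I) / 2) * (real (rank a) * ln (2 * pi) + (\<Sum>j | l j \<noteq> 0. ln (l j))
      + (\<Sum>j | l j \<noteq> 0. (v j \<bullet> (emp_cov I z *v v j)) / l j))"
proof -
  let ?J = "{j. l j \<noteq> 0}"
  have l: "0 < l j" if "l j \<noteq> 0" for j
    using a(1) that by (simp add: eigensystem_pos_semidef[OF a(2)] less_le)
  let ?c = "(2 * pi) powr (- (real (rank a) / 2)) * (\<Prod>j\<in>?J. l j) powr (- (1 / 2))"
  have g: "gauss_density a (z i) = ?c * exp (- (1 / 2) * (\<Sum>j\<in>UNIV. (v j \<bullet> z i)\<^sup>2 / l j))" if "i \<in> I" for i
    using supp[OF that] unfolding eigensystem_gauss_density[OF a(2)] eigensystem_rank[OF a(2)] by simp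
  have P: "0 < (\<Prod>j\<in>?J. l j)" using l by (intro prod_pos) auto
  have c: "0 < ?c" using P by simp
  have pos: "0 < gauss_density a (z i)" if "i \<in> I" for i
    unfolding g[OF that] using c by simp
  then show "0 < lik I z a" unfolding lik_def by (intro prod_pos) auto
  have lnc: "ln ?c = - (1 / 2) * (real (rank a) * ln (2 * pi) + (\<Sum>j\<in>?J. ln (l j)))"
  proof -
    have "ln (\<Prod>j\<in>?J. l j) = (\<Sum>j\<in>?J. ln (l j))" using l by (intro ln_prod) auto
    then show ?thesis using P by (subst ln_mult) (auto simp: ln_powr algebra_simps)
  qed
  have "ln (lik I z a) = (\<Sum>i\<in>I. ln (gauss_density a (z i)))"
    unfolding lik_def using I by (intro ln_prod) (auto dest: pos)
  also have "\<dots> = (\<Sum>i\<in>I. ln ?c - (1 / 2) * (\<Sum>j\<in>UNIV. (v j \<bullet> z i)\<^sup>2 / l j))"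
  proof (intro sum.cong refl)
    fix i assume "i \<in> I"
    show "ln (gauss_density a (z i)) = ln ?c - (1 / 2) * (\<Sum>j\<in>UNIV. (v j \<bullet> z i)\<^sup>2 / l j)"
      unfolding g[OF \<open>i \<in> I\<close>] using c by (subst ln_mult) auto
  qed
  also have "\<dots> = card I * ln ?c - (1 / 2) * (\<Sum>i\<in>I. \<Sum>j\<in>UNIV. (v j \<bullet> z i)\<^sup>2 / l j)"
    by (simp add: sum_subtractf sum_distrib_left)
  also have "(\<Sum>i\<in>I. \<Sum>j\<in>UNIV. (v j \<bullet> z i)\<^sup>2 / l j) = (\<Sum>j\<in>UNIV. (\<Sum>i\<in>I. (v j \<bullet> z i)\<^sup>2) / l j)"
    by (subst sum.swap) (simp add: sum_divide_distrib)
  also have "\<dots> = (\<Sum>j\<in>UNIV. card I * ((v j \<bullet> (emp_cov I z *v v j)) / l j))"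
    using card_I_pos by (simp add: emp_cov_quadratic)
  also have "\<dots> = card I * (\<Sum>j\<in>UNIV. (v j \<bullet> (emp_cov I z *v v j)) / l j)"
    by (rule sum_distrib_left[symmetric])
  \<comment> \<open>Zero eigenvalues drop out, because division by 0 gives 0.\<close>
  also have "(\<Sum>j\<in>UNIV. (v j \<bullet> (emp_cov I z *v v j)) / l j) = (\<Sum>j\<in>?J. (v j \<bullet> (emp_cov I z *v v j)) / l j)"
    by (intro sum.mono_neutral_right) auto
  finally show "ln (lik I z a) = - (real (card I) / 2) * (real (rank a) * ln (2 * pi) + (\<Sum>j\<in>?J. ln (l j))
      + (\<Sum>j\<in>?J. (v j \<bullet> (emp_cov I z *v v j)) / l j))"
    unfolding lnc by (simp add: algebra_simps)
qed

lemma lik_pos_iff: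
  assumes a: "pos_semidef a" "eigensystem a v l"
  shows "0 < lik I z a \<longleftrightarrow> (\<forall>i\<in>I. \<forall>j. l j = 0 \<longrightarrow> v j \<bullet> z i = 0)"
proof
  assume "\<forall>i\<in>I. \<forall>j. l j = 0 \<longrightarrow> v j \<bullet> z i = 0"
  then show "0 < lik I z a" using ln_lik(1)[OF a] by blast
next
  assume "0 < lik I z a"
  then have "gauss_density a (z i) \<noteq> 0" if "i \<in> I" for i
    using that I prod_zero[of I "\<lambda>i. gauss_density a (z i)"] unfolding lik_def by fastforce
  then show "\<forall>i\<in>I. \<forall>j. l j = 0 \<longrightarrow> v j \<bullet> z i = 0"
    unfolding eigensystem_gauss_density[OF a(2)] by metis
qed

text \<open>Positive likelihood means that all samples lie in the range of \<open>a\<close>, and the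
  empirical covariance maps into their span.\<close>

lemma lik_pos_range:
  assumes a: "pos_semidef a" and pos: "0 < lik I z a"
  shows "range ((*v) (emp_cov I z)) \<subseteq> range ((*v) a)"
proof -
  obtain v l where v: "eigensystem a v l"
    using a symmetric_eigensystem unfolding pos_semidef_def by blast
  have "v j \<bullet> (emp_cov I z *v x) = 0" if "l j = 0" for j x
    using pos that unfolding lik_pos_iff[OF a v]
    by (simp add: emp_cov_def scaleR_matrix_vec matrix_sum_vec outer_mult_vec inner_sum_right)
  then show ?thesis unfolding eigensystem_range[OF v] by auto
qed

text \<open>Together with an upper bound on the rank this leaves only competitors of equal
  rank.\<close>

lemma lik_pos_rank:
  assumes a: "pos_semidef a" and pos: "0 < lik I z a"
  shows "rank (emp_cov I z) \<le> rank a"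
  unfolding rank_dim_range by (intro dim_subset lik_pos_range assms)

text \<open>A null vector of the empirical covariance is orthogonal to every sample, so the support
  condition holds in the singular case as well.\<close>

lemma lik_emp_cov_pos: "0 < lik I z (emp_cov I z)"
proof -
  obtain w \<mu> where w: "eigensystem (emp_cov I z) w \<mu>"
    using pos_semidef_emp_cov symmetric_eigensystem unfolding pos_semidef_def by blast
  show ?thesis
    unfolding lik_pos_iff[OF pos_semidef_emp_cov w]
    using emp_cov_kernel eigensystem_eigenvalue[OF w] by metis
qed

text \<open>With eigenvectors \<open>v j\<close>, \<open>w k\<close> of \<open>a\<close> and of the empirical covariance, the numbers
  \<open>(v j \<bullet> w k)\<^sup>2\<close> form a doubly stochastic matrix, and the difference of the log-likelihoods is their
  sum weighted with terms \<open>x - 1 - ln x \<ge> 0\<close>, where \<open>x = \<mu> k / l j\<close>.\<close>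

lemma lik_le_equal_rank:
  assumes a: "pos_semidef a" and pos: "0 < lik I z a" and rank: "rank a = rank (emp_cov I z)"
  shows "lik I z a \<le> lik I z (emp_cov I z)"
    and "lik I z a = lik I z (emp_cov I z) \<Longrightarrow> a = emp_cov I z"
proof -
  let ?H = "emp_cov I z"
  obtain v l where v: "eigensystem a v l"
    using a symmetric_eigensystem unfolding pos_semidef_def by blast
  obtain w \<mu> where w: "eigensystem ?H w \<mu>"
    using pos_semidef_emp_cov symmetric_eigensystem unfolding pos_semidef_def by blast
  define J where "J = {j. l j \<noteq> 0}"
  define K where "K = {k. \<mu> k \<noteq> 0}"
  have l: "0 < l j" if "j \<in> J" for j
    using a that by (simp add: J_def eigensystem_pos_semidef[OF v] less_le)
  have \<mu>: "0 < \<mu> k" if "k \<in> K" for k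
    using pos_semidef_emp_cov that by (simp add: K_def eigensystem_pos_semidef[OF w] less_le)
  have "range ((*v) ?H) = range ((*v) a)"
  proof (rule subspace_dim_equal)
    show "subspace (range ((*v) ?H))" "subspace (range ((*v) a))"
      by (intro linear_subspace_image; simp)+
    show "range ((*v) ?H) \<subseteq> range ((*v) a)" by (rule lik_pos_range[OF a pos])
    show "dim (range ((*v) a)) \<le> dim (range ((*v) ?H))"
      using rank by (simp add: rank_dim_range)
  qed
  \<comment> \<open>Equal rank has turned the inclusion of ranges into equality; \<open>R\<close>
    translates the support condition from one eigenbasis to the other.\<close>
  then have R: "(\<forall>j. l j = 0 \<longrightarrow> v j \<bullet> x = 0) \<longleftrightarrow> (\<forall>k. \<mu> k = 0 \<longrightarrow> w k \<bullet> x = 0)" for x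
    unfolding eigensystem_range[OF v] eigensystem_range[OF w] by blast
  note vo = eigensystem_orthonormal[OF v] and wo = eigensystem_orthonormal[OF w]
  \<comment> \<open>Vectors in the common range are orthogonal to those in the common kernel, so
    \<open>p\<close> restricted to \<open>J\<close> and \<open>K\<close> is already doubly
    stochastic.\<close>
  have vw: "v j \<bullet> w k = 0" if "j \<in> J \<and> k \<notin> K \<or> j \<notin> J \<and> k \<in> K" for j k
  proof (cases "j \<in> J")
    case True
    then have "\<forall>j'. l j' = 0 \<longrightarrow> v j' \<bullet> v j = 0" using vo by (auto simp: J_def orthonormal_def)
    then show ?thesis using True that by (simp add: R K_def inner_commute)
  next
    case False
    then have "k \<in> K" using that by auto
    then have "\<forall>k'. \<mu> k' = 0 \<longrightarrow> w k' \<bullet> w k = 0" using wo by (auto simp: K_def orthonormal_def)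
    then show ?thesis using False by (simp add: R[symmetric] J_def)
  qed
  define p where "p j k = (v j \<bullet> w k)\<^sup>2" for j k
  have p0: "0 \<le> p j k" for j k by (simp add: p_def)
  have sumK: "(\<Sum>k\<in>K. p j k) = 1" if "j \<in> J" for j
  proof -
    have "(\<Sum>k\<in>K. p j k) = (\<Sum>k\<in>UNIV. p j k)"
      using vw that by (intro sum.mono_neutral_left) (auto simp: p_def)
    also have "\<dots> = v j \<bullet> v j"
      unfolding orthonormal_inner[OF wo, of "v j" "v j"] by (simp add: p_def power2_eq_square inner_commute)
    finally show ?thesis using vo by (simp add: orthonormal_def)
  qed
  have sumJ: "(\<Sum>j\<in>J. p j k) = 1" if "k \<in> K" for k
  proof -
    have "(\<Sum>j\<in>J. p j k) = (\<Sum>j\<in>UNIV. p j k)"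
      using vw that by (intro sum.mono_neutral_left) (auto simp: p_def)
    also have "\<dots> = w k \<bullet> w k"
      unfolding orthonormal_inner[OF vo, of "w k" "w k"] by (simp add: p_def power2_eq_square)
    finally show ?thesis using wo by (simp add: orthonormal_def)
  qed
  have q: "v j \<bullet> (?H *v v j) = (\<Sum>k\<in>K. \<mu> k * p j k)" for j
    unfolding eigensystem_quadratic[OF w]
    by (intro sum.mono_neutral_cong_right) (auto simp: K_def p_def power2_eq_square inner_commute)
  let ?\<phi> = "\<lambda>x::real. x - 1 - ln x"
  have "(\<Sum>j\<in>J. \<Sum>k\<in>K. p j k * ?\<phi> (\<mu> k / l j)) =
      (\<Sum>j\<in>J. \<Sum>k\<in>K. \<mu> k * p j k / l j + p j k * ln (l j) - p j k - p j k * ln (\<mu> k))"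
  proof (intro sum.cong refl)
    fix j k assume "j \<in> J" "k \<in> K"
    then show "p j k * ?\<phi> (\<mu> k / l j) = \<mu> k * p j k / l j + p j k * ln (l j) - p j k - p j k * ln (\<mu> k)"
      using l[of j] \<mu>[of k] by (simp add: ln_div algebra_simps)
  qed
  also have "\<dots> = (\<Sum>j\<in>J. (v j \<bullet> (?H *v v j)) / l j) + (\<Sum>j\<in>J. (\<Sum>k\<in>K. p j k) * ln (l j))
      - (\<Sum>j\<in>J. \<Sum>k\<in>K. p j k) - (\<Sum>j\<in>J. \<Sum>k\<in>K. p j k * ln (\<mu> k))"
    by (simp add: q sum.distrib sum_subtractf sum_divide_distrib sum_distrib_right)
  also have "(\<Sum>j\<in>J. \<Sum>k\<in>K. p j k * ln (\<mu> k)) = (\<Sum>k\<in>K. (\<Sum>j\<in>J. p j k) * ln (\<mu> k))"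
    by (subst sum.swap) (simp add: sum_distrib_right)
  finally have D: "(\<Sum>j\<in>J. \<Sum>k\<in>K. p j k * ?\<phi> (\<mu> k / l j)) =
      (\<Sum>j\<in>J. (v j \<bullet> (?H *v v j)) / l j) + (\<Sum>j\<in>J. ln (l j)) - card J - (\<Sum>k\<in>K. ln (\<mu> k))"
    using sumK sumJ by simp
  have rJ: "rank a = card J" and rK: "rank ?H = card K"
    using eigensystem_rank[OF v] eigensystem_rank[OF w] by (auto simp: J_def K_def)
  \<comment> \<open>For the empirical covariance itself the trace term is the rank, which cancels
    against \<open>card J\<close> in \<open>D\<close>.\<close>
  have "(\<Sum>k\<in>K. (w k \<bullet> (?H *v w k)) / \<mu> k) = card K"
    unfolding eigensystem_eigenvalue[OF w, symmetric] by (simp add: K_def)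
  then have lnH: "ln (lik I z ?H) = - (real (card I) / 2) * (real (card K) * ln (2 * pi) + (\<Sum>k\<in>K. ln (\<mu> k)) + card K)"
    using ln_lik(2)[OF pos_semidef_emp_cov w] lik_emp_cov_pos lik_pos_iff[OF pos_semidef_emp_cov w]
    by (simp add: rK K_def)
  have lna: "ln (lik I z a) = - (real (card I) / 2) * (real (card J) * ln (2 * pi) + (\<Sum>j\<in>J. ln (l j))
      + (\<Sum>j\<in>J. (v j \<bullet> (?H *v v j)) / l j))"
    using ln_lik(2)[OF a v] pos lik_pos_iff[OF a v] by (simp add: rJ J_def)
  have diff: "ln (lik I z ?H) - ln (lik I z a) = (card I / 2) * (\<Sum>j\<in>J. \<Sum>k\<in>K. p j k * ?\<phi> (\<mu> k / l j))"
    unfolding D lnH lna using rank rJ rK by (simp add: algebra_simps)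
  have phi: "0 \<le> p j k * ?\<phi> (\<mu> k / l j)" if "j \<in> J" "k \<in> K" for j k
    using ln_le_minus_one[of "\<mu> k / l j"] l[of j] \<mu>[of k] p0 that by (intro mult_nonneg_nonneg) auto
  have "0 \<le> ln (lik I z ?H) - ln (lik I z a)"
    unfolding diff by (intro mult_nonneg_nonneg sum_nonneg phi) auto
  then show "lik I z a \<le> lik I z ?H"
    using pos lik_emp_cov_pos by simp
  show "a = ?H" if eq: "lik I z a = lik I z ?H"
  proof -
    have "(\<Sum>j\<in>J. \<Sum>k\<in>K. p j k * ?\<phi> (\<mu> k / l j)) = 0" using diff eq card_I_pos by simp
    then have z0: "p j k * ?\<phi> (\<mu> k / l j) = 0" if "j \<in> J" "k \<in> K" for j k
      using that phi by (simp add: sum_nonneg_eq_0_iff sum_nonneg)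
    \<comment> \<open>\<open>ln x = x - 1\<close> only at \<open>x = 1\<close>, so eigenvalues agree
      wherever the eigenvectors are not orthogonal. In the coordinates given by \<open>v\<close>
      this says that \<open>w k\<close> is an eigenvector of \<open>a\<close> for
      \<open>\<mu> k\<close>.\<close>
    have "(v j \<bullet> w k) * l j = (v j \<bullet> w k) * \<mu> k" for j k
    proof (cases "v j \<bullet> w k = 0")
      case False
      then consider "j \<in> J" "k \<in> K" | "j \<notin> J" "k \<notin> K" using vw by blast
      then show ?thesis
      proof cases
        case 1
        then have "ln (\<mu> k / l j) = \<mu> k / l j - 1" using z0[OF 1] False by (simp add: p_def)
        then have "\<mu> k / l j = 1" using l \<mu> 1 by (intro ln_eq_minus_one) auto
        then show ?thesis using l[OF 1(1)] by simp
      qed (simp add: J_def K_def)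
    qed simp
    then have "a *v w k = \<mu> k *\<^sub>R w k" for k
      by (intro orthonormal_eqI[OF vo]) (simp add: eigensystem_coord[OF v] mult.commute)
    then have "eigensystem a w \<mu>" using wo by (simp add: eigensystem_def)
    then show ?thesis using w by (rule eigensystem_unique)
  qed
qed

lemma lik_le:
  assumes a: "pos_semidef a" and rank: "rank a \<le> rank (emp_cov I z)"
  shows "lik I z a \<le> lik I z (emp_cov I z)"
proof (cases "0 < lik I z a")
  case True
  then show ?thesis using lik_le_equal_rank(1)[OF a] lik_pos_rank[OF a] rank by simp
next
  case False
  then show ?thesis using lik_emp_cov_pos by simp
qed

text \<open>Above the rank of the empirical covariance the likelihood is unbounded: let the additional
  eigenvalues tend to \<open>0\<close>.\<close>

lemma lik_improve:
  assumes a: "pos_semidef a" and pos: "0 < lik I z a" and rank: "rank (emp_cov I z) < rank a"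
  obtains a' where "pos_semidef a'" "rank a' = rank a" "lik I z a < lik I z a'"
proof -
  let ?H = "emp_cov I z"
  obtain w \<mu> where w: "eigensystem ?H w \<mu>"
    using pos_semidef_emp_cov symmetric_eigensystem unfolding pos_semidef_def by blast
  note wo = eigensystem_orthonormal[OF w]
  define K where "K = {k. \<mu> k \<noteq> 0}"
  have rK: "rank ?H = card K" using eigensystem_rank[OF w] by (simp add: K_def)
  have \<mu>: "0 \<le> \<mu> k" for k
    using pos_semidef_emp_cov by (simp add: eigensystem_pos_semidef[OF w])
  have "rank a - card K \<le> card (- K)"
    using rank_bound[of a] by (simp add: Compl_eq_Diff_UNIV card_Diff_subset)
  \<comment> \<open>Directions in the kernel of the empirical covariance that fill its rank up to
    that of \<open>a\<close>.\<close>
  then obtain E where E: "E \<subseteq> - K" "card E = rank a - card K" "finite E"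
    using obtain_subset_with_card_n by metis
  have cE: "0 < real (card E)" using E(2) rank rK by simp
  \<comment> \<open>\<open>c\<close> solves \<open>ln (lik I z a') = ln (lik I z a) + 1\<close> for
    the sum of the logarithms of the added eigenvalues. These are all equal, which gives
    \<open>\<epsilon>\<close>.\<close>
  define c where "c = - 2 / real (card I) * (ln (lik I z a) + 1)
      - (real (rank a) * ln (2 * pi) + (\<Sum>k\<in>K. ln (\<mu> k)) + real (card K))"
  define \<epsilon> where "\<epsilon> = exp (c / card E)"
  define l where "l k = (if k \<in> E then \<epsilon> else \<mu> k)" for k
  define a' where "a' = (\<Sum>k\<in>UNIV. l k *\<^sub>R outer (w k) (w k))"
  have a': "eigensystem a' w l" unfolding a'_def by (rule eigensystem_spectral[OF wo])
  have \<epsilon>: "0 < \<epsilon>" by (simp add: \<epsilon>_def)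
  have psd: "pos_semidef a'"
    unfolding eigensystem_pos_semidef[OF a'] using \<mu> \<epsilon> by (simp add: l_def)
  have J: "{j. l j \<noteq> 0} = K \<union> E" using \<epsilon> by (auto simp: l_def K_def)
  have KE: "K \<inter> E = {}" using E by auto
  have r: "rank a' = rank a"
    unfolding eigensystem_rank[OF a'] J using KE E rank rK by (simp add: card_Un_disjoint)
  have lK: "l k = \<mu> k" if "k \<in> K" for k using that KE by (auto simp: l_def)
  have lE: "l k = \<epsilon>" if "k \<in> E" for k using that by (simp add: l_def)
  have supp: "w j \<bullet> z i = 0" if "i \<in> I" "l j = 0" for i j
  proof -
    have "j \<notin> K \<union> E" using that J by blast
    then have "\<mu> j = 0" by (simp add: K_def)
    then show ?thesis using emp_cov_kernel that(1) eigensystem_eigenvalue[OF w] by metis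
  qed
  have "(\<Sum>j\<in>K \<union> E. ln (l j)) = (\<Sum>k\<in>K. ln (\<mu> k)) + c"
    using KE E(3) cE lK lE by (subst sum.union_disjoint) (auto simp: \<epsilon>_def)
  \<comment> \<open>The added directions carry no empirical variance, so their eigenvalue enters the
    logarithms only.\<close>
  moreover have "(\<Sum>j\<in>K \<union> E. (w j \<bullet> (?H *v w j)) / l j) = card K"
  proof -
    have "(\<Sum>j\<in>K \<union> E. (w j \<bullet> (?H *v w j)) / l j) = (\<Sum>j\<in>K. 1) + (\<Sum>j\<in>E. 0)"
      unfolding eigensystem_eigenvalue[OF w, symmetric]
    proof (subst sum.union_disjoint)
      show "(\<Sum>j\<in>K. \<mu> j / l j) + (\<Sum>j\<in>E. \<mu> j / l j) = (\<Sum>j\<in>K. 1) + (\<Sum>j\<in>E. 0)"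
        using E(1) lK by (intro arg_cong2[where f = "(+)"] sum.cong) (auto simp: K_def)
    qed (use KE E(3) in auto)
    then show ?thesis by simp
  qed
  ultimately have "ln (lik I z a') = - (real (card I) / 2) *
      (real (rank a) * ln (2 * pi) + ((\<Sum>k\<in>K. ln (\<mu> k)) + c) + card K)"
    using ln_lik(2)[OF psd a' supp] by (simp only: J r)
  also have "\<dots> = ln (lik I z a) + 1"
    using card_I_pos by (simp add: c_def field_simps)
  finally have "ln (lik I z a) < ln (lik I z a')" by simp
  then have "lik I z a < lik I z a'" using pos ln_lik(1)[OF psd a' supp] by simp
  then show thesis using that psd r by blast
qed

end

section \<open>The maximum likelihood estimators\<close>

lemma emp_cov_singleton: "emp_cov {i} z = outer (z i) (z i)"
  by (simp add: emp_cov_def)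

context sampling_times
begin

lemma alpha_hat_eq: "alpha_hat n t x = emp_cov {1..<n} (incr x)"
proof -
  have "{1..n - 1} = {1..<n}" using n_ge_2 by auto
  then show ?thesis
    unfolding alpha_hat_def emp_cov_def
    by (intro arg_cong2[where f = "(*\<^sub>R)"] sum.cong)
      (use step_var_pos in \<open>auto simp: incr_def step_var_def outer_def vec_eq_iff real_sqrt_mult_self less_imp_le divide_simps\<close>)
qed

text \<open>This is where \<open>beta_hat\<close> comes from: it solves
  \<open>t n (a - t n b) = x n (x n)\<^sup>T\<close> for \<open>b\<close> at
  \<open>a = alpha_hat n t x\<close>.\<close>

lemma sigma_hat_eq:
  "t n *\<^sub>R (alpha_hat n t x - t n *\<^sub>R beta_hat n t x) = emp_cov {n} x"
  using t_n_pos
  by (simp add: beta_hat_def emp_cov_singleton scaleR_diff_right power2_eq_square)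

lemma joint_density_lik:
  assumes "(a, b) \<in> closed_params (t n)"
  shows "joint_density e n t a b x =
    det whiten ^ rank a * lik {1..<n} (incr x) a * lik {n} x (t n *\<^sub>R (a - t n *\<^sub>R b))"
  using joint_density_eq[OF assms] by (simp add: lik_def)

lemma samples_nonempty: "finite {1..<n}" "{1..<n} \<noteq> {}" "finite {n}" "{n} \<noteq> {}"
  using n_ge_2 by auto

lemma estimates_closed_params: "(alpha_hat n t x, beta_hat n t x) \<in> closed_params (t n)"
  unfolding closed_params_iff[OF t_n_pos] sigma_hat_eq unfolding alpha_hat_eq
  by (intro conjI pos_semidef_emp_cov samples_nonempty)

lemma joint_density_estimates_pos: "0 < joint_density e n t (alpha_hat n t x) (beta_hat n t x) x"
  unfolding joint_density_lik[OF estimates_closed_params] sigma_hat_eq unfolding alpha_hat_eq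
  by (intro mult_pos_pos zero_less_power det_whiten_pos lik_emp_cov_pos samples_nonempty)

lemma joint_density_le_estimates:
  assumes ab: "(a, b) \<in> closed_params (t n)"
    and rank: "rank a \<le> rank (alpha_hat n t x)"
      "rank (t n *\<^sub>R (a - t n *\<^sub>R b)) \<le> rank (emp_cov {n} x)"
  shows "joint_density e n t a b x \<le> joint_density e n t (alpha_hat n t x) (beta_hat n t x) x"
proof (cases "0 < lik {1..<n} (incr x) a")
  case True
  have psd: "pos_semidef a" "pos_semidef (t n *\<^sub>R (a - t n *\<^sub>R b))"
    using ab closed_params_iff[OF t_n_pos] by auto
  \<comment> \<open>The ranks have to agree exactly: the power of \<open>det whiten\<close> depends
    on the rank, and \<open>det whiten\<close> may lie on either side of 1.\<close>
  have r: "rank a = rank (emp_cov {1..<n} (incr x))"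
    using lik_pos_rank[OF samples_nonempty(1,2) psd(1) True] rank(1) by (simp add: alpha_hat_eq)
  show ?thesis
    unfolding joint_density_lik[OF estimates_closed_params] sigma_hat_eq joint_density_lik[OF ab]
    unfolding alpha_hat_eq r
    by (intro mult_mono mult_left_mono lik_le samples_nonempty psd rank(2) lik_nonneg mult_nonneg_nonneg
        zero_le_power less_imp_le[OF det_whiten_pos] eq_refl[OF r])
next
  case False
  then have "lik {1..<n} (incr x) a = 0" using lik_nonneg[of "{1..<n}" "incr x" a] by simp
  then show ?thesis
    using joint_density_lik[OF ab] joint_density_estimates_pos[of x] by simp
qed

lemma max_likelihood_estimates: "max_likelihood e n t (alpha_hat n t) (beta_hat n t)"
  unfolding max_likelihood_def cov_kernel_n sigma_hat_eq
  using estimates_closed_params joint_density_estimates_pos joint_density_le_estimates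
  by auto

text \<open>The rank of a maximizer is bounded below by positivity of its likelihood and above by
  \<open>lik_improve\<close>. At the rank of the estimate each factor is at most its own maximum, so
  optimality of the product forces optimality of both.\<close>

lemma max_likelihood_unique:
  assumes mle: "max_likelihood e n t A B"
  shows "A x = alpha_hat n t x" and "B x = beta_hat n t x"
proof -
  define a where "a = A x"
  define b where "b = B x"
  define S where "S = t n *\<^sub>R (a - t n *\<^sub>R b)"
  let ?z = "incr x" and ?I = "{1..<n}"
  have ab: "(a, b) \<in> closed_params (t n)" and pos: "0 < joint_density e n t a b x"
    and max: "\<And>a' b'. (a', b') \<in> closed_params (t n) \<Longrightarrow> rank a' \<le> rank a \<Longrightarrow>
      rank (t n *\<^sub>R (a' - t n *\<^sub>R b')) \<le> rank S \<Longrightarrow>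
      joint_density e n t a' b' x \<le> joint_density e n t a b x"
    using mle unfolding max_likelihood_def a_def b_def S_def cov_kernel_n by auto
  have psd: "pos_semidef a" "pos_semidef S"
    using ab closed_params_iff[OF t_n_pos] by (auto simp: S_def)
  have d: "0 < det whiten ^ k" for k using det_whiten_pos by simp
  have J: "joint_density e n t a b x = det whiten ^ rank a * lik ?I ?z a * lik {n} x S"
    unfolding S_def by (rule joint_density_lik[OF ab])
  have l1: "0 < lik ?I ?z a" and l2: "0 < lik {n} x S"
    using pos d[of "rank a"] lik_nonneg[of ?I ?z a] lik_nonneg[of "{n}" x S]
    unfolding J by (auto simp: zero_less_mult_iff)
  \<comment> \<open>In the coordinates \<open>(a', S')\<close> the two factors vary independently;
    \<open>b'\<close> is recovered from \<open>S' = t n (a' - t n b')\<close>.\<close>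
  have max': "det whiten ^ rank a' * lik ?I ?z a' * lik {n} x S' \<le>
      det whiten ^ rank a * lik ?I ?z a * lik {n} x S"
    if "pos_semidef a'" "pos_semidef S'" "rank a' \<le> rank a" "rank S' \<le> rank S" for a' S'
  proof -
    define b' where "b' = (1 / t n) *\<^sub>R (a' - (1 / t n) *\<^sub>R S')"
    have S': "t n *\<^sub>R (a' - t n *\<^sub>R b') = S'"
      using t_n_pos by (simp add: b'_def)
    have "(a', b') \<in> closed_params (t n)"
      unfolding closed_params_iff[OF t_n_pos] S' using that by simp
    from max[OF this] joint_density_lik[OF this] show ?thesis
      unfolding S' J using that by simp
  qed
  have r1: "rank a = rank (emp_cov ?I ?z)"
  proof (rule ccontr)
    assume "rank a \<noteq> rank (emp_cov ?I ?z)"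
    then have "rank (emp_cov ?I ?z) < rank a"
      using lik_pos_rank[OF samples_nonempty(1,2) psd(1) l1] by simp
    then obtain a' where a': "pos_semidef a'" "rank a' = rank a" "lik ?I ?z a < lik ?I ?z a'"
      using lik_improve[OF samples_nonempty(1,2) psd(1) l1] by metis
    have "det whiten ^ rank a * lik ?I ?z a * lik {n} x S < det whiten ^ rank a * lik ?I ?z a' * lik {n} x S"
      using a'(3) l2 d[of "rank a"] by (intro mult_strict_right_mono mult_strict_left_mono)
    then show False using max'[OF a'(1) psd(2)] a'(2) by simp
  qed
  have r2: "rank S = rank (emp_cov {n} x)"
  proof (rule ccontr)
    assume "rank S \<noteq> rank (emp_cov {n} x)"
    then have "rank (emp_cov {n} x) < rank S"
      using lik_pos_rank[OF samples_nonempty(3,4) psd(2) l2] by simp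
    then obtain S' where S': "pos_semidef S'" "rank S' = rank S" "lik {n} x S < lik {n} x S'"
      using lik_improve[OF samples_nonempty(3,4) psd(2) l2] by metis
    have "det whiten ^ rank a * lik ?I ?z a * lik {n} x S < det whiten ^ rank a * lik ?I ?z a * lik {n} x S'"
      using S'(3) l1 d[of "rank a"] by (intro mult_strict_left_mono mult_pos_pos)
    then show False using max'[OF psd(1) S'(1)] S'(2) by simp
  qed
  let ?H = "emp_cov ?I ?z" and ?G = "emp_cov {n} x"
  have le1: "lik ?I ?z a \<le> lik ?I ?z ?H"
    by (rule lik_le_equal_rank(1)[OF samples_nonempty(1,2) psd(1) l1 r1])
  have le2: "lik {n} x S \<le> lik {n} x ?G"
    by (rule lik_le_equal_rank(1)[OF samples_nonempty(3,4) psd(2) l2 r2])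
  \<comment> \<open>By \<open>r1\<close> and \<open>r2\<close> the estimate is itself an admissible
    competitor.\<close>
  have "lik ?I ?z ?H * lik {n} x ?G \<le> lik ?I ?z a * lik {n} x S"
    using max'[OF pos_semidef_emp_cov[OF samples_nonempty(1,2)] pos_semidef_emp_cov[OF samples_nonempty(3,4)], of ?z x]
      r1 r2 d[of "rank a"] by (simp add: mult.assoc)
  moreover have "lik ?I ?z a * lik {n} x S < lik ?I ?z ?H * lik {n} x ?G"
    if "lik ?I ?z a \<noteq> lik ?I ?z ?H \<or> lik {n} x S \<noteq> lik {n} x ?G"
  proof (cases "lik ?I ?z a = lik ?I ?z ?H")
    case True
    then show ?thesis using that le1 le2 l1 by simp
  next
    case False
    then show ?thesis using le1 le2 l1 l2 by (intro mult_less_le_imp_less) auto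
  qed
  ultimately have eq: "lik ?I ?z a = lik ?I ?z ?H" "lik {n} x S = lik {n} x ?G" by fastforce+
  have "a = ?H"
    by (rule lik_le_equal_rank(2)[OF samples_nonempty(1,2) psd(1) l1 r1 eq(1)])
  then show A: "A x = alpha_hat n t x" by (simp add: a_def alpha_hat_eq)
  have "S = ?G"
    by (rule lik_le_equal_rank(2)[OF samples_nonempty(3,4) psd(2) l2 r2 eq(2)])
  then have "t n *\<^sub>R (a - t n *\<^sub>R b) = t n *\<^sub>R (a - t n *\<^sub>R beta_hat n t x)"
    unfolding S_def sigma_hat_eq[of x, symmetric] A[symmetric] a_def .
  then show "B x = beta_hat n t x" using t_n_pos by (simp add: b_def)
qed

end

section \<open>Laws determined by characteristic functions\<close>

text \<open>Dividing the weight by its integral gives a probability measure, to which Levy's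
  uniqueness theorem applies. The lower bound on \<open>h\<close> keeps the integral positive, and
  frequency 0 shows that it is the same under \<open>P\<close> and \<open>Q\<close>.\<close>

lemma weighted_law_eq_if_char_eq:
  fixes h V :: "'w \<Rightarrow> real"
  assumes PQ: "prob_space P" "prob_space Q"
    and V: "V \<in> borel_measurable P" "V \<in> borel_measurable Q"
    and h: "h \<in> borel_measurable P" "h \<in> borel_measurable Q" "\<And>w. 1 \<le> h w" "\<And>w. h w \<le> C"
    and eq: "\<And>u. (CLINT w|P. h w *\<^sub>R iexp (u * V w)) = (CLINT w|Q. h w *\<^sub>R iexp (u * V w))"
    and A: "A \<in> sets borel"
  shows "(LINT w|P. h w * indicator A (V w)) = (LINT w|Q. h w * indicator A (V w))"
proof -
  define m where "m = (LINT w|P. h w)"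
  have D: "real_distribution (distr (density R (\<lambda>w. h w / m)) borel V)"
      "(LINT w|R. h w * indicator A (V w)) = m * measure (distr (density R (\<lambda>w. h w / m)) borel V) A"
      "char (distr (density R (\<lambda>w. h w / m)) borel V) u = (CLINT w|R. h w *\<^sub>R iexp (u * V w)) / m"
    if R: "prob_space R" and [measurable]: "V \<in> borel_measurable R" "h \<in> borel_measurable R"
      and m: "m = (LINT w|R. h w)" for R u
  proof -
    interpret R: prob_space R by (rule R)
    have hi: "integrable R h"
    proof (intro R.integrable_const_bound[where B = C] AE_I2)
      show "norm (h w) \<le> C" for w using h(3)[of w] h(4)[of w] by simp
    qed simp
    have m1: "1 \<le> m"
      unfolding m using integral_mono[of R "\<lambda>_. 1" h] hi h(3) by (simp add: R.prob_space)
    have h0: "0 \<le> h w / m" for w using h(3)[of w] m1 by simp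
    let ?N = "density R (\<lambda>w. h w / m)"
    have "emeasure ?N (space ?N) = (\<integral>\<^sup>+w. ennreal (h w / m) \<partial>R)"
      by (subst emeasure_density) (auto intro!: nn_integral_cong)
    also have "\<dots> = ennreal (LINT w|R. h w / m)"
      using hi h0 by (intro nn_integral_eq_integral) auto
    also have "(LINT w|R. h w / m) = 1" using m1 by (simp add: m[symmetric])
    finally have N: "prob_space ?N" by (intro prob_spaceI) simp
    then interpret N: prob_space ?N .
    show "real_distribution (distr ?N borel V)" by (rule N.real_distribution_distr) simp
    have "measure (distr ?N borel V) A = (LINT x|distr ?N borel V. indicator A x)"
      using A by simp
    also have "\<dots> = (LINT w|?N. indicator A (V w))"
      using A by (intro integral_distr) auto
    also have "\<dots> = (LINT w|R. (h w / m) *\<^sub>R indicator A (V w))"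
      using A h0 by (intro integral_density) auto
    also have "\<dots> = (LINT w|R. h w * indicator A (V w)) / m"
      by simp
    finally show "(LINT w|R. h w * indicator A (V w)) = m * measure (distr ?N borel V) A"
      using m1 by simp
    have "char (distr ?N borel V) u = (CLINT w|?N. iexp (u * V w))"
      unfolding char_def by (intro integral_distr) auto
    also have "\<dots> = (CLINT w|R. (h w / m) *\<^sub>R iexp (u * V w))"
      using h0 by (intro integral_density) auto
    also have "\<dots> = (CLINT w|R. (h w *\<^sub>R iexp (u * V w)) / m)"
      by (simp add: scaleR_conv_of_real)
    also have "\<dots> = (CLINT w|R. h w *\<^sub>R iexp (u * V w)) / m"
      by (rule integral_divide_zero)
    finally show "char (distr ?N borel V) u = (CLINT w|R. h w *\<^sub>R iexp (u * V w)) / m" .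
  qed
  have "(CLINT w|P. complex_of_real (h w)) = (CLINT w|Q. complex_of_real (h w))"
    using eq[of 0] by (simp add: scaleR_conv_of_real)
  then have mQ: "m = (LINT w|Q. h w)" by (simp add: m_def)
  have "distr (density P (\<lambda>w. h w / m)) borel V = distr (density Q (\<lambda>w. h w / m)) borel V"
    using D[OF PQ(1) V(1) h(1) m_def] D[OF PQ(2) V(2) h(2) mQ] eq
    by (intro Levy_uniqueness ext) auto
  then show ?thesis
    using D(2)[OF PQ(1) V(1) h(1) m_def] D(2)[OF PQ(2) V(2) h(2) mQ] by simp
qed

text \<open>A real part as weight is a combination of the complex weight at the frequencies
  \<open>x\<close> and \<open>- x\<close>, so equality of the complex transforms at all frequencies
  passes to real parts.\<close>

lemma Re_scaleR_iexp:
  "Re g *\<^sub>R iexp x = (g * iexp x + cnj (g * iexp (- x))) / 2"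
proof -
  have cnj: "cnj (iexp (- x)) = iexp x" by (simp add: exp_cnj)
  have "complex_of_real (Re g) = (g + cnj g) / 2" by (simp add: complex_add_cnj)
  then have "Re g *\<^sub>R iexp x = (g + cnj g) / 2 * iexp x" by (simp only: scaleR_conv_of_real)
  also have "\<dots> = (g * iexp x + cnj g * iexp x) / 2" by (simp add: distrib_right)
  finally show ?thesis unfolding complex_cnj_mult cnj .
qed

text \<open>The conclusion for a complex weight follows from that for the positive weights \<open>1\<close>,
  \<open>2 + Re g\<close> and \<open>2 + Im g\<close>.\<close>

lemma complex_weighted_law_eq_if_char_eq:
  fixes g :: "'w \<Rightarrow> complex" and V :: "'w \<Rightarrow> real"
  assumes PQ: "prob_space P" "prob_space Q"
    and V: "V \<in> borel_measurable P" "V \<in> borel_measurable Q"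
    and g: "g \<in> borel_measurable P" "g \<in> borel_measurable Q" "\<And>w. norm (g w) \<le> 1"
    and eq1: "\<And>u. (CLINT w|P. iexp (u * V w)) = (CLINT w|Q. iexp (u * V w))"
    and eq: "\<And>u. (CLINT w|P. g w * iexp (u * V w)) = (CLINT w|Q. g w * iexp (u * V w))"
    and A: "A \<in> sets borel"
  shows "(CLINT w|P. g w * indicator A (V w)) = (CLINT w|Q. g w * indicator A (V w))"
proof -
  interpret P: prob_space P by fact
  interpret Q: prob_space Q by fact
  have int: "integrable R (\<lambda>w. f w * iexp (c * V w))"
    if "prob_space R" "f \<in> borel_measurable R" "V \<in> borel_measurable R" "\<And>w. norm (f w) \<le> 1"
    for R c and f :: "'w \<Rightarrow> complex"
  proof -
    interpret prob_space R by fact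
    show ?thesis
      using that by (intro integrable_const_bound[where B = 1]) (auto simp: norm_mult)
  qed
  have intA: "integrable R (\<lambda>w. f w * indicator A (V w))" "integrable R (\<lambda>w. indicat_real A (V w))"
    if "prob_space R" "f \<in> borel_measurable R" "V \<in> borel_measurable R" "\<And>w. norm (f w) \<le> 1"
    for R and f :: "'w \<Rightarrow> complex"
  proof -
    interpret prob_space R by fact
    show "integrable R (\<lambda>w. f w * indicator A (V w))" "integrable R (\<lambda>w. indicat_real A (V w))"
    proof -
      note [measurable] = that(2,3) A
      show "integrable R (\<lambda>w. f w * indicator A (V w))"
        by (rule integrable_const_bound[where B = 1])
          (auto intro!: AE_I2 simp: norm_mult indicator_def that(4))
      show "integrable R (\<lambda>w. indicat_real A (V w))"
        by (rule integrable_const_bound[where B = 1]) (auto intro!: AE_I2 simp: indicator_def)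
    qed
  qed
  have one: "(LINT w|P. indicator A (V w)) = (LINT w|Q. indicator A (V w) :: real)"
  proof -
    have "(LINT w|P. 1 * indicator A (V w)) = (LINT w|Q. 1 * indicator A (V w) :: real)"
    proof (rule weighted_law_eq_if_char_eq[OF PQ V _ _ _ _ _ A, where C = 1])
      show "(CLINT w|P. 1 *\<^sub>R iexp (u * V w)) = (CLINT w|Q. 1 *\<^sub>R iexp (u * V w))" for u
        unfolding scaleR_one by (rule eq1)
    qed auto
    then show ?thesis by (simp only: mult_1)
  qed
  have Re: "(LINT w|P. Re (f w) * indicator A (V w)) = (LINT w|Q. Re (f w) * indicator A (V w))"
    if f: "f \<in> borel_measurable P" "f \<in> borel_measurable Q" "\<And>w. norm (f w) \<le> 1"
      and eqf: "\<And>u. (CLINT w|P. f w * iexp (u * V w)) = (CLINT w|Q. f w * iexp (u * V w))"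
    for f :: "'w \<Rightarrow> complex"
  proof -
    have bd: "- 1 \<le> Re (f w)" "Re (f w) \<le> 1" for w
      using abs_Re_le_cmod[of "f w"] f(3)[of w] by auto
    have split: "(CLINT w|R. (2 + Re (f w)) *\<^sub>R iexp (u * V w)) =
        2 * (CLINT w|R. iexp (u * V w)) +
        ((CLINT w|R. f w * iexp (u * V w)) + cnj (CLINT w|R. f w * iexp ((- u) * V w))) / 2"
      if R: "prob_space R" "f \<in> borel_measurable R" "V \<in> borel_measurable R" for R u
    proof -
      interpret R: prob_space R by fact
      have i1: "integrable R (\<lambda>w. iexp (u * V w))" using int[of R "\<lambda>_. 1"] R by simp
      note i2 = int[OF R f(3), of u] and i3 = int[OF R f(3), of "- u"]
      have "(2 + Re (f w)) *\<^sub>R iexp (u * V w) =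
          2 * iexp (u * V w) + (f w * iexp (u * V w) + cnj (f w * iexp ((- u) * V w))) / 2" for w
        unfolding scaleR_add_left Re_scaleR_iexp by (simp add: scaleR_conv_of_real)
      then have "(CLINT w|R. (2 + Re (f w)) *\<^sub>R iexp (u * V w)) =
          (CLINT w|R. 2 * iexp (u * V w) + (f w * iexp (u * V w) + cnj (f w * iexp ((- u) * V w))) / 2)"
        by simp
      also have "\<dots> = (CLINT w|R. 2 * iexp (u * V w)) + (CLINT w|R. (f w * iexp (u * V w) + cnj (f w * iexp ((- u) * V w))) / 2)"
        using i1 i2 integrable_cnj[OF i3] by (intro Bochner_Integration.integral_add) auto
      also have "(CLINT w|R. (f w * iexp (u * V w) + cnj (f w * iexp ((- u) * V w))) / 2) =
          (CLINT w|R. f w * iexp (u * V w) + cnj (f w * iexp ((- u) * V w))) / 2"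
        by (rule integral_divide_zero)
      also have "(CLINT w|R. f w * iexp (u * V w) + cnj (f w * iexp ((- u) * V w))) =
          (CLINT w|R. f w * iexp (u * V w)) + (CLINT w|R. cnj (f w * iexp ((- u) * V w)))"
        using i2 integrable_cnj[OF i3] by (intro Bochner_Integration.integral_add)
      finally show ?thesis
        unfolding integral_mult_right_zero Bochner_Integration.integral_cnj[of R "\<lambda>w. f w * iexp ((- u) * V w)"] .
    qed
    have "(LINT w|P. (2 + Re (f w)) * indicator A (V w)) = (LINT w|Q. (2 + Re (f w)) * indicator A (V w))"
    proof (rule weighted_law_eq_if_char_eq[OF PQ V, where C = 3])
      show "(CLINT w|P. (2 + Re (f w)) *\<^sub>R iexp (u * V w)) = (CLINT w|Q. (2 + Re (f w)) *\<^sub>R iexp (u * V w))" for u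
        unfolding split[OF PQ(1) f(1) V(1)] split[OF PQ(2) f(2) V(2)] by (simp only: eq1 eqf)
      show "1 \<le> 2 + Re (f w)" "2 + Re (f w) \<le> 3" for w using bd[of w] by auto
    qed (use f A in auto)
    moreover have "(LINT w|R. (2 + Re (f w)) * indicator A (V w)) =
        2 * (LINT w|R. indicator A (V w)) + (LINT w|R. Re (f w) * indicator A (V w))"
      if R: "prob_space R" "f \<in> borel_measurable R" "V \<in> borel_measurable R" for R
    proof -
      have "integrable R (\<lambda>w. Re (f w * indicator A (V w)))"
        using intA(1)[OF R f(3)] by (rule integrable_Re)
      moreover have "(\<lambda>w. Re (f w * indicator A (V w))) = (\<lambda>w. Re (f w) * indicator A (V w))"
        by (auto simp: fun_eq_iff indicator_def)
      ultimately have "integrable R (\<lambda>w. Re (f w) * indicator A (V w))" by (simp only:)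
      then show ?thesis
        using intA(2)[OF R f(3)] by (simp add: distrib_right)
    qed
    ultimately show ?thesis using PQ V f one by simp
  qed
  \<comment> \<open>The imaginary part is covered as the real part of
    \<open>- \<i> * g\<close>.\<close>
  have ReIm: "(CLINT w|R. g w * indicator A (V w)) =
      Complex (LINT w|R. Re (g w) * indicator A (V w)) (LINT w|R. Re (- \<i> * g w) * indicator A (V w))"
    if R: "prob_space R" "g \<in> borel_measurable R" "V \<in> borel_measurable R" for R
  proof -
    note i = intA(1)[OF R g(3)]
    have "Re (CLINT w|R. g w * indicator A (V w)) = (LINT w|R. Re (g w * indicator A (V w)))"
      by (rule integral_Re[OF i, symmetric])
    also have "\<dots> = (LINT w|R. Re (g w) * indicator A (V w))"
      by (intro Bochner_Integration.integral_cong) (auto simp: indicator_def)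
    finally have 1: "Re (CLINT w|R. g w * indicator A (V w)) = (LINT w|R. Re (g w) * indicator A (V w))" .
    have "Im (CLINT w|R. g w * indicator A (V w)) = (LINT w|R. Im (g w * indicator A (V w)))"
      by (rule integral_Im[OF i, symmetric])
    also have "\<dots> = (LINT w|R. Re (- \<i> * g w) * indicator A (V w))"
      by (intro Bochner_Integration.integral_cong) (auto simp: indicator_def)
    finally show ?thesis using 1 by (simp add: complex_eq_iff)
  qed
  have "(CLINT w|P. - \<i> * g w * iexp (u * V w)) = (CLINT w|Q. - \<i> * g w * iexp (u * V w))" for u
    using eq[of u] by (simp add: mult.assoc)
  then show ?thesis
    unfolding ReIm[OF PQ(1) g(1) V(1)] ReIm[OF PQ(2) g(2) V(2)]
    using Re[of g] Re[of "\<lambda>w. - \<i> * g w"] g eq by (simp add: norm_mult)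
qed

text \<open>The exponential factors are replaced by indicators one coordinate at a time; the product of the
  other factors serves as the complex weight.\<close>

lemma rectangles_eq_if_char_eq:
  fixes W :: "'j \<Rightarrow> 'w \<Rightarrow> real"
  assumes PQ: "prob_space P" "prob_space Q" and J: "finite J"
    and W: "\<And>j. j \<in> J \<Longrightarrow> W j \<in> borel_measurable P" "\<And>j. j \<in> J \<Longrightarrow> W j \<in> borel_measurable Q"
    and eq: "\<And>u. (CLINT w|P. iexp (\<Sum>j\<in>J. u j * W j w)) = (CLINT w|Q. iexp (\<Sum>j\<in>J. u j * W j w))"
    and A: "\<And>j. j \<in> J \<Longrightarrow> A j \<in> sets borel"
  shows "(LINT w|P. (\<Prod>j\<in>J. indicator (A j) (W j w))) = (LINT w|Q. (\<Prod>j\<in>J. indicator (A j) (W j w)) :: real)"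
proof -
  define F :: "bool \<Rightarrow> (real \<Rightarrow> complex) set" where
    "F b = range (\<lambda>u x. iexp (u * x)) \<union> (if b then {\<lambda>x. indicator B x | B. B \<in> sets borel} else {})" for b
  have F: "f \<in> borel_measurable borel \<and> (\<forall>x. norm (f x) \<le> 1)" if "f \<in> F b" for f b
    using that by (auto simp: F_def indicator_def split: if_splits)
  have main: "\<forall>f. (\<forall>j\<in>J. f j \<in> F (j \<in> J')) \<longrightarrow>
      (CLINT w|P. (\<Prod>j\<in>J. f j (W j w))) = (CLINT w|Q. (\<Prod>j\<in>J. f j (W j w)))"
    if "finite J'" "J' \<subseteq> J" for J'
    using that
  proof (induction J')
    case empty
    show ?case
    proof (intro allI impI)
      fix f :: "'j \<Rightarrow> real \<Rightarrow> complex" assume "\<forall>j\<in>J. f j \<in> F (j \<in> {})"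
      then have "\<forall>j\<in>J. \<exists>u. f j = (\<lambda>x. iexp (u * x))" by (auto simp: F_def)
      then obtain u where u: "\<And>j. j \<in> J \<Longrightarrow> f j = (\<lambda>x. iexp (u j * x))" by metis
      have "(\<Prod>j\<in>J. f j (W j w)) = iexp (\<Sum>j\<in>J. u j * W j w)" for w
        using u J by (simp add: exp_sum sum_distrib_left)
      then show "(CLINT w|P. (\<Prod>j\<in>J. f j (W j w))) = (CLINT w|Q. (\<Prod>j\<in>J. f j (W j w)))"
        using eq[of u] by simp
    qed
  next
    case (insert i J')
    then have IH: "\<And>f. (\<And>j. j \<in> J \<Longrightarrow> f j \<in> F (j \<in> J')) \<Longrightarrow>
      (CLINT w|P. (\<Prod>j\<in>J. f j (W j w))) = (CLINT w|Q. (\<Prod>j\<in>J. f j (W j w)))"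
      and i: "i \<in> J" "i \<notin> J'" by auto
    show ?case
    proof (intro allI impI)
      fix f :: "'j \<Rightarrow> real \<Rightarrow> complex" assume f: "\<forall>j\<in>J. f j \<in> F (j \<in> insert i J')"
      show "(CLINT w|P. (\<Prod>j\<in>J. f j (W j w))) = (CLINT w|Q. (\<Prod>j\<in>J. f j (W j w)))"
      proof (cases "\<exists>u. f i = (\<lambda>x. iexp (u * x))")
        case True
        then have "f j \<in> F (j \<in> J')" if "j \<in> J" for j
        proof (cases "j = i")
          case False
          then have *: "(j \<in> insert i J') = (j \<in> J')" by simp
          from f that have "f j \<in> F (j \<in> insert i J')" by (rule bspec)
          then show ?thesis by (simp only: *)
        qed (use True in \<open>auto simp: F_def\<close>)
        then show ?thesis by (rule IH)
      next
        case False
        have "f i \<in> F (i \<in> insert i J')" using f i(1) by (rule bspec)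
        then have "f i \<in> {\<lambda>x. indicator B x | B. B \<in> sets borel}"
          using False unfolding F_def by (simp only: insert_iff simp_thms if_True Un_iff) blast
        then obtain B where B: "B \<in> sets borel" "f i = (\<lambda>x. indicator B x)"
          by blast
        define g where "g w = (\<Prod>j\<in>J - {i}. f j (W j w))" for w
        have split: "(\<Prod>j\<in>J. (f(i := c)) j (W j w)) = g w * c (W i w)" for c w
          unfolding g_def using J i by (subst prod.remove[of J i]) (auto intro: prod.cong)
        have fm: "f j \<in> borel_measurable borel" "norm (f j x) \<le> 1" if "j \<in> J" for j x
          using F f that by blast+
        have gm: "g \<in> borel_measurable P" "g \<in> borel_measurable Q"
          unfolding g_def using W fm by (auto intro!: borel_measurable_prod measurable_compose[where N = borel])
        have gn: "norm (g w) \<le> 1" for w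
          unfolding g_def prod_norm[symmetric] using fm by (intro prod_le_1) auto
        have "(CLINT w|P. g w * indicator B (W i w)) = (CLINT w|Q. g w * indicator B (W i w))"
        proof (rule complex_weighted_law_eq_if_char_eq[OF PQ W(1)[OF i(1)] W(2)[OF i(1)] gm gn _ _ B(1)])
          fix u
          \<comment> \<open>With frequency 0 at all other coordinates the induction hypothesis
            yields the characteristic function of \<open>W i\<close> alone.\<close>
          have "(\<Prod>j\<in>J. ((\<lambda>j x. iexp (0 * x))(i := \<lambda>x. iexp (u * x))) j (W j w)) = iexp (u * W i w)" for w
            using J i by (subst prod.remove[of J i]) (auto intro!: prod.neutral)
          moreover have "((\<lambda>j x. iexp (0 * x))(i := \<lambda>x. iexp (u * x))) j \<in> F (j \<in> J')" for j
            unfolding F_def by (cases "j = i") (simp_all only: fun_upd_same fun_upd_other not_False_eq_True, blast+)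
          ultimately show "(CLINT w|P. iexp (u * W i w)) = (CLINT w|Q. iexp (u * W i w))"
            using IH[of "(\<lambda>j x. iexp (0 * x))(i := \<lambda>x. iexp (u * x))"] by (simp only:)
          have "(f(i := \<lambda>x. iexp (u * x))) j \<in> F (j \<in> J')" if "j \<in> J" for j
          proof (cases "j = i")
            case False
            then have *: "(j \<in> insert i J') = (j \<in> J')" by simp
            from f that have "f j \<in> F (j \<in> insert i J')" by (rule bspec)
            then show ?thesis using False by (simp only: * fun_upd_other not_False_eq_True)
          qed (auto simp: F_def)
          from IH[OF this] show "(CLINT w|P. g w * iexp (u * W i w)) = (CLINT w|Q. g w * iexp (u * W i w))"
            by (simp only: split)
        qed
        moreover have "(\<Prod>j\<in>J. f j (W j w)) = g w * indicator B (W i w)" for w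
          using split[of "f i" w] unfolding fun_upd_triv by (simp only: B(2))
        ultimately show ?thesis by (simp only:)
      qed
    qed
  qed
  have "(CLINT w|P. (\<Prod>j\<in>J. indicator (A j) (W j w))) = (CLINT w|Q. (\<Prod>j\<in>J. indicator (A j) (W j w)))"
    using main[of J, rule_format, of "\<lambda>j x. indicator (A j) x"] J A by (auto simp: F_def)
  moreover have "(\<Prod>j\<in>J. indicator (A j) (W j w)) = complex_of_real (\<Prod>j\<in>J. indicator (A j) (W j w))" for w
    unfolding of_real_prod by (intro prod.cong refl) (simp add: indicator_def)
  ultimately have "complex_of_real (LINT w|P. (\<Prod>j\<in>J. indicator (A j) (W j w))) =
      complex_of_real (LINT w|Q. (\<Prod>j\<in>J. indicator (A j) (W j w)))"
    by (simp only: integral_complex_of_real)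
  then show ?thesis by simp
qed

text \<open>Vectors are flattened to scalar coordinates by \<open>\<phi>\<close>, where measures are
  determined by rectangles, and \<open>\<psi>\<close> carries the equality back.\<close>

theorem PiM_eq_if_char_eq:
  fixes P Q :: "('i \<Rightarrow> real^'m) measure"
  assumes PQ: "prob_space P" "prob_space Q" and I: "finite I"
    and sets: "sets P = sets (\<Pi>\<^sub>M i\<in>I. borel)" "sets Q = sets (\<Pi>\<^sub>M i\<in>I. borel)"
    and eq: "\<And>c. (CLINT x|P. iexp (\<Sum>i\<in>I. c i \<bullet> x i)) = (CLINT x|Q. iexp (\<Sum>i\<in>I. c i \<bullet> x i))"
  shows "P = Q"
proof -
  interpret P: prob_space P by fact
  interpret Q: prob_space Q by fact
  let ?B = "\<Pi>\<^sub>M i\<in>I. (borel :: (real^'m) measure)"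
  let ?J = "I \<times> (UNIV :: 'm set)"
  let ?C = "\<Pi>\<^sub>M j\<in>?J. (borel :: real measure)"
  define \<phi> where "\<phi> x = (\<lambda>j\<in>?J. x (fst j) $ snd j)" for x :: "'i \<Rightarrow> real^'m"
  define \<psi> where "\<psi> y = (\<lambda>i\<in>I. \<chi> k. y (i, k))" for y :: "'i \<times> 'm \<Rightarrow> real"
  have W: "(\<lambda>x. x (fst j) $ snd j) \<in> borel_measurable ?B" if "j \<in> ?J" for j
  proof -
    have "(\<lambda>x. x (fst j)) \<in> measurable ?B borel"
      using that by (intro measurable_component_singleton) auto
    then show ?thesis by (rule measurable_compose) (auto intro: borel_measurable_continuous_onI continuous_intros)
  qed
  have \<phi>: "\<phi> \<in> measurable ?B ?C"
    unfolding \<phi>_def by (intro measurable_restrict) (rule W)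
  have \<psi>: "\<psi> \<in> measurable ?C ?B"
    unfolding \<psi>_def
  proof (intro measurable_restrict)
    fix i assume i: "i \<in> I"
    have eq: "(\<lambda>y. \<chi> k. y (i, k)) = (\<lambda>y. \<Sum>k\<in>UNIV. y (i, k) *\<^sub>R axis k (1::real))"
      by (simp add: fun_eq_iff vec_eq_iff axis_def if_distrib cong: if_cong)
    have "(\<lambda>y. y (i, k)) \<in> borel_measurable ?C" for k
      using i by (intro measurable_component_singleton) auto
    then show "(\<lambda>y. \<chi> k. y (i, k)) \<in> borel_measurable ?C"
      unfolding eq by (intro borel_measurable_sum borel_measurable_scaleR borel_measurable_const)
  qed
  have meas: "measurable P N = measurable ?B N" "measurable Q N = measurable ?B N" for N
    using sets by (auto intro: measurable_cong_sets)
  have "distr P ?C \<phi> = distr Q ?C \<phi>"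
  proof (rule measure_eqI_PiM_finite[where I = ?J and M = "\<lambda>_. borel" and A = "\<lambda>_. space ?C"])
    show "finite ?J" using I by simp
    show "range (\<lambda>_::nat. space ?C) \<subseteq> prod_algebra ?J (\<lambda>_. borel)"
      using I prod_algebraI_finite[of ?J "\<lambda>_. UNIV" "\<lambda>_. borel :: real measure"] by (auto simp: space_PiM)
    interpret D: prob_space "distr P ?C \<phi>" using \<phi> by (intro P.prob_space_distr) (simp add: meas)
    show "emeasure (distr P ?C \<phi>) (space ?C) \<noteq> \<infinity>" by simp
    fix A :: "'i \<times> 'm \<Rightarrow> real set" assume A: "\<And>j. j \<in> ?J \<Longrightarrow> A j \<in> sets borel"
    have R: "emeasure (distr R ?C \<phi>) (Pi\<^sub>E ?J A) = ennreal (LINT x|R. (\<Prod>j\<in>?J. indicator (A j) (x (fst j) $ snd j)))"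
      if "prob_space R" "sets R = sets ?B" for R
    proof -
      interpret R: prob_space R by fact
      have mR: "measurable R N = measurable ?B N" for N :: "'z measure"
        using that(2) by (auto intro: measurable_cong_sets)
      have E: "Pi\<^sub>E ?J A \<in> sets ?C" using A I by (intro sets_PiM_I_finite) auto
      have "emeasure (distr R ?C \<phi>) (Pi\<^sub>E ?J A) = emeasure R (\<phi> -` Pi\<^sub>E ?J A \<inter> space R)"
        using \<phi> E by (intro emeasure_distr) (auto simp: mR)
      also have "\<dots> = ennreal (measure R (\<phi> -` Pi\<^sub>E ?J A \<inter> space R))"
        by (rule R.emeasure_eq_measure)
      also have "measure R (\<phi> -` Pi\<^sub>E ?J A \<inter> space R) = (LINT x|R. indicator (\<phi> -` Pi\<^sub>E ?J A \<inter> space R) x)"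
        by simp
      also have "\<dots> = (LINT x|R. (\<Prod>j\<in>?J. indicator (A j) (x (fst j) $ snd j)))"
      proof (intro Bochner_Integration.integral_cong refl)
        fix x assume x: "x \<in> space R"
        have "\<phi> x \<in> Pi\<^sub>E ?J A \<longleftrightarrow> (\<forall>j\<in>?J. x (fst j) $ snd j \<in> A j)"
          unfolding \<phi>_def by (auto simp: PiE_iff)
        moreover have "(\<Prod>j\<in>?J. indicator (A j) (x (fst j) $ snd j)) = (if \<forall>j\<in>?J. x (fst j) $ snd j \<in> A j then 1 else 0 :: real)"
        proof (cases "\<forall>j\<in>?J. x (fst j) $ snd j \<in> A j")
          case True
          then have "(\<Prod>j\<in>?J. indicator (A j) (x (fst j) $ snd j)) = (1::real)"
            by (intro prod.neutral) (metis indicator_simps(1))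
          then show ?thesis unfolding if_P[OF True] .
        next
          case False
          then have "(\<Prod>j\<in>?J. indicator (A j) (x (fst j) $ snd j)) = (0::real)"
            using I by (intro prod_zero) (auto simp: indicator_def)
          then show ?thesis unfolding if_not_P[OF False] .
        qed
        ultimately show "indicator (\<phi> -` Pi\<^sub>E ?J A \<inter> space R) x = (\<Prod>j\<in>?J. indicator (A j) (x (fst j) $ snd j) :: real)"
          using x by (simp add: indicator_def)
      qed
      finally show ?thesis .
    qed
    have "(LINT x|P. (\<Prod>j\<in>?J. indicator (A j) (x (fst j) $ snd j))) =
        (LINT x|Q. (\<Prod>j\<in>?J. indicator (A j) (x (fst j) $ snd j)) :: real)"
    proof (rule rectangles_eq_if_char_eq[OF PQ])
      fix u :: "'i \<times> 'm \<Rightarrow> real"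
      have "(\<Sum>j\<in>?J. u j * x (fst j) $ snd j) = (\<Sum>i\<in>I. (\<chi> k. u (i, k)) \<bullet> x i)" for x :: "'i \<Rightarrow> real^'m"
        using sum.cartesian_product[of "\<lambda>i k. u (i, k) * x i $ k" UNIV I]
        by (simp add: inner_vec_def case_prod_beta)
      then show "(CLINT x|P. iexp (\<Sum>j\<in>?J. u j * x (fst j) $ snd j)) = (CLINT x|Q. iexp (\<Sum>j\<in>?J. u j * x (fst j) $ snd j))"
        using eq[of "\<lambda>i. \<chi> k. u (i, k)"] by simp
    qed (use I W A in \<open>auto simp: meas\<close>)
    then show "emeasure (distr P ?C \<phi>) (Pi\<^sub>E ?J A) = emeasure (distr Q ?C \<phi>) (Pi\<^sub>E ?J A)"
      using R PQ sets by simp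
  qed simp_all
  then have "distr (distr P ?C \<phi>) ?B \<psi> = distr (distr Q ?C \<phi>) ?B \<psi>" by simp
  moreover have "distr (distr R ?C \<phi>) ?B \<psi> = R" if "sets R = sets ?B" for R
  proof -
    have "\<phi> \<in> measurable R ?C" using \<phi> that by (simp cong: measurable_cong_sets)
    then have "distr (distr R ?C \<phi>) ?B \<psi> = distr R ?B (\<psi> \<circ> \<phi>)"
      using \<psi> by (intro distr_distr)
    also have "\<dots> = distr R R (\<lambda>x. x)"
    proof (rule distr_cong)
      fix x assume "x \<in> space R"
      then have "x \<in> space ?B" using sets_eq_imp_space_eq[OF that] by simp
      then show "(\<psi> \<circ> \<phi>) x = x"
        by (auto simp: space_PiM PiE_iff \<psi>_def \<phi>_def fun_eq_iff extensional_def vec_eq_iff)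
    qed (use that in auto)
    finally show ?thesis by simp
  qed
  ultimately show ?thesis using sets by simp
qed

section \<open>Nondegenerate normal laws\<close>

lemma nn_integral_lborel_affine:
  fixes f :: "'a::euclidean_space \<Rightarrow> ennreal"
  assumes [measurable]: "f \<in> borel_measurable borel" and c: "c \<noteq> 0"
  shows "(\<integral>\<^sup>+x. f x \<partial>lborel) = ennreal (\<bar>c\<bar> ^ DIM('a)) * (\<integral>\<^sup>+x. f (t + c *\<^sub>R x) \<partial>lborel)"
  by (subst lborel_affine[OF c, of t])
    (simp add: nn_integral_density nn_integral_distr nn_integral_cmult ennreal_power)

text \<open>The usual argument for the uniqueness of Haar measure, with the unit ball as a test set that is
  invariant under the orthogonal map.\<close>

lemma lborel_distr_orthogonal:
  fixes R R' :: "'a::euclidean_space \<Rightarrow> 'a"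
  assumes R: "linear R" and norm: "\<And>x. norm (R x) = norm x" and R': "\<And>y. R (R' y) = y"
  shows "distr lborel borel R = lborel"
proof (rule measure_eqI)
  have Rm [measurable]: "R \<in> borel_measurable borel"
    using R by (simp add: borel_measurable_continuous_onI linear_continuous_on linear_conv_bounded_linear)
  interpret linear R by fact
  define V where "V = emeasure lborel (ball (0::'a) 1)"
  have ball: "emeasure lborel (ball c 1) = V" for c :: 'a
    by (simp add: V_def emeasure_ball)
  have "0 < unit_ball_vol (real DIM('a))" by simp
  moreover have "V = ennreal (unit_ball_vol (real DIM('a)))" by (simp add: V_def emeasure_ball)
  ultimately have V: "V \<noteq> 0" "V \<noteq> \<top>"
    by (metis ennreal_less_zero_iff less_irrefl, simp)
  have [measurable]: "ball (0::'a) 1 \<in> sets borel" by simp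
  let ?g = "indicator (ball 0 1) :: 'a \<Rightarrow> ennreal"
  fix A :: "'a set" assume "A \<in> sets (distr lborel borel R)"
  then have [measurable]: "A \<in> sets borel" by simp
  let ?f = "indicator A :: 'a \<Rightarrow> ennreal"
  have tr: "(\<integral>\<^sup>+x. h x \<partial>lborel) = (\<integral>\<^sup>+x. h (c + x) \<partial>lborel)"
    if "h \<in> borel_measurable borel" for h :: "'a \<Rightarrow> ennreal" and c
    using nn_integral_lborel_affine[OF that, of 1 c] by simp
  have "V * (\<integral>\<^sup>+x. ?f (R x) \<partial>lborel) = (\<integral>\<^sup>+y. ?g y * (\<integral>\<^sup>+x. ?f (R x) \<partial>lborel) \<partial>lborel)"
    by (subst nn_integral_multc) (auto simp: V_def)
  \<comment> \<open>Translation invariance in \<open>x\<close>: the shift by \<open>R' y\<close>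
    becomes a shift by \<open>y\<close> under \<open>R\<close>.\<close>
  also have "\<dots> = (\<integral>\<^sup>+y. ?g y * (\<integral>\<^sup>+x. ?f (y + R x) \<partial>lborel) \<partial>lborel)"
  proof (intro nn_integral_cong)
    fix y
    show "?g y * (\<integral>\<^sup>+x. ?f (R x) \<partial>lborel) = ?g y * (\<integral>\<^sup>+x. ?f (y + R x) \<partial>lborel)"
      using tr[of "\<lambda>x. ?f (R x)" "R' y"] by (simp add: add R')
  qed
  also have "\<dots> = (\<integral>\<^sup>+y. (\<integral>\<^sup>+x. ?g y * ?f (y + R x) \<partial>lborel) \<partial>lborel)"
    by (intro nn_integral_cong nn_integral_cmult[symmetric]) auto
  also have "\<dots> = (\<integral>\<^sup>+x. (\<integral>\<^sup>+y. ?g y * ?f (y + R x) \<partial>lborel) \<partial>lborel)"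
    by (intro lborel_pair.Fubini') simp
  also have "\<dots> = (\<integral>\<^sup>+x. (\<integral>\<^sup>+y. ?g (y - R x) * ?f y \<partial>lborel) \<partial>lborel)"
  proof (rule nn_integral_cong)
    fix x
    show "(\<integral>\<^sup>+y. ?g y * ?f (y + R x) \<partial>lborel) = (\<integral>\<^sup>+y. ?g (y - R x) * ?f y \<partial>lborel)"
      by (subst tr[of "\<lambda>y. ?g (y - R x) * ?f y" "R x"]) (auto simp: add.commute)
  qed
  also have "\<dots> = (\<integral>\<^sup>+y. (\<integral>\<^sup>+x. ?g (y - R x) * ?f y \<partial>lborel) \<partial>lborel)"
    by (intro lborel_pair.Fubini') simp
  also have "\<dots> = (\<integral>\<^sup>+y. V * ?f y \<partial>lborel)"
  proof (intro nn_integral_cong)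
    fix y
    \<comment> \<open>As \<open>y = R (R' y)\<close> and \<open>R\<close> is an isometry, the
      indicator becomes that of the unit ball about \<open>R' y\<close>, whose volume is
      \<open>V\<close> for every \<open>y\<close>.\<close>
    have "norm (y - R x) = norm (R' y - x)" for x
      using norm[of "R' y - x"] by (simp add: diff R')
    then have "?g (y - R x) = indicator (ball (R' y) 1) x" for x
      by (simp add: indicator_def dist_norm norm_minus_commute[of "R x" y for x])
    then show "(\<integral>\<^sup>+x. ?g (y - R x) * ?f y \<partial>lborel) = V * ?f y"
      by (simp only:) (subst nn_integral_multc, auto intro!: borel_measurable_indicator simp: ball)
  qed
  also have "\<dots> = V * (\<integral>\<^sup>+y. ?f y \<partial>lborel)" by (intro nn_integral_cmult) auto
  finally have "V * (\<integral>\<^sup>+x. ?f (R x) \<partial>lborel) = V * (\<integral>\<^sup>+y. ?f y \<partial>lborel)" .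
  then have "(\<integral>\<^sup>+x. ?f (R x) \<partial>lborel) = (\<integral>\<^sup>+y. ?f y \<partial>lborel)"
    using V by (simp add: ennreal_mult_cancel_left)
  moreover have "(\<integral>\<^sup>+x. ?f (R x) \<partial>lborel) = emeasure (distr lborel borel R) A"
  proof -
    have "(\<integral>\<^sup>+x. ?f (R x) \<partial>lborel) = (\<integral>\<^sup>+y. ?f y \<partial>distr lborel borel R)"
      by (intro nn_integral_distr[symmetric]) auto
    then show ?thesis by simp
  qed
  ultimately show "emeasure (distr lborel borel R) A = emeasure lborel A" by simp
qed simp

text \<open>Lebesgue measure is a product over \<open>Basis\<close>; reindexing by
  \<open>axis\<close> turns this into a product over the coordinates of a vector.\<close>

lemma Basis_vec_image: "Basis = range (\<lambda>j. axis j (1::real))"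
  by (auto simp: Basis_vec_def)

lemma inj_axis: "inj (\<lambda>j. axis j (1::real))"
  by (auto simp: inj_def axis_eq_axis)

lemma prod_Basis_vec:
  "(\<Prod>b\<in>(Basis :: (real^'i) set). f b) = (\<Prod>j\<in>UNIV. f (axis j (1::real)))"
  unfolding Basis_vec_image by (simp add: prod.reindex[OF inj_axis])

lemma nn_integral_lborel_vec_prod:
  fixes f :: "'i::finite \<Rightarrow> real \<Rightarrow> ennreal"
  assumes "\<And>j. f j \<in> borel_measurable borel"
  shows "(\<integral>\<^sup>+x. (\<Prod>j\<in>UNIV. f j (x $ j)) \<partial>(lborel :: (real^'i) measure)) = (\<Prod>j\<in>UNIV. \<integral>\<^sup>+x. f j x \<partial>lborel)"
proof -
  let ?\<iota> = "inv (\<lambda>j. axis j (1::real) :: real^'i)"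
  have i: "?\<iota> (axis j 1) = j" for j by (rule inv_f_f[OF inj_axis])
  have "(\<integral>\<^sup>+x. (\<Prod>b\<in>Basis. f (?\<iota> b) (x \<bullet> b)) \<partial>(lborel :: (real^'i) measure)) = (\<Prod>b\<in>Basis. \<integral>\<^sup>+x. f (?\<iota> b) x \<partial>lborel)"
    using assms by (intro nn_integral_lborel_prod) auto
  then show ?thesis by (simp add: prod_Basis_vec i inner_axis)
qed

lemma integral_lborel_vec_prod:
  fixes f :: "'i::finite \<Rightarrow> real \<Rightarrow> complex"
  assumes f: "\<And>j. integrable lborel (f j)"
  shows "(CLINT x|(lborel :: (real^'i) measure). (\<Prod>j\<in>UNIV. f j (x $ j))) = (\<Prod>j\<in>UNIV. CLINT x|lborel. f j x)"
proof -
  let ?\<iota> = "inv (\<lambda>j. axis j (1::real) :: real^'i)"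
  have i: "?\<iota> (axis j 1) = j" for j by (rule inv_f_f[OF inj_axis])
  have [measurable]: "f j \<in> borel_measurable borel" for j using f[of j] by auto
  interpret product_sigma_finite "\<lambda>_::real^'i. lborel :: real measure" ..
  have "(CLINT x|(lborel :: (real^'i) measure). (\<Prod>j\<in>UNIV. f j (x $ j)))
      = (CLINT x|(lborel :: (real^'i) measure). (\<Prod>b\<in>Basis. f (?\<iota> b) (x \<bullet> b)))"
    by (simp add: prod_Basis_vec i inner_axis)
  also have "\<dots> = (CLINT y|(\<Pi>\<^sub>M b\<in>(Basis :: (real^'i) set). lborel). (\<Prod>b\<in>Basis. f (?\<iota> b) ((\<Sum>c\<in>Basis. y c *\<^sub>R c) \<bullet> b)))"
    by (subst lborel_eq, subst integral_distr) auto
  also have "\<dots> = (CLINT y|(\<Pi>\<^sub>M b\<in>(Basis :: (real^'i) set). lborel). (\<Prod>b\<in>Basis. f (?\<iota> b) (y b)))"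
    by (intro Bochner_Integration.integral_cong prod.cong arg_cong2[where f = f] refl) (simp add: inner_sum_left_Basis)
  also have "\<dots> = (\<Prod>b\<in>(Basis :: (real^'i) set). CLINT x|lborel. f (?\<iota> b) x)"
    using f by (intro product_integral_prod) auto
  finally show ?thesis by (simp add: prod_Basis_vec i)
qed

lemma char_normal_density:
  assumes \<sigma>: "0 < \<sigma>"
  shows "(CLINT x|lborel. normal_density 0 \<sigma> x *\<^sub>R iexp (u * x)) = exp (- (\<sigma>\<^sup>2 * u\<^sup>2) / 2)"
proof -
  have nd: "\<sigma> * normal_density 0 \<sigma> (\<sigma> * x) = std_normal_density x" for x
    using \<sigma> by (simp add: normal_density_def power_mult_distrib real_sqrt_mult)
  have "(CLINT x|lborel. normal_density 0 \<sigma> x *\<^sub>R iexp (u * x)) =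
      \<bar>\<sigma>\<bar> *\<^sub>R (CLINT x|lborel. normal_density 0 \<sigma> (0 + \<sigma> * x) *\<^sub>R iexp (u * (0 + \<sigma> * x)))"
    using \<sigma> by (intro lborel_integral_real_affine) auto
  also have "\<dots> = (CLINT x|lborel. \<sigma> *\<^sub>R (normal_density 0 \<sigma> (\<sigma> * x) *\<^sub>R iexp (u * (\<sigma> * x))))"
    using \<sigma> by (subst integral_scaleR_right) auto
  also have "\<dots> = (CLINT x|lborel. std_normal_density x *\<^sub>R iexp ((\<sigma> * u) * x))"
    by (intro Bochner_Integration.integral_cong refl) (simp add: nd[symmetric] mult_ac)
  also have "\<dots> = char std_normal_distribution (\<sigma> * u)"
    unfolding char_def by (subst integral_density) auto
  also have "\<dots> = exp (- (\<sigma>\<^sup>2 * u\<^sup>2) / 2)"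
    by (simp add: char_std_normal_distribution power_mult_distrib)
  finally show ?thesis .
qed

lemma measurable_gauss_density:
  fixes S :: "real^'i^'i"
  assumes S: "pos_def S"
  shows "gauss_density S \<in> borel_measurable borel"
proof -
  obtain b l where e: "eigensystem S b l" using S symmetric_eigensystem unfolding pos_def_def by blast
  have l: "l j \<noteq> 0" for j using eigensystem_pos_def[OF e S, of j] by simp
  show ?thesis
    unfolding eigensystem_gauss_density[OF e, abs_def] by (simp add: l)
qed

text \<open>In eigenbasis coordinates the density is a product of one-dimensional normal densities
  with variances \<open>l j\<close>, so both integrals factor. The change of coordinates is an
  isometry and preserves Lebesgue measure.\<close>

lemma pos_def_gauss_density_integrals:
  fixes S :: "real^'i^'i"
  assumes S: "pos_def S"
  shows "(\<integral>\<^sup>+y. ennreal (gauss_density S y) \<partial>lborel) = 1"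
    and "(CLINT y|lborel. gauss_density S y *\<^sub>R iexp (u \<bullet> y)) = exp (- (u \<bullet> (S *v u)) / 2)"
proof -
  obtain b l where e: "eigensystem S b l" using S symmetric_eigensystem unfolding pos_def_def by blast
  have l: "0 < l j" for j using eigensystem_pos_def[OF e S] .
  then have l0: "l j \<noteq> 0" for j by (metis less_irrefl)
  note on = eigensystem_orthonormal[OF e]
  define R where "R y = (\<Sum>j\<in>UNIV. (y $ j) *\<^sub>R b j)" for y :: "real^'i"
  have bR: "b j \<bullet> R y = y $ j" for j y unfolding R_def by (rule orthonormal_coord[OF on])
  have lin: "linear R"
    unfolding R_def by (intro linearI) (simp_all add: scaleR_left_distrib sum.distrib scaleR_right.sum)
  have Rm [measurable]: "R \<in> borel_measurable borel"
    using lin by (simp add: borel_measurable_continuous_onI linear_continuous_on linear_conv_bounded_linear)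
  have "norm (R x) = norm x" for x
    unfolding norm_eq_sqrt_inner orthonormal_inner[OF on, of "R x" "R x"] bR by (simp add: inner_vec_def)
  moreover have "R (\<chi> j. b j \<bullet> y) = y" for y
    unfolding R_def using orthonormal_expand[OF on, of y] by simp
  ultimately have D: "distr lborel borel R = lborel"
    by (intro lborel_distr_orthogonal[OF lin])
  note gm [measurable] = measurable_gauss_density[OF S]
  have g: "gauss_density S (R y) = (\<Prod>j\<in>UNIV. normal_density 0 (sqrt (l j)) (y $ j))" for y
  proof -
    have P: "(\<Prod>j\<in>UNIV. l j) powr - (1 / 2) = (\<Prod>j\<in>UNIV. 1 / sqrt (l j))"
    proof -
      have "l j powr - (1 / 2) = 1 / sqrt (l j)" for j
        using l[of j] by (subst powr_minus) (simp add: powr_half_sqrt inverse_eq_divide less_imp_le)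
      then show ?thesis using l by (subst prod_powr_distrib) (auto simp: less_imp_le)
    qed
    have T: "(2 * pi) powr (- (real CARD('i) / 2)) = (\<Prod>j\<in>(UNIV::'i set). 1 / sqrt (2 * pi))"
    proof -
      have "(2 * pi) powr (- (real CARD('i) / 2)) = ((2 * pi) powr (- (1 / 2))) ^ CARD('i)"
        by (simp add: powr_realpow[symmetric] powr_powr)
      also have "(2 * pi) powr (- (1 / 2)) = 1 / sqrt (2 * pi)"
        by (subst powr_minus) (simp add: powr_half_sqrt inverse_eq_divide)
      finally show ?thesis by simp
    qed
    have "gauss_density S (R y) = (2 * pi) powr (- (real CARD('i) / 2)) * (\<Prod>j\<in>UNIV. l j) powr - (1 / 2)
        * exp (\<Sum>j\<in>UNIV. - ((y $ j)\<^sup>2 / (2 * l j)))"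
      unfolding eigensystem_gauss_density[OF e] bR by (simp add: l0 sum_negf sum_divide_distrib mult.commute)
    also have "\<dots> = (\<Prod>j\<in>UNIV. 1 / sqrt (2 * pi) * (1 / sqrt (l j)) * exp (- ((y $ j)\<^sup>2 / (2 * l j))))"
      unfolding P T by (simp only: exp_sum[OF finite] prod.distrib)
    also have "\<dots> = (\<Prod>j\<in>UNIV. normal_density 0 (sqrt (l j)) (y $ j))"
      using l by (intro prod.cong refl) (simp add: normal_density_def real_sqrt_mult less_imp_le)
    finally show ?thesis .
  qed
  have "(\<integral>\<^sup>+y. ennreal (gauss_density S y) \<partial>lborel) = (\<integral>\<^sup>+y. ennreal (gauss_density S (R y)) \<partial>lborel)"
    by (subst (1) D[symmetric], subst nn_integral_distr) auto
  also have "\<dots> = (\<integral>\<^sup>+y. (\<Prod>j\<in>UNIV. ennreal (normal_density 0 (sqrt (l j)) (y $ j))) \<partial>lborel)"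
    unfolding g by (simp add: prod_ennreal)
  also have "\<dots> = (\<Prod>j\<in>UNIV. \<integral>\<^sup>+x. ennreal (normal_density 0 (sqrt (l j)) x) \<partial>lborel)"
    by (intro nn_integral_lborel_vec_prod) auto
  also have "\<dots> = 1"
    using l by (intro prod.neutral ballI) (subst nn_integral_eq_integral, auto)
  finally show "(\<integral>\<^sup>+y. ennreal (gauss_density S y) \<partial>lborel) = 1" .
  have "(CLINT y|lborel. gauss_density S y *\<^sub>R iexp (u \<bullet> y)) = (CLINT y|lborel. gauss_density S (R y) *\<^sub>R iexp (u \<bullet> R y))"
    by (subst (1) D[symmetric], subst integral_distr) auto
  also have "\<dots> = (CLINT y|lborel. (\<Prod>j\<in>UNIV. normal_density 0 (sqrt (l j)) (y $ j) *\<^sub>R iexp ((b j \<bullet> u) * y $ j)))"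
  proof (intro Bochner_Integration.integral_cong refl)
    fix y
    have "u \<bullet> R y = (\<Sum>j\<in>UNIV. (b j \<bullet> u) * y $ j)"
      unfolding orthonormal_inner[OF on, of u] bR ..
    then have "iexp (u \<bullet> R y) = (\<Prod>j\<in>UNIV. iexp ((b j \<bullet> u) * y $ j))"
      by (simp add: exp_sum sum_distrib_left)
    then show "gauss_density S (R y) *\<^sub>R iexp (u \<bullet> R y) =
        (\<Prod>j\<in>UNIV. normal_density 0 (sqrt (l j)) (y $ j) *\<^sub>R iexp ((b j \<bullet> u) * y $ j))"
      unfolding g by (simp add: scaleR_conv_of_real prod.distrib)
  qed
  also have "\<dots> = (\<Prod>j\<in>UNIV. CLINT x|lborel. normal_density 0 (sqrt (l j)) x *\<^sub>R iexp ((b j \<bullet> u) * x))"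
  proof (rule integral_lborel_vec_prod)
    fix j
    show "integrable lborel (\<lambda>x. normal_density 0 (sqrt (l j)) x *\<^sub>R iexp ((b j \<bullet> u) * x))"
      by (rule Bochner_Integration.integrable_bound[OF integrable_normal_density[where \<mu> = 0 and \<sigma> = "sqrt (l j)"]]) (use l in auto)
  qed
  also have "\<dots> = (\<Prod>j\<in>UNIV. complex_of_real (exp (- (l j * (b j \<bullet> u)\<^sup>2) / 2)))"
    using l by (subst char_normal_density) (auto simp: less_imp_le)
  also have "\<dots> = complex_of_real (exp (\<Sum>j\<in>UNIV. - (l j * (b j \<bullet> u)\<^sup>2) / 2))"
    by (simp only: exp_sum[OF finite] of_real_prod)
  also have "(\<Sum>j\<in>UNIV. - (l j * (b j \<bullet> u)\<^sup>2) / 2) = - (u \<bullet> (S *v u)) / 2"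
    unfolding eigensystem_quadratic[OF e] by (simp add: sum_negf sum_divide_distrib power2_eq_square mult.assoc)
  finally show "(CLINT y|lborel. gauss_density S y *\<^sub>R iexp (u \<bullet> y)) = exp (- (u \<bullet> (S *v u)) / 2)" .
qed

section \<open>The law of the sample\<close>

lemma normal_rv_integrable:
  assumes "prob_space M" and Y: "normal_rv M Y"
  shows "integrable M Y" and "integrable M (\<lambda>w. (Y w)\<^sup>2)"
proof -
  interpret prob_space M by fact
  have m [measurable]: "Y \<in> borel_measurable M" using Y by (simp add: normal_rv_def)
  obtain \<mu> \<sigma> where "(0 < \<sigma> \<and> distributed M lborel Y (normal_density \<mu> \<sigma>)) \<or> (AE w in M. Y w = \<mu>)"
    using Y by (auto simp: normal_rv_def)
  then have "integrable M Y \<and> integrable M (\<lambda>w. (Y w)\<^sup>2)"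
  proof
    assume "0 < \<sigma> \<and> distributed M lborel Y (normal_density \<mu> \<sigma>)"
    then have \<sigma>: "0 < \<sigma>" and D: "distributed M lborel Y (normal_density \<mu> \<sigma>)" by auto
    have 1: "integrable M Y"
      using distributed_integrable[OF D, of "\<lambda>x. x"] integrable_normal_moment_nz_1[OF \<sigma>, of \<mu>] by simp
    have "integrable M (\<lambda>w. (Y w - \<mu>)\<^sup>2)"
      using distributed_integrable[OF D, of "\<lambda>x. (x - \<mu>)\<^sup>2"] integrable_normal_moment[OF \<sigma>, of \<mu> 2] by simp
    \<comment> \<open>The square is recovered from the second moment about \<open>\<mu>\<close>,
      which is the one known for normal densities.\<close>
    then have "integrable M (\<lambda>w. (Y w - \<mu>)\<^sup>2 + 2 * \<mu> * Y w - \<mu>\<^sup>2)"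
      using 1 by (intro Bochner_Integration.integrable_add Bochner_Integration.integrable_diff
        integrable_mult_right integrable_const)
    then show ?thesis using 1 by (simp add: power2_diff)
  next
    assume "AE w in M. Y w = \<mu>"
    then have ae: "AE w in M. \<bar>Y w\<bar> \<le> \<bar>\<mu>\<bar>" "AE w in M. \<bar>(Y w)\<^sup>2\<bar> \<le> \<mu>\<^sup>2" by auto
    show ?thesis
      using ae by (auto intro!: integrable_const_bound)
  qed
  then show "integrable M Y" "integrable M (\<lambda>w. (Y w)\<^sup>2)" by auto
qed

text \<open>The formula covers almost surely constant variables too, so it applies to every linear
  combination of the process, degenerate or not.\<close>

lemma char_normal_rv:
  assumes "prob_space M" and Y: "normal_rv M Y" and mean: "(LINT w|M. Y w) = 0"
  shows "(CLINT w|M. iexp (Y w)) = exp (- (LINT w|M. (Y w)\<^sup>2) / 2)"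
proof -
  interpret prob_space M by fact
  have m [measurable]: "Y \<in> borel_measurable M" using Y by (simp add: normal_rv_def)
  obtain \<mu> \<sigma> where "(0 < \<sigma> \<and> distributed M lborel Y (normal_density \<mu> \<sigma>)) \<or> (AE w in M. Y w = \<mu>)"
    using Y by (auto simp: normal_rv_def)
  then show ?thesis
  proof
    assume "0 < \<sigma> \<and> distributed M lborel Y (normal_density \<mu> \<sigma>)"
    then have \<sigma>: "0 < \<sigma>" and D: "distributed M lborel Y (normal_density \<mu> \<sigma>)" by auto
    have \<mu>: "\<mu> = 0" using normal_distributed_expectation[OF \<sigma> D] mean by simp
    have v: "(LINT w|M. (Y w)\<^sup>2) = \<sigma>\<^sup>2" using normal_distributed_variance[OF \<sigma> D] mean by simp
    have "(CLINT w|M. iexp (Y w)) = (CLINT x|distr M lborel Y. iexp x)"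
      by (subst integral_distr) auto
    also have "\<dots> = (CLINT x|lborel. normal_density \<mu> \<sigma> x *\<^sub>R iexp x)"
      unfolding distributed_distr_eq_density[OF D] by (subst integral_density) auto
    also have "\<dots> = exp (- \<sigma>\<^sup>2 / 2)"
      using char_normal_density[OF \<sigma>, of 1] by (simp add: \<mu>)
    finally show ?thesis by (simp add: v)
  next
    assume ae: "AE w in M. Y w = \<mu>"
    have "(LINT w|M. Y w) = (LINT w|M. \<mu>)" using ae by (intro integral_cong_AE) auto
    then have "\<mu> = 0" using mean by (simp add: prob_space)
    then have ae0: "AE w in M. Y w = 0" using ae by simp
    have "(CLINT w|M. iexp (Y w)) = (CLINT w|M. 1)"
      by (intro integral_cong_AE) (use ae0 in auto)
    moreover have "(LINT w|M. (Y w)\<^sup>2) = (LINT w|M. 0)"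
      by (intro integral_cong_AE) (use ae0 in auto)
    ultimately show ?thesis by (simp add: prob_space)
  qed
qed

lemma norm_outer: "norm (outer x y) = norm x * norm y"
proof -
  have "outer x y \<bullet> outer x y = (x \<bullet> x) * (y \<bullet> y)"
    by (simp add: inner_vec_def outer_def sum_product sum_distrib_left mult_ac)
  then show ?thesis by (simp add: norm_eq_sqrt_inner real_sqrt_mult)
qed

lemma measurable_outer [measurable]:
  fixes f :: "'w \<Rightarrow> real^'i" and g :: "'w \<Rightarrow> real^'j"
  assumes "f \<in> borel_measurable M" "g \<in> borel_measurable M"
  shows "(\<lambda>w. outer (f w) (g w)) \<in> borel_measurable M"
proof -
  have "continuous_on UNIV (\<lambda>x. outer (fst x) (snd x) :: real^'j^'i)"
    unfolding outer_def by (intro continuous_intros)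
  then show ?thesis using borel_measurable_continuous_Pair[OF assms] by blast
qed

text \<open>A condition that is stable under linear combinations and makes all outer products
  integrable.\<close>

definition square_integrable :: "'w measure \<Rightarrow> ('w \<Rightarrow> real^'i) \<Rightarrow> bool" where
  "square_integrable M f \<longleftrightarrow> f \<in> borel_measurable M \<and> integrable M (\<lambda>w. (norm (f w))\<^sup>2)"

lemma square_integrable_diff:
  assumes f: "square_integrable M f" and g: "square_integrable M g"
  shows "square_integrable M (\<lambda>w. p *\<^sub>R f w - q *\<^sub>R g w)"
proof -
  have [measurable]: "f \<in> borel_measurable M" "g \<in> borel_measurable M"
    using f g by (auto simp: square_integrable_def)
  have bd: "(norm (p *\<^sub>R x - q *\<^sub>R y))\<^sup>2 \<le> 2 * p\<^sup>2 * (norm x)\<^sup>2 + 2 * q\<^sup>2 * (norm y)\<^sup>2" for x y :: "real^'i"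
  proof -
    have "(norm (p *\<^sub>R x - q *\<^sub>R y))\<^sup>2 \<le> (\<bar>p\<bar> * norm x + \<bar>q\<bar> * norm y)\<^sup>2"
      using norm_triangle_ineq4[of "p *\<^sub>R x" "q *\<^sub>R y"] by (intro power_mono) auto
    also have "\<dots> \<le> 2 * (\<bar>p\<bar> * norm x)\<^sup>2 + 2 * (\<bar>q\<bar> * norm y)\<^sup>2"
      using sum_squares_bound[of "\<bar>p\<bar> * norm x" "\<bar>q\<bar> * norm y"] by (simp add: power2_sum)
    finally show ?thesis by (simp add: power_mult_distrib)
  qed
  have "integrable M (\<lambda>w. (norm (p *\<^sub>R f w - q *\<^sub>R g w))\<^sup>2)"
  proof (rule Bochner_Integration.integrable_bound)
    show "integrable M (\<lambda>w. 2 * p\<^sup>2 * (norm (f w))\<^sup>2 + 2 * q\<^sup>2 * (norm (g w))\<^sup>2)"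
      using f g unfolding square_integrable_def
      by (intro Bochner_Integration.integrable_add integrable_mult_right) auto
    show "AE w in M. norm ((norm (p *\<^sub>R f w - q *\<^sub>R g w))\<^sup>2) \<le>
        norm (2 * p\<^sup>2 * (norm (f w))\<^sup>2 + 2 * q\<^sup>2 * (norm (g w))\<^sup>2)"
    proof (rule AE_I2)
      fix w
      show "norm ((norm (p *\<^sub>R f w - q *\<^sub>R g w))\<^sup>2) \<le>
          norm (2 * p\<^sup>2 * (norm (f w))\<^sup>2 + 2 * q\<^sup>2 * (norm (g w))\<^sup>2)"
        unfolding real_norm_def abs_power2 by (rule order_trans[OF bd abs_ge_self])
    qed
  qed simp
  then show ?thesis by (simp add: square_integrable_def)
qed

lemma integrable_outer:
  assumes f: "square_integrable M f" and g: "square_integrable M g"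
  shows "integrable M (\<lambda>w. outer (f w) (g w))"
proof (rule Bochner_Integration.integrable_bound)
  show "integrable M (\<lambda>w. (norm (f w))\<^sup>2 + (norm (g w))\<^sup>2)"
    using f g by (auto simp: square_integrable_def)
  show "(\<lambda>w. outer (f w) (g w)) \<in> borel_measurable M"
    using f g by (auto simp: square_integrable_def)
  show "AE w in M. norm (outer (f w) (g w)) \<le> norm ((norm (f w))\<^sup>2 + (norm (g w))\<^sup>2)"
  proof (intro AE_I2)
    fix w
    have "0 \<le> norm (f w) * norm (g w)" by simp
    moreover have "2 * (norm (f w) * norm (g w)) \<le> (norm (f w))\<^sup>2 + (norm (g w))\<^sup>2"
      using sum_squares_bound[of "norm (f w)" "norm (g w)"] by (simp add: mult.assoc)
    ultimately show "norm (outer (f w) (g w)) \<le> norm ((norm (f w))\<^sup>2 + (norm (g w))\<^sup>2)"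
      unfolding norm_outer real_norm_def by linarith
  qed
qed

lemma integral_outer_diff_left:
  assumes f: "square_integrable M f" and g: "square_integrable M g" and h: "square_integrable M h"
  shows "(LINT w|M. outer (p *\<^sub>R f w - q *\<^sub>R g w) (h w)) =
    p *\<^sub>R (LINT w|M. outer (f w) (h w)) - q *\<^sub>R (LINT w|M. outer (g w) (h w))"
proof -
  have "outer (p *\<^sub>R f w - q *\<^sub>R g w) (h w) = p *\<^sub>R outer (f w) (h w) - q *\<^sub>R outer (g w) (h w)" for w
    by (simp add: outer_def vec_eq_iff algebra_simps)
  then show ?thesis
    using integrable_outer[OF f h] integrable_outer[OF g h] by simp
qed

lemma integral_outer_diff_right:
  assumes f: "square_integrable M f" and g: "square_integrable M g" and h: "square_integrable M h"
  shows "(LINT w|M. outer (h w) (p *\<^sub>R f w - q *\<^sub>R g w)) =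
    p *\<^sub>R (LINT w|M. outer (h w) (f w)) - q *\<^sub>R (LINT w|M. outer (h w) (g w))"
proof -
  have "outer (h w) (p *\<^sub>R f w - q *\<^sub>R g w) = p *\<^sub>R outer (h w) (f w) - q *\<^sub>R outer (h w) (g w)" for w
    by (simp add: outer_def vec_eq_iff algebra_simps)
  then show ?thesis
    using integrable_outer[OF h f] integrable_outer[OF h g] by simp
qed

text \<open>The expectation of the outer product commutes with the bounded linear functional
  \<open>A \<mapsto> c \<bullet> (A *v d)\<close>.\<close>

lemma integral_inner_mult:
  fixes f :: "'w \<Rightarrow> real^'i" and g :: "'w \<Rightarrow> real^'j"
  assumes f: "square_integrable M f" and g: "square_integrable M g"
  shows "integrable M (\<lambda>w. (c \<bullet> f w) * (d \<bullet> g w))"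
    and "(LINT w|M. (c \<bullet> f w) * (d \<bullet> g w)) = c \<bullet> ((LINT w|M. outer (f w) (g w)) *v d)"
proof -
  have bl: "bounded_linear (\<lambda>A :: real^'j^'i. c \<bullet> (A *v d))"
    by (intro linear_conv_bounded_linear[THEN iffD1] linearI)
      (simp_all add: matrix_vector_mult_add_rdistrib inner_add_right scaleR_matrix_vec)
  have e: "(c \<bullet> f w) * (d \<bullet> g w) = c \<bullet> (outer (f w) (g w) *v d)" for w
    by (simp add: outer_mult_vec inner_commute mult.commute)
  show "integrable M (\<lambda>w. (c \<bullet> f w) * (d \<bullet> g w))"
    unfolding e by (rule integrable_bounded_linear[OF bl integrable_outer[OF f g]])
  show "(LINT w|M. (c \<bullet> f w) * (d \<bullet> g w)) = c \<bullet> ((LINT w|M. outer (f w) (g w)) *v d)"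
    unfolding e by (rule integral_bounded_linear[OF bl integrable_outer[OF f g]])
qed

section \<open>The increment map, its inverse and its Jacobian\<close>

context sampling_times
begin

definition incr_map :: "(nat \<Rightarrow> real^'m) \<Rightarrow> nat \<Rightarrow> real^'m" where
  "incr_map x = (\<lambda>i\<in>{1..n}. incr x i)"

text \<open>From \<open>x j / t j - x (j + 1) / t (j + 1) = sqrt (step_var j) / (t j * t (j + 1)) *
  z j\<close>, which telescopes between \<open>i\<close> and \<open>n\<close>.\<close>

definition incr_inv :: "(nat \<Rightarrow> real^'m) \<Rightarrow> nat \<Rightarrow> real^'m" where
  "incr_inv z = (\<lambda>i\<in>{1..n}. t i *\<^sub>R ((1 / t n) *\<^sub>R z n
     + (\<Sum>j\<in>{i..<n}. (sqrt (step_var j) / (t j * t (j + 1))) *\<^sub>R z j)))"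

lemma measurable_incr:
  assumes "\<And>i. i \<in> {k..n} \<Longrightarrow> (\<lambda>w. f w i) \<in> borel_measurable M" and i: "i \<in> {k..n}"
  shows "(\<lambda>w. incr (f w) i) \<in> borel_measurable M"
proof (cases "i = n")
  case False
  then have "(\<lambda>w. f w i) \<in> borel_measurable M" "(\<lambda>w. f w (i + 1)) \<in> borel_measurable M"
    using i by (auto intro!: assms)
  then show ?thesis using False by (simp add: incr_def)
qed (use assms in \<open>simp add: incr_def\<close>)

lemma measurable_restrict_incr:
  "(\<lambda>x. \<lambda>i\<in>{k..n}. incr x i) \<in> measurable (\<Pi>\<^sub>M i\<in>{k..n}. lborel) (\<Pi>\<^sub>M i\<in>{k..n}. (lborel :: (real^'m) measure))"
proof (intro measurable_restrict)
  fix i assume i: "i \<in> {k..n}"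
  let ?L = "\<Pi>\<^sub>M i\<in>{k..n}. (lborel :: (real^'m) measure)"
  have "(\<lambda>x. x j) \<in> borel_measurable ?L" if "j \<in> {k..n}" for j
    using measurable_component_singleton[OF that, of "\<lambda>_. lborel :: (real^'m) measure"] by simp
  then have "(\<lambda>x. incr x i) \<in> borel_measurable ?L" using i by (rule measurable_incr)
  then show "(\<lambda>x. incr x i) \<in> measurable ?L lborel" by simp
qed

lemma measurable_incr_map: "incr_map \<in> measurable (sample_measure n) (sample_measure n)"
  unfolding incr_map_def sample_measure_def by (rule measurable_restrict_incr)

lemma measurable_incr_inv: "incr_inv \<in> measurable (sample_measure n) (sample_measure n)"
proof -
  have c: "(\<lambda>z. z i) \<in> borel_measurable (\<Pi>\<^sub>M i\<in>{1..n}. lborel)" if "i \<in> {1..n}" for i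
    using that measurable_component_singleton[of i "{1..n}" "\<lambda>_. lborel"] by simp
  show ?thesis
    unfolding incr_inv_def sample_measure_def using n_ge_2
    by (intro measurable_restrict)
      (auto intro!: borel_measurable_scaleR borel_measurable_add borel_measurable_sum c)
qed

lemma incr_inv_incr_map:
  assumes "x \<in> space (sample_measure n)"
  shows "incr_inv (incr_map x) = x"
proof
  have x: "x \<in> extensional {1..n}"
    using assms by (simp add: sample_measure_def space_PiM PiE_def)
  fix i
  show "incr_inv (incr_map x) i = x i"
  proof (cases "i \<in> {1..n}")
    case False
    show ?thesis
      unfolding incr_inv_def restrict_def if_not_P[OF False] extensional_arb[OF x False] ..
  next
    case True
    let ?d = "\<lambda>j. (1 / t j) *\<^sub>R x j - (1 / t (j + 1)) *\<^sub>R x (j + 1)"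
    have "(\<Sum>j\<in>{i..<n}. (sqrt (step_var j) / (t j * t (j + 1))) *\<^sub>R incr_map x j) = (\<Sum>j\<in>{i..<n}. ?d j)"
    proof (intro sum.cong refl)
      fix j assume j: "j \<in> {i..<n}"
      then have p: "0 < step_var j" "0 < t j" "0 < t (j + 1)"
        using True step_var_pos[of j] t_pos[of j] t_pos[of "j + 1"] by auto
      have "(sqrt (step_var j) / (t j * t (j + 1))) *\<^sub>R incr_map x j =
          (1 / (t j * t (j + 1))) *\<^sub>R (t (j + 1) *\<^sub>R x j - t j *\<^sub>R x (j + 1))"
        using j True p by (simp add: incr_map_def incr_def)
      also have "\<dots> = ?d j" using p by (simp add: scaleR_diff_right)
      finally show "(sqrt (step_var j) / (t j * t (j + 1))) *\<^sub>R incr_map x j = ?d j" .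
    qed
    also have "\<dots> = (1 / t i) *\<^sub>R x i - (1 / t n) *\<^sub>R x n"
      using True sum_Suc_diff'[of i n "\<lambda>j. - ((1 / t j) *\<^sub>R x j)"] by (simp add: algebra_simps)
    finally have "incr_inv (incr_map x) i = t i *\<^sub>R ((1 / t i) *\<^sub>R x i)"
      using True n_ge_2 by (simp add: incr_inv_def incr_map_def incr_def)
    then show ?thesis using True t_pos[of i] by simp
  qed
qed

text \<open>For \<open>k < n\<close>, \<open>incr x k\<close> involves only \<open>x k\<close> and
  \<open>x (k + 1)\<close>, so in descending order each step integrates out one new variable by an
  affine substitution. The last variable is left unchanged, hence the empty product at
  \<open>k = n\<close>.\<close>

lemma nn_integral_incr_tail:
  assumes k: "1 \<le> k" "k \<le> n"
    and F: "F \<in> borel_measurable (\<Pi>\<^sub>M i\<in>{k..n}. (lborel :: (real^'m) measure))"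
  shows "ennreal ((\<Prod>i\<in>{k..<n}. t (i + 1) / sqrt (step_var i)) ^ CARD('m)) *
      (\<integral>\<^sup>+x. F (\<lambda>i\<in>{k..n}. incr x i) \<partial>(\<Pi>\<^sub>M i\<in>{k..n}. lborel)) = (\<integral>\<^sup>+x. F x \<partial>(\<Pi>\<^sub>M i\<in>{k..n}. lborel))"
  using k(2,1) F
proof (induction k arbitrary: F rule: inc_induct)
  case base
  have "(\<integral>\<^sup>+x. F (\<lambda>i\<in>{n..n}. incr x i) \<partial>(\<Pi>\<^sub>M i\<in>{n..n}. lborel)) = (\<integral>\<^sup>+x. F x \<partial>(\<Pi>\<^sub>M i\<in>{n..n}. lborel))"
  proof (intro nn_integral_cong arg_cong[where f = F])
    fix x :: "nat \<Rightarrow> real^'m" assume "x \<in> space (\<Pi>\<^sub>M i\<in>{n..n}. lborel)"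
    then show "(\<lambda>i\<in>{n..n}. incr x i) = x"
      by (auto simp: space_PiM PiE_iff extensional_def fun_eq_iff incr_def restrict_def)
  qed
  then show ?case
    by (simp only: atLeastLessThan_empty[OF le_refl] prod.empty power_one ennreal_1 mult_1)
next
  case (step k)
  interpret product_sigma_finite "\<lambda>_::nat. lborel :: (real^'m) measure" ..
  let ?J = "{Suc k..n}"
  let ?L = "\<Pi>\<^sub>M i\<in>?J. (lborel :: (real^'m) measure)"
  have kn: "1 \<le> k" "k < n" using step by auto
  have I: "{k..n} = insert k ?J" using kn by auto
  have F [measurable]: "F \<in> borel_measurable (\<Pi>\<^sub>M i\<in>insert k ?J. (lborel :: (real^'m) measure))"
    using step.prems(2) by (simp add: I)
  define c where "c = t (k + 1) / sqrt (step_var k)"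
  define d where "d = t k / sqrt (step_var k)"
  have c: "0 < c" using t_pos[of "k + 1"] step_var_pos[of k] kn by (simp add: c_def)
  define G where "G z = (\<integral>\<^sup>+y. F (z(k := y)) \<partial>lborel)" for z :: "nat \<Rightarrow> real^'m"
  have G [measurable]: "G \<in> borel_measurable ?L"
    unfolding G_def by measurable
  have "(\<integral>\<^sup>+x. F (\<lambda>i\<in>{k..n}. incr x i) \<partial>(\<Pi>\<^sub>M i\<in>{k..n}. lborel)) =
      (\<integral>\<^sup>+x. (\<integral>\<^sup>+y. F (\<lambda>i\<in>insert k ?J. incr (x(k := y)) i) \<partial>lborel) \<partial>?L)"
    unfolding I
    by (rule product_nn_integral_insert)
      (auto intro: measurable_compose[OF measurable_restrict_incr[of k, unfolded I] F])
  also have "\<dots> = (\<integral>\<^sup>+x. ennreal ((1 / c) ^ CARD('m)) * G (\<lambda>i\<in>?J. incr x i) \<partial>?L)"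
  proof (intro nn_integral_cong)
    fix x assume x: "x \<in> space ?L"
    let ?z = "\<lambda>i\<in>?J. incr x i"
    have z: "?z \<in> space ?L" by (simp add: space_PiM)
    have Fz: "(\<lambda>y. F (?z(k := y))) \<in> borel_measurable borel"
      using measurable_compose[OF measurable_fun_upd[of "insert k ?J" ?J k "\<lambda>_. ?z" borel "\<lambda>_. lborel" "\<lambda>y. y"] F] z
      by simp
    \<comment> \<open>Among the indices from \<open>k\<close> on, changing \<open>x k\<close>
      affects \<open>incr x i\<close> only at \<open>i = k\<close>, where the dependence is affine
      with scale \<open>c\<close>.\<close>
    have "(\<lambda>i\<in>insert k ?J. incr (x(k := y)) i) = ?z(k := - d *\<^sub>R x (k + 1) + c *\<^sub>R y)" for y
    proof
      fix i
      show "(\<lambda>i\<in>insert k ?J. incr (x(k := y)) i) i = (?z(k := - d *\<^sub>R x (k + 1) + c *\<^sub>R y)) i"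
        using kn by (auto simp: incr_def c_def d_def scaleR_diff_right)
    qed
    then have "(\<integral>\<^sup>+y. F (\<lambda>i\<in>insert k ?J. incr (x(k := y)) i) \<partial>lborel) =
        (\<integral>\<^sup>+y. F (?z(k := - d *\<^sub>R x (k + 1) + c *\<^sub>R y)) \<partial>lborel)" by simp
    also have "\<dots> = ennreal ((1 / c) ^ CARD('m)) * (ennreal (c ^ CARD('m)) *
        (\<integral>\<^sup>+y. F (?z(k := - d *\<^sub>R x (k + 1) + c *\<^sub>R y)) \<partial>lborel))"
      using c by (simp add: mult.assoc[symmetric] ennreal_mult[symmetric] power_mult_distrib[symmetric])
    also have "ennreal (c ^ CARD('m)) * (\<integral>\<^sup>+y. F (?z(k := - d *\<^sub>R x (k + 1) + c *\<^sub>R y)) \<partial>lborel) = G ?z"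
      using nn_integral_lborel_affine[OF Fz, of c "- d *\<^sub>R x (k + 1)"] c by (simp add: G_def)
    finally show "(\<integral>\<^sup>+y. F (\<lambda>i\<in>insert k ?J. incr (x(k := y)) i) \<partial>lborel) = ennreal ((1 / c) ^ CARD('m)) * G ?z" .
  qed
  also have "\<dots> = ennreal ((1 / c) ^ CARD('m)) * (\<integral>\<^sup>+x. G (\<lambda>i\<in>?J. incr x i) \<partial>?L)"
    by (rule nn_integral_cmult, rule measurable_compose[OF measurable_restrict_incr G])
  finally have 1: "(\<integral>\<^sup>+x. F (\<lambda>i\<in>{k..n}. incr x i) \<partial>(\<Pi>\<^sub>M i\<in>{k..n}. lborel)) =
      ennreal ((1 / c) ^ CARD('m)) * (\<integral>\<^sup>+x. G (\<lambda>i\<in>?J. incr x i) \<partial>?L)" .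
  have "{k..<n} = insert k ({Suc k..<n})" using kn by auto
  then have p: "(\<Prod>i\<in>{k..<n}. t (i + 1) / sqrt (step_var i)) = c * (\<Prod>i\<in>{Suc k..<n}. t (i + 1) / sqrt (step_var i))"
    by (simp add: c_def)
  have p0: "0 \<le> (\<Prod>i\<in>{Suc k..<n}. t (i + 1) / sqrt (step_var i))"
    using t_pos step_var_pos by (intro prod_nonneg) (auto intro!: divide_nonneg_nonneg less_imp_le)
  have "ennreal ((c * (\<Prod>i\<in>{Suc k..<n}. t (i + 1) / sqrt (step_var i))) ^ CARD('m)) * ennreal ((1 / c) ^ CARD('m))
      = ennreal ((\<Prod>i\<in>{Suc k..<n}. t (i + 1) / sqrt (step_var i)) ^ CARD('m))"
    using c p0 by (simp add: ennreal_mult[symmetric] power_mult_distrib[symmetric])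
  then have "ennreal ((\<Prod>i\<in>{k..<n}. t (i + 1) / sqrt (step_var i)) ^ CARD('m)) *
      (\<integral>\<^sup>+x. F (\<lambda>i\<in>{k..n}. incr x i) \<partial>(\<Pi>\<^sub>M i\<in>{k..n}. lborel)) =
      ennreal ((\<Prod>i\<in>{Suc k..<n}. t (i + 1) / sqrt (step_var i)) ^ CARD('m)) * (\<integral>\<^sup>+x. G (\<lambda>i\<in>?J. incr x i) \<partial>?L)"
    unfolding 1 p mult.assoc[symmetric] by simp
  also have "\<dots> = (\<integral>\<^sup>+x. G x \<partial>?L)"
    by (rule step.IH[OF _ G]) simp
  also have "\<dots> = (\<integral>\<^sup>+x. F x \<partial>(\<Pi>\<^sub>M i\<in>{k..n}. lborel))"
    unfolding I G_def by (rule product_nn_integral_insert[symmetric]) auto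
  finally show ?case .
qed

lemma nn_integral_incr_map:
  fixes F :: "(nat \<Rightarrow> real^'m) \<Rightarrow> ennreal"
  assumes "F \<in> borel_measurable (sample_measure n)"
  shows "ennreal (det whiten ^ CARD('m)) * (\<integral>\<^sup>+x. F (incr_map x) \<partial>sample_measure n) = (\<integral>\<^sup>+x. F x \<partial>sample_measure n)"
  using nn_integral_incr_tail[of 1 F] assms n_ge_2 by (simp add: sample_measure_def incr_map_def det_whiten)

end

lemma pos_semidef_if_pos_def: "pos_def A \<Longrightarrow> pos_semidef A"
  unfolding pos_def_def pos_semidef_def by (metis inner_zero_left less_imp_le order_refl)

lemma pos_def_scaleR: "pos_def A \<Longrightarrow> 0 < c \<Longrightarrow> pos_def (c *\<^sub>R A)"
  by (simp add: pos_def_def transpose_scaleR scaleR_matrix_vec)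

text \<open>\<open>params\<close> speaks of positive times only; positivity of
  \<open>\<alpha>\<close> itself comes from
  \<open>\<alpha> = (\<alpha> - t \<beta>) + t \<beta>\<close>.\<close>

lemma pos_def_add_scaleR:
  assumes A: "pos_def (A - c *\<^sub>R B)" and B: "pos_def B" and c: "0 < c"
  shows "pos_def A"
proof -
  have "transpose A = A"
    using A B by (simp add: pos_def_def transpose_diff transpose_scaleR)
  moreover have "0 < v \<bullet> (A *v v)" if "v \<noteq> 0" for v
  proof -
    have "0 < v \<bullet> ((A - c *\<^sub>R B) *v v)" "0 < c * (v \<bullet> (B *v v))"
      using A B c that by (auto simp: pos_def_def)
    then show ?thesis by (simp add: matrix_diff_vec scaleR_matrix_vec inner_diff_right)
  qed
  ultimately show ?thesis by (simp add: pos_def_def)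
qed

lemma pos_def_rank:
  fixes A :: "real^'i^'i"
  assumes "pos_def A"
  shows "rank A = CARD('i)"
proof -
  obtain b l where e: "eigensystem A b l" using assms symmetric_eigensystem unfolding pos_def_def by blast
  have "{j. l j \<noteq> 0} = UNIV" using eigensystem_pos_def[OF e assms] by (auto simp: less_le)
  then show ?thesis using eigensystem_rank[OF e] by simp
qed

text \<open>At full rank the support condition is vacuous and the density is positive everywhere, so
  that likelihood ratios can be formed in the proof of sufficiency.\<close>

lemma pos_def_gauss_density:
  fixes A :: "real^'i^'i"
  assumes "pos_def A"
  obtains c where "0 < c" "\<And>x. gauss_density A x = c * exp (- (1 / 2) * trace (ginv A ** outer x x))"
proof -
  obtain b l where e: "eigensystem A b l" using assms symmetric_eigensystem unfolding pos_def_def by blast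
  have l: "0 < l j" for j by (rule eigensystem_pos_def[OF e assms])
  have supp: "\<exists>N. null_columns A N \<and> (\<forall>v\<in>N. v \<bullet> x = 0)" for x
  proof -
    have "{j. l j = 0} = {}" using l by (auto simp: less_le)
    then have "null_columns A {}" using eigensystem_null_columns[OF e] by simp
    then show ?thesis by blast
  qed
  have "0 < pdet A" unfolding eigensystem_pdet[OF e] using l by (intro prod_pos) auto
  then have "0 < (2 * pi) powr (- (real (rank A) / 2)) * pdet A powr (- (1 / 2))" by simp
  moreover have "gauss_density A x = (2 * pi) powr (- (real (rank A) / 2)) * pdet A powr (- (1 / 2))
      * exp (- (1 / 2) * trace (ginv A ** outer x x))" for x
    unfolding gauss_density_def if_P[OF supp] ..
  ultimately show thesis by (rule that)
qed

section \<open>The law with the joint density, in increment coordinates\<close>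

context sampling_times
begin

definition step_cov :: "real^'m^'m \<Rightarrow> real^'m^'m \<Rightarrow> nat \<Rightarrow> real^'m^'m" where
  "step_cov a b i = (if i = n then t n *\<^sub>R (a - t n *\<^sub>R b) else a)"

definition incr_density :: "real^'m^'m \<Rightarrow> real^'m^'m \<Rightarrow> (nat \<Rightarrow> real^'m) \<Rightarrow> real" where
  "incr_density a b z = (\<Prod>i\<in>{1..n}. gauss_density (step_cov a b i) (z i))"

lemma incr_density_nonneg: "0 \<le> incr_density a b z"
  unfolding incr_density_def by (intro prod_nonneg gauss_density_nonneg)

lemma sets_sample_measure:
  "sets (sample_measure n :: (nat \<Rightarrow> real^'m) measure) = sets (\<Pi>\<^sub>M i\<in>{1..n}. borel)"
  unfolding sample_measure_def by (intro sets_PiM_cong) auto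

lemma measurable_sample_component:
  "i \<in> {1..n} \<Longrightarrow> (\<lambda>x. x i) \<in> borel_measurable (sample_measure n :: (nat \<Rightarrow> real^'m) measure)"
  using measurable_component_singleton[of i "{1..n}" "\<lambda>_. lborel :: (real^'m) measure"]
  by (simp add: sample_measure_def)

lemma measurable_iexp_inner:
  fixes c :: "nat \<Rightarrow> real^'m"
  shows "(\<lambda>x. iexp (\<Sum>i\<in>{1..n}. c i \<bullet> x i)) \<in> borel_measurable (sample_measure n)"
proof -
  have "(\<lambda>x. \<Sum>i\<in>{1..n}. c i \<bullet> x i) \<in> borel_measurable (sample_measure n)"
    by (intro borel_measurable_sum borel_measurable_inner borel_measurable_const measurable_sample_component)
  moreover have "iexp \<in> borel_measurable borel"
    by (intro borel_measurable_continuous_onI continuous_intros)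
  ultimately show ?thesis by (rule measurable_compose)
qed

lemma params_pos_def:
  assumes ab: "(a, b) \<in> params T" and T: "ereal (t n) < T"
  shows "pos_def a" "pos_def (step_cov a b i)" "(a, b) \<in> closed_params (t n)"
proof -
  have b: "pos_def b" and ab': "pos_def (a - t n *\<^sub>R b)"
    using ab T t_n_pos by (auto simp: params_def)
  then show a: "pos_def a" using pos_def_add_scaleR[OF ab' b t_n_pos] by simp
  have S: "pos_def (t n *\<^sub>R (a - t n *\<^sub>R b))" using ab' t_n_pos by (rule pos_def_scaleR)
  then show "pos_def (step_cov a b i)" using a by (simp add: step_cov_def)
  show "(a, b) \<in> closed_params (t n)"
    unfolding closed_params_iff[OF t_n_pos] using a S by (simp add: pos_semidef_if_pos_def)
qed

context
  fixes a b :: "real^'m^'m" and T :: ereal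
  assumes ab: "(a, b) \<in> params T" and T: "ereal (t n) < T"
begin

text \<open>At full rank the power of \<open>det whiten\<close> is the Jacobian of
  \<open>incr_map\<close>, with one factor for each coordinate of an observation.\<close>

lemma joint_density_incr:
  "joint_density e n t a b x = det whiten ^ CARD('m) * incr_density a b (incr_map x)"
proof -
  have "{1..n} = insert n {1..<n}" using n_ge_2 by auto
  then have "incr_density a b (incr_map x) =
      gauss_density (step_cov a b n) (incr_map x n) * (\<Prod>i\<in>{1..<n}. gauss_density (step_cov a b i) (incr_map x i))"
    by (simp add: incr_density_def)
  also have "(\<Prod>i\<in>{1..<n}. gauss_density (step_cov a b i) (incr_map x i)) = (\<Prod>i\<in>{1..<n}. gauss_density a (incr x i))"
    by (intro prod.cong refl) (simp add: step_cov_def incr_map_def)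
  also have "step_cov a b n = t n *\<^sub>R (a - t n *\<^sub>R b)" by (simp add: step_cov_def)
  also have "incr_map x n = x n" using n_ge_2 by (simp add: incr_map_def incr_def)
  finally show ?thesis
    unfolding joint_density_eq[OF params_pos_def(3)[OF ab T]] pos_def_rank[OF params_pos_def(1)[OF ab T]]
    by (simp only: mult_ac)
qed

lemma measurable_incr_density: "incr_density a b \<in> borel_measurable (sample_measure n)"
  unfolding incr_density_def
  by (intro borel_measurable_prod measurable_compose[OF measurable_sample_component]
      measurable_gauss_density params_pos_def(2)[OF ab T])

lemma measurable_joint_density: "joint_density e n t a b \<in> borel_measurable (sample_measure n)"
  unfolding joint_density_incr[abs_def]
  by (intro borel_measurable_times borel_measurable_const
      measurable_compose[OF measurable_incr_map measurable_incr_density])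

lemma nn_integral_incr_density: "(\<integral>\<^sup>+z. ennreal (incr_density a b z) \<partial>sample_measure n) = 1"
proof -
  interpret product_sigma_finite "\<lambda>_::nat. lborel :: (real^'m) measure" ..
  have "(\<integral>\<^sup>+z. ennreal (incr_density a b z) \<partial>sample_measure n) =
      (\<integral>\<^sup>+z. (\<Prod>i\<in>{1..n}. ennreal (gauss_density (step_cov a b i) (z i))) \<partial>(\<Pi>\<^sub>M i\<in>{1..n}. lborel))"
    by (simp add: sample_measure_def incr_density_def prod_ennreal gauss_density_nonneg)
  also have "\<dots> = (\<Prod>i\<in>{1..n}. \<integral>\<^sup>+y. ennreal (gauss_density (step_cov a b i) y) \<partial>lborel)"
    using measurable_gauss_density[OF params_pos_def(2)[OF ab T]] by (intro product_nn_integral_prod) auto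
  also have "\<dots> = 1"
    by (simp add: pos_def_gauss_density_integrals(1)[OF params_pos_def(2)[OF ab T]])
  finally show ?thesis .
qed

lemma char_incr_density:
  "(CLINT z|density (sample_measure n) (incr_density a b). iexp (\<Sum>i\<in>{1..n}. c i \<bullet> z i)) =
    exp (- (\<Sum>i\<in>{1..n}. c i \<bullet> (step_cov a b i *v c i)) / 2)"
proof -
  interpret product_sigma_finite "\<lambda>_::nat. lborel :: (real^'m) measure" ..
  note gm = measurable_gauss_density[OF params_pos_def(2)[OF ab T]]
  let ?f = "\<lambda>i y. gauss_density (step_cov a b i) y *\<^sub>R iexp (c i \<bullet> y)"
  have fi: "integrable lborel (?f i)" for i
  proof (rule Bochner_Integration.integrable_bound)
    show "integrable lborel (gauss_density (step_cov a b i))"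
      using pos_def_gauss_density_integrals(1)[OF params_pos_def(2)[OF ab T]] gm
      by (intro integrableI_nonneg) (auto intro!: AE_I2 gauss_density_nonneg)
  qed (use gm gauss_density_nonneg in auto)
  have "(CLINT z|density (sample_measure n) (incr_density a b). iexp (\<Sum>i\<in>{1..n}. c i \<bullet> z i)) =
      (CLINT z|sample_measure n. incr_density a b z *\<^sub>R iexp (\<Sum>i\<in>{1..n}. c i \<bullet> z i))"
    by (intro integral_density measurable_iexp_inner measurable_incr_density AE_I2 incr_density_nonneg)
  also have "\<dots> = (CLINT z|(\<Pi>\<^sub>M i\<in>{1..n}. lborel). (\<Prod>i\<in>{1..n}. ?f i (z i)))"
    unfolding sample_measure_def incr_density_def
    by (intro Bochner_Integration.integral_cong refl)
      (simp add: scaleR_conv_of_real prod.distrib exp_sum sum_distrib_left)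
  also have "\<dots> = (\<Prod>i\<in>{1..n}. CLINT y|lborel. ?f i y)"
    using fi by (intro product_integral_prod) auto
  also have "\<dots> = (\<Prod>i\<in>{1..n}. complex_of_real (exp (- (c i \<bullet> (step_cov a b i *v c i)) / 2)))"
    by (simp only: pos_def_gauss_density_integrals(2)[OF params_pos_def(2)[OF ab T]])
  also have "\<dots> = complex_of_real (exp (\<Sum>i\<in>{1..n}. - (c i \<bullet> (step_cov a b i *v c i)) / 2))"
    by (simp only: exp_sum[OF finite_atLeastAtMost] of_real_prod)
  also have "(\<Sum>i\<in>{1..n}. - (c i \<bullet> (step_cov a b i *v c i)) / 2) = - (\<Sum>i\<in>{1..n}. c i \<bullet> (step_cov a b i *v c i)) / 2"
    by (simp add: sum_negf sum_divide_distrib)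
  finally show ?thesis .
qed

lemma prob_space_incr_density: "prob_space (density (sample_measure n) (incr_density a b))"
proof (rule prob_spaceI)
  let ?L = "sample_measure n :: (nat \<Rightarrow> real^'m) measure"
  have "emeasure (density ?L (incr_density a b)) (space (density ?L (incr_density a b))) =
      (\<integral>\<^sup>+z. ennreal (incr_density a b z) \<partial>?L)"
    using measurable_incr_density by (subst emeasure_density) (auto intro!: nn_integral_cong)
  then show "emeasure (density ?L (incr_density a b)) (space (density ?L (incr_density a b))) = 1"
    by (simp only: nn_integral_incr_density)
qed

text \<open>The constant in \<open>joint_density_incr\<close> is exactly what
  \<open>nn_integral_incr_map\<close> absorbs.\<close>

lemma distr_joint_density:
  "distr (density (sample_measure n) (joint_density e n t a b)) (sample_measure n) incr_map =
    density (sample_measure n) (incr_density a b)"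
proof (rule measure_eqI)
  let ?L = "sample_measure n :: (nat \<Rightarrow> real^'m) measure"
  let ?P = "density ?L (joint_density e n t a b)"
  fix A assume "A \<in> sets (distr ?P ?L incr_map)"
  then have A [measurable]: "A \<in> sets ?L" by simp
  have T_meas [measurable]: "incr_map \<in> measurable ?L ?L" by (rule measurable_incr_map)
  note [measurable] = measurable_joint_density measurable_incr_density
  have "emeasure (distr ?P ?L incr_map) A = emeasure ?P (incr_map -` A \<inter> space ?L)"
    by (subst emeasure_distr) (auto simp: measurable_incr_map)
  also have "\<dots> = (\<integral>\<^sup>+x. ennreal (joint_density e n t a b x) * indicator (incr_map -` A \<inter> space ?L) x \<partial>?L)"
    by (intro emeasure_density) auto
  also have "\<dots> = (\<integral>\<^sup>+x. ennreal (det whiten ^ CARD('m)) * (ennreal (incr_density a b (incr_map x)) * indicator A (incr_map x)) \<partial>?L)"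
    using det_whiten_pos
    by (intro nn_integral_cong)
      (auto simp: joint_density_incr ennreal_mult incr_density_nonneg mult.assoc indicator_def)
  also have "\<dots> = ennreal (det whiten ^ CARD('m)) * (\<integral>\<^sup>+x. ennreal (incr_density a b (incr_map x)) * indicator A (incr_map x) \<partial>?L)"
    by (intro nn_integral_cmult) measurable
  also have "\<dots> = (\<integral>\<^sup>+z. ennreal (incr_density a b z) * indicator A z \<partial>?L)"
    by (rule nn_integral_incr_map) measurable
  also have "\<dots> = emeasure (density ?L (incr_density a b)) A"
    by (intro emeasure_density[symmetric]) auto
  finally show "emeasure (distr ?P ?L incr_map) A = emeasure (density ?L (incr_density a b)) A" .
qed simp

text \<open>The total mass is that of the image under \<open>incr_map\<close>, whose density is a
  product.\<close>

lemma prob_space_joint_density: "prob_space (density (sample_measure n) (joint_density e n t a b))"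
proof -
  have "prob_space (distr (density (sample_measure n) (joint_density e n t a b)) (sample_measure n) incr_map)"
    unfolding distr_joint_density by (rule prob_space_incr_density)
  then show ?thesis
    by (rule prob_space_distrD[rotated]) (simp add: measurable_incr_map)
qed

text \<open>\<open>incr_map\<close> has a measurable left inverse, so a law on samples is determined
  by its image.\<close>

lemma sample_law_unique:
  assumes sets: "sets P = sets (sample_measure n :: (nat \<Rightarrow> real^'m) measure)"
    and distr: "distr P (sample_measure n) incr_map = density (sample_measure n) (incr_density a b)"
  shows "P = density (sample_measure n) (joint_density e n t a b)"
proof -
  let ?L = "sample_measure n :: (nat \<Rightarrow> real^'m) measure"
  have inv: "distr (distr Q ?L incr_map) ?L incr_inv = Q" if Q: "sets Q = sets ?L" for Q
  proof -
    have "distr (distr Q ?L incr_map) ?L incr_inv = distr Q ?L (incr_inv \<circ> incr_map)"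
      using measurable_incr_map measurable_incr_inv Q
      by (intro distr_distr) (auto cong: measurable_cong_sets)
    also have "\<dots> = distr Q Q (\<lambda>x. x)"
    proof (rule distr_cong)
      fix x assume "x \<in> space Q"
      then show "(incr_inv \<circ> incr_map) x = x"
        using incr_inv_incr_map sets_eq_imp_space_eq[OF Q] by simp
    qed (use Q in auto)
    finally show ?thesis by simp
  qed
  show ?thesis
    using inv[OF sets] inv[of "density ?L (joint_density e n t a b)"] unfolding distr distr_joint_density by simp
qed

end

end

section \<open>Moments and law of the observed process\<close>

locale gaussian_sample = sampling_times n t e for n t and e :: "'k::finite \<Rightarrow> nat" +
  fixes M :: "'w measure" and X :: "real \<Rightarrow> 'w \<Rightarrow> real^'m"
    and \<alpha> \<beta> :: "real^'m^'m" and T :: ereal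
  assumes process: "centred_gaussian_process M {s. 0 \<le> s \<and> ereal s < T} X (cov_kernel \<alpha> \<beta>)"
    and t_n_less: "ereal (t n) < T" and params: "(\<alpha>, \<beta>) \<in> params T"
begin

lemma t_range: "i \<in> {1..n} \<Longrightarrow> t i \<in> {s. 0 \<le> s \<and> ereal s < T}"
proof -
  assume i: "i \<in> {1..n}"
  then have "ereal (t i) \<le> ereal (t n)" using t_le[of i n] by simp
  then show ?thesis using i t_pos[of i] le_less_trans[OF _ t_n_less] by auto
qed

lemma prob_space_M: "prob_space M"
  using process by (simp add: centred_gaussian_process_def)

text \<open>Coefficients are attached to times, as in \<open>centred_gaussian_process\<close>.
  Closure under differences and sums then gives normality of combinations of increments without
  computing their coefficients.\<close>

definition lin_comb :: "('w \<Rightarrow> real) \<Rightarrow> bool" where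
  "lin_comb f \<longleftrightarrow> (\<exists>a. f = (\<lambda>w. \<Sum>s\<in>t ` {1..n}. a s \<bullet> X s w))"

lemma lin_comb_normal_rv:
  assumes "lin_comb f"
  shows "normal_rv M f"
proof -
  obtain a where f: "f = (\<lambda>w. \<Sum>s\<in>t ` {1..n}. a s \<bullet> X s w)"
    using assms by (auto simp: lin_comb_def)
  have "\<forall>F a. finite F \<and> F \<subseteq> {s. 0 \<le> s \<and> ereal s < T} \<longrightarrow> normal_rv M (\<lambda>w. \<Sum>s\<in>F. a s \<bullet> X s w)"
    using process unfolding centred_gaussian_process_def by (elim conjE)
  moreover have "t ` {1..n} \<subseteq> {s. 0 \<le> s \<and> ereal s < T}" using t_range by (rule image_subsetI)
  ultimately show ?thesis unfolding f by simp
qed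

lemma lin_comb_inner:
  assumes "i \<in> {1..n}"
  shows "lin_comb (\<lambda>w. c \<bullet> X (t i) w)"
  unfolding lin_comb_def
proof (intro exI ext)
  fix w
  have "(\<Sum>s\<in>t ` {1..n}. (if s = t i then c else 0) \<bullet> X s w) = (\<Sum>s\<in>t ` {1..n}. if s = t i then c \<bullet> X s w else 0)"
    by (intro sum.cong) auto
  then show "c \<bullet> X (t i) w = (\<Sum>s\<in>t ` {1..n}. (if s = t i then c else 0) \<bullet> X s w)"
    using assms by simp
qed

lemma lin_comb_diff:
  assumes "lin_comb f" "lin_comb g"
  shows "lin_comb (\<lambda>w. p * f w - q * g w)"
proof -
  obtain a b where "f = (\<lambda>w. \<Sum>s\<in>t ` {1..n}. a s \<bullet> X s w)" "g = (\<lambda>w. \<Sum>s\<in>t ` {1..n}. b s \<bullet> X s w)"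
    using assms by (auto simp: lin_comb_def)
  then have "(\<lambda>w. p * f w - q * g w) = (\<lambda>w. \<Sum>s\<in>t ` {1..n}. (p *\<^sub>R a s - q *\<^sub>R b s) \<bullet> X s w)"
    by (simp add: fun_eq_iff inner_diff_left sum_subtractf sum_distrib_left)
  then show ?thesis unfolding lin_comb_def by (intro exI)
qed

lemma lin_comb_sum:
  assumes "finite I" "\<And>i. i \<in> I \<Longrightarrow> lin_comb (f i)"
  shows "lin_comb (\<lambda>w. \<Sum>i\<in>I. f i w)"
  using assms
proof (induction I)
  case empty
  show ?case unfolding lin_comb_def by (intro exI[of _ "\<lambda>_. 0"]) simp
next
  case (insert i I)
  then have "lin_comb (\<lambda>w. 1 * f i w - (- 1) * (\<Sum>i\<in>I. f i w))"
    by (intro lin_comb_diff) auto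
  then show ?case using insert(1,2) by simp
qed

text \<open>An equation for a Bochner integral does not by itself assert integrability, as the
  integral of a non-integrable function is 0 by convention. Second moments are therefore drawn from
  the normality of the coordinates.\<close>

lemma square_integrable_X:
  assumes "i \<in> {1..n}"
  shows "square_integrable M (X (t i))"
proof -
  have m: "X (t i) \<in> borel_measurable M"
    using process t_range[OF assms] by (auto simp: centred_gaussian_process_def)
  have "integrable M (\<lambda>w. (axis k 1 \<bullet> X (t i) w)\<^sup>2)" for k
    by (intro normal_rv_integrable(2)[OF prob_space_M] lin_comb_normal_rv lin_comb_inner assms)
  then have "integrable M (\<lambda>w. \<Sum>k\<in>UNIV. (axis k 1 \<bullet> X (t i) w)\<^sup>2)" by simp
  moreover have "(\<Sum>k\<in>UNIV. (axis k 1 \<bullet> x)\<^sup>2) = (norm x)\<^sup>2" for x :: "real^'m"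
    unfolding power2_norm_eq_inner by (simp add: inner_vec_def[of x] inner_axis' power2_eq_square)
  ultimately show ?thesis using m by (simp add: square_integrable_def)
qed

lemma integral_X:
  assumes "i \<in> {1..n}"
  shows "integrable M (X (t i))" "(LINT w|M. X (t i) w) = 0"
proof -
  interpret prob_space M by (rule prob_space_M)
  show "integrable M (X (t i))"
  proof (rule Bochner_Integration.integrable_bound)
    show "integrable M (\<lambda>w. 1 + (norm (X (t i) w))\<^sup>2)"
      using square_integrable_X[OF assms] by (simp add: square_integrable_def)
    show "X (t i) \<in> borel_measurable M"
      using square_integrable_X[OF assms] by (simp add: square_integrable_def)
    show "AE w in M. norm (X (t i) w) \<le> norm (1 + (norm (X (t i) w))\<^sup>2)"
    proof (rule AE_I2)
      fix w
      have "2 * norm (X (t i) w) \<le> 1 + (norm (X (t i) w))\<^sup>2"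
        using sum_squares_bound[of 1 "norm (X (t i) w)"] by simp
      then have "norm (X (t i) w) \<le> 1 + (norm (X (t i) w))\<^sup>2"
        using norm_ge_zero[of "X (t i) w"] by linarith
      then show "norm (X (t i) w) \<le> norm (1 + (norm (X (t i) w))\<^sup>2)"
        unfolding real_norm_def by (rule order_trans[OF _ abs_ge_self])
    qed
  qed
  show "(LINT w|M. X (t i) w) = 0"
    using process t_range[OF assms] unfolding centred_gaussian_process_def by blast
qed

lemma lin_comb_mean:
  assumes "lin_comb f"
  shows "(LINT w|M. f w) = 0"
proof -
  obtain a where f: "f = (\<lambda>w. \<Sum>s\<in>t ` {1..n}. a s \<bullet> X s w)"
    using assms by (auto simp: lin_comb_def)
  have "(LINT w|M. f w) = (\<Sum>s\<in>t ` {1..n}. LINT w|M. a s \<bullet> X s w)"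
    unfolding f using integral_X(1) by (intro Bochner_Integration.integral_sum integrable_inner_right) auto
  also have "\<dots> = (\<Sum>s\<in>t ` {1..n}. a s \<bullet> (LINT w|M. X s w))"
    using integral_X(1) by (intro sum.cong refl integral_inner_right) auto
  also have "\<dots> = 0" using integral_X(2) by (intro sum.neutral) auto
  finally show ?thesis .
qed

lemma integral_outer_X:
  assumes "i \<in> {1..n}" "j \<in> {1..n}"
  shows "(LINT w|M. outer (X (t i) w) (X (t j) w)) = min (t i) (t j) *\<^sub>R \<alpha> - (t i * t j) *\<^sub>R \<beta>"
proof -
  have "(LINT w|M. outer (X (t i) w) (X (t j) w)) = cov_kernel \<alpha> \<beta> (t i) (t j)"
    using process t_range[OF assms(1)] t_range[OF assms(2)] unfolding centred_gaussian_process_def by blast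
  then show ?thesis
    by (simp add: cov_kernel_def min_def scaleR_diff_right mult.commute)
qed

definition sample_incr :: "nat \<Rightarrow> 'w \<Rightarrow> real^'m" where
  "sample_incr i w = incr (sample n t X w) i"

lemma sample_incr_n: "sample_incr n w = X (t n) w"
  using n_ge_2 by (simp add: sample_incr_def incr_def sample_def)

lemma sample_incr_less:
  assumes "1 \<le> i" "i < n"
  shows "sample_incr i w = (t (i + 1) / sqrt (step_var i)) *\<^sub>R X (t i) w
    - (t i / sqrt (step_var i)) *\<^sub>R X (t (i + 1)) w"
  using assms by (simp add: sample_incr_def incr_def sample_def scaleR_diff_right)

lemma square_integrable_sample_incr:
  assumes "i \<in> {1..n}"
  shows "square_integrable M (sample_incr i)"
proof (cases "i = n")
  case True
  then show ?thesis using square_integrable_X[OF assms] by (simp add: sample_incr_n[abs_def])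
next
  case False
  then have i: "1 \<le> i" "i < n" using assms by auto
  show ?thesis
    unfolding sample_incr_less[OF i, abs_def] using i
    by (intro square_integrable_diff square_integrable_X) auto
qed

lemma lin_comb_sample_incr:
  assumes "i \<in> {1..n}"
  shows "lin_comb (\<lambda>w. c \<bullet> sample_incr i w)"
proof (cases "i = n")
  case True
  then show ?thesis using lin_comb_inner[OF assms] by (simp add: sample_incr_n)
next
  case False
  then have i: "1 \<le> i" "i < n" using assms by auto
  show ?thesis
    unfolding sample_incr_less[OF i] inner_diff_right inner_scaleR_right using i
    by (intro lin_comb_diff lin_comb_inner) auto
qed

text \<open>The term \<open>(t i * t j) \<beta>\<close> is annihilated by the difference in either
  index, and on the \<open>min\<close> term the two differences act as in
  \<open>whiten_bridge\<close>.\<close>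

lemma integral_outer_sample_incr:
  assumes ij: "i \<in> {1..n}" "j \<in> {1..n}"
  shows "(LINT w|M. outer (sample_incr i w) (sample_incr j w)) = (if i = j then step_cov \<alpha> \<beta> i else 0)"
proof -
  let ?E = "\<lambda>f g. (LINT w|M. outer (f w) (g w))"
  \<comment> \<open>The case \<open>j = n\<close> is included: it says that the increments before
    \<open>n\<close> are uncorrelated with \<open>X (t n)\<close>.\<close>
  have left: "?E (sample_incr i) (X (t j)) =
      (if j \<le> i then t j * (t (i + 1) - t i) / sqrt (step_var i) else 0) *\<^sub>R \<alpha>"
    if i: "1 \<le> i" "i < n" and j: "1 \<le> j" "j \<le> n" for i j
  proof -
    have "?E (sample_incr i) (X (t j)) =
        (t (i + 1) / sqrt (step_var i)) *\<^sub>R ?E (X (t i)) (X (t j)) - (t i / sqrt (step_var i)) *\<^sub>R ?E (X (t (i + 1))) (X (t j))"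
      unfolding sample_incr_less[OF i] using i j
      by (intro integral_outer_diff_left square_integrable_X) auto
    also have "\<dots> = (t (i + 1) / sqrt (step_var i)) *\<^sub>R (min (t i) (t j) *\<^sub>R \<alpha> - (t i * t j) *\<^sub>R \<beta>)
        - (t i / sqrt (step_var i)) *\<^sub>R (min (t (i + 1)) (t j) *\<^sub>R \<alpha> - (t (i + 1) * t j) *\<^sub>R \<beta>)"
      using i j by (subst (1 2) integral_outer_X) auto
    also have "\<dots> = ((t (i + 1) * min (t i) (t j) - t i * min (t (i + 1)) (t j)) / sqrt (step_var i)) *\<^sub>R \<alpha>"
      by (simp add: vec_eq_iff diff_divide_distrib algebra_simps)
    finally show ?thesis unfolding min_step_left[OF i j] by simp
  qed
  have both: "?E (sample_incr i) (sample_incr j) = (if i = j then \<alpha> else 0)"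
    if i: "1 \<le> i" "i < n" and j: "1 \<le> j" "j < n" for i j
  proof -
    have "?E (sample_incr i) (sample_incr j) =
        (t (j + 1) / sqrt (step_var j)) *\<^sub>R ?E (sample_incr i) (X (t j)) - (t j / sqrt (step_var j)) *\<^sub>R ?E (sample_incr i) (X (t (j + 1)))"
      unfolding sample_incr_less[OF j] using i j
      by (intro integral_outer_diff_right square_integrable_X square_integrable_sample_incr) auto
    also have "\<dots> = ((t (j + 1) * (if j \<le> i then t j * (t (i + 1) - t i) / sqrt (step_var i) else 0)
        - t j * (if j + 1 \<le> i then t (j + 1) * (t (i + 1) - t i) / sqrt (step_var i) else 0)) / sqrt (step_var j)) *\<^sub>R \<alpha>"
      using i j by (subst (1 2) left) (auto simp: diff_divide_distrib scaleR_diff_left)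
    also have "\<dots> = (if i = j then 1 else 0) *\<^sub>R \<alpha>" by (simp only: min_step_right[OF i j])
    finally show ?thesis by simp
  qed
  have nn: "1 \<le> n" using n_ge_2 by simp
  have last: "?E (X (t n)) (sample_incr j) = 0" if j: "1 \<le> j" "j < n" for j
  proof -
    have "?E (X (t n)) (sample_incr j) =
        (t (j + 1) / sqrt (step_var j)) *\<^sub>R ?E (X (t n)) (X (t j)) - (t j / sqrt (step_var j)) *\<^sub>R ?E (X (t n)) (X (t (j + 1)))"
      unfolding sample_incr_less[OF j] using j nn
      by (intro integral_outer_diff_right square_integrable_X) auto
    also have "\<dots> = (t (j + 1) / sqrt (step_var j)) *\<^sub>R (t j *\<^sub>R \<alpha> - (t n * t j) *\<^sub>R \<beta>)
        - (t j / sqrt (step_var j)) *\<^sub>R (t (j + 1) *\<^sub>R \<alpha> - (t n * t (j + 1)) *\<^sub>R \<beta>)"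
      using j nn t_le[of j n] t_le[of "j + 1" n]
      by (subst (1 2) integral_outer_X) (auto simp: min_absorb2)
    also have "\<dots> = 0" by (simp add: vec_eq_iff algebra_simps)
    finally show ?thesis .
  qed
  consider "i < n" "j < n" | "i < n" "j = n" | "i = n" "j < n" | "i = n" "j = n" using ij by fastforce
  then show ?thesis
  proof cases
    case 1
    then show ?thesis using both[of i j] ij by (simp add: step_cov_def)
  next
    case 2
    then show ?thesis using left[of i n] ij by (simp add: sample_incr_n)
  next
    case 3
    then show ?thesis using last[of j] ij by (simp add: sample_incr_n)
  next
    case 4
    then show ?thesis
      using integral_outer_X[of n n] nn by (simp add: sample_incr_n step_cov_def scaleR_diff_right)
  qed
qed

text \<open>Normality reduces the characteristic function to the variance of the linear combination,
  and the vanishing cross moments make that a single sum.\<close>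

lemma char_sample_incr:
  "(CLINT w|M. iexp (\<Sum>i\<in>{1..n}. c i \<bullet> sample_incr i w)) =
    exp (- (\<Sum>i\<in>{1..n}. c i \<bullet> (step_cov \<alpha> \<beta> i *v c i)) / 2)"
proof -
  let ?Y = "\<lambda>w. \<Sum>i\<in>{1..n}. c i \<bullet> sample_incr i w"
  have Y: "lin_comb ?Y" by (intro lin_comb_sum lin_comb_sample_incr) auto
  have "(LINT w|M. (?Y w)\<^sup>2) = (LINT w|M. (\<Sum>i\<in>{1..n}. \<Sum>j\<in>{1..n}. (c i \<bullet> sample_incr i w) * (c j \<bullet> sample_incr j w)))"
    by (simp add: power2_eq_square sum_product)
  also have "\<dots> = (\<Sum>i\<in>{1..n}. LINT w|M. (\<Sum>j\<in>{1..n}. (c i \<bullet> sample_incr i w) * (c j \<bullet> sample_incr j w)))"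
    by (intro Bochner_Integration.integral_sum Bochner_Integration.integrable_sum
        integral_inner_mult(1) square_integrable_sample_incr)
  also have "\<dots> = (\<Sum>i\<in>{1..n}. \<Sum>j\<in>{1..n}. LINT w|M. (c i \<bullet> sample_incr i w) * (c j \<bullet> sample_incr j w))"
    by (intro sum.cong refl Bochner_Integration.integral_sum integral_inner_mult(1) square_integrable_sample_incr)
  also have "\<dots> = (\<Sum>i\<in>{1..n}. \<Sum>j\<in>{1..n}. if i = j then c i \<bullet> (step_cov \<alpha> \<beta> i *v c j) else 0)"
    by (intro sum.cong refl)
      (simp add: integral_inner_mult(2) square_integrable_sample_incr integral_outer_sample_incr)
  also have "\<dots> = (\<Sum>i\<in>{1..n}. c i \<bullet> (step_cov \<alpha> \<beta> i *v c i))"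
    by (intro sum.cong refl) (simp add: sum.delta)
  finally show ?thesis
    using char_normal_rv[OF prob_space_M lin_comb_normal_rv[OF Y] lin_comb_mean[OF Y]] by simp
qed

lemma measurable_sample: "sample n t X \<in> measurable M (sample_measure n)"
proof -
  have "X (t i) \<in> borel_measurable M" if "i \<in> {1..n}" for i
    using square_integrable_X[OF that] by (simp add: square_integrable_def)
  then show ?thesis
    unfolding sample_measure_def sample_def[abs_def] by (intro measurable_restrict) simp
qed

text \<open>Characteristic functions are compared for the increments, where both sides are explicit;
  \<open>sample_law_unique\<close> returns to the samples.\<close>

theorem sample_law:
  "distr M (sample_measure n) (sample n t X) = density (sample_measure n) (joint_density e n t \<alpha> \<beta>)"
proof (rule sample_law_unique[OF params t_n_less])
  interpret prob_space M by (rule prob_space_M)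
  let ?L = "sample_measure n :: (nat \<Rightarrow> real^'m) measure"
  let ?P = "distr M ?L (sample n t X)"
  note [measurable] = measurable_sample measurable_incr_map
  show "distr ?P ?L incr_map = density ?L (incr_density \<alpha> \<beta>)"
  proof (rule PiM_eq_if_char_eq[where I = "{1..n}"])
    have "prob_space ?P" by (rule prob_space_distr) measurable
    then show "prob_space (distr ?P ?L incr_map)" by (rule prob_space.prob_space_distr) measurable
    show "prob_space (density ?L (incr_density \<alpha> \<beta>))" by (rule prob_space_incr_density[OF params t_n_less])
    fix c :: "nat \<Rightarrow> real^'m"
    note m = measurable_iexp_inner[of c]
    have "(CLINT z|distr ?P ?L incr_map. iexp (\<Sum>i\<in>{1..n}. c i \<bullet> z i)) =
        (CLINT x|?P. iexp (\<Sum>i\<in>{1..n}. c i \<bullet> incr_map x i))"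
      by (rule integral_distr[OF _ m]) measurable
    also have "\<dots> = (CLINT w|M. iexp (\<Sum>i\<in>{1..n}. c i \<bullet> incr_map (sample n t X w) i))"
      by (rule integral_distr[OF measurable_sample measurable_compose[OF measurable_incr_map m]])
    also have "\<dots> = (CLINT w|M. iexp (\<Sum>i\<in>{1..n}. c i \<bullet> sample_incr i w))"
      by (intro Bochner_Integration.integral_cong arg_cong[where f = iexp] sum.cong refl)
        (simp add: incr_map_def sample_incr_def)
    also have "\<dots> = (CLINT z|density ?L (incr_density \<alpha> \<beta>). iexp (\<Sum>i\<in>{1..n}. c i \<bullet> z i))"
      unfolding char_sample_incr char_incr_density[OF params t_n_less] ..
    finally show "(CLINT z|distr ?P ?L incr_map. iexp (\<Sum>i\<in>{1..n}. c i \<bullet> z i)) =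
        (CLINT z|density ?L (incr_density \<alpha> \<beta>). iexp (\<Sum>i\<in>{1..n}. c i \<bullet> z i))" .
  qed (simp_all add: sets_sample_measure)
qed simp

lemma distributed_sample: "distributed M (sample_measure n) (sample n t X) (joint_density e n t \<alpha> \<beta>)"
  unfolding distributed_def
  using sample_law measurable_sample measurable_joint_density[OF params t_n_less] by simp

lemma unbiased_alpha_hat: "unbiased M (sample n t X) (alpha_hat n t) \<alpha>"
proof -
  let ?f = "\<lambda>w. (1 / real (card {1..<n})) *\<^sub>R (\<Sum>i\<in>{1..<n}. outer (sample_incr i w) (sample_incr i w))"
  have eq: "alpha_hat n t (sample n t X w) = ?f w" for w
    by (simp add: alpha_hat_eq emp_cov_def sample_incr_def)
  have i: "integrable M (\<lambda>w. outer (sample_incr i w) (sample_incr i w))" if "i \<in> {1..<n}" for i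
    using that by (intro integrable_outer square_integrable_sample_incr) auto
  have "(LINT w|M. ?f w) = (1 / real (card {1..<n})) *\<^sub>R (\<Sum>i\<in>{1..<n}. LINT w|M. outer (sample_incr i w) (sample_incr i w))"
    using i by (subst integral_scaleR_right) (auto intro!: arg_cong2[where f = "(*\<^sub>R)"] Bochner_Integration.integral_sum)
  also have "\<dots> = (1 / real (card {1..<n})) *\<^sub>R (\<Sum>i\<in>{1..<n}. \<alpha>)"
    by (intro arg_cong2[where f = "(*\<^sub>R)"] sum.cong refl) (simp add: integral_outer_sample_incr step_cov_def)
  also have "\<dots> = \<alpha>" using n_ge_2 unfolding sum_constant_scaleR by simp
  finally show ?thesis
    unfolding unbiased_def eq using i by (auto intro!: integrable_scaleR_right Bochner_Integration.integrable_sum)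
qed

lemma unbiased_beta_hat: "unbiased M (sample n t X) (beta_hat n t) \<beta>"
proof -
  have n: "n \<in> {1..n}" using n_ge_2 by simp
  have x: "sample n t X w n = X (t n) w" for w using n by (simp add: sample_def)
  have A: "integrable M (\<lambda>w. alpha_hat n t (sample n t X w))" "(LINT w|M. alpha_hat n t (sample n t X w)) = \<alpha>"
    using unbiased_alpha_hat by (auto simp: unbiased_def)
  have B: "integrable M (\<lambda>w. outer (X (t n) w) (X (t n) w))"
    by (intro integrable_outer square_integrable_X n)
  have "(LINT w|M. beta_hat n t (sample n t X w)) =
      (1 / t n) *\<^sub>R \<alpha> - (1 / (t n)\<^sup>2) *\<^sub>R (t n *\<^sub>R \<alpha> - (t n * t n) *\<^sub>R \<beta>)"
    unfolding beta_hat_def x using A B integral_outer_X[OF n n] by simp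
  also have "\<dots> = \<beta>"
    using t_n_pos by (simp add: scaleR_diff_right power2_eq_square)
  finally show ?thesis
    unfolding unbiased_def using A B by (simp add: beta_hat_def x)
qed

end

section \<open>Sufficiency\<close>

text \<open>With respect to a reference law of the family the densities are functions of the statistic, so
  a conditional probability under the reference law, taken as a Radon-Nikodym derivative on the range
  of the statistic, serves all parameters.\<close>

lemma sufficient_if_densities_factor:
  fixes S :: "'x \<Rightarrow> 'y::topological_space" and r :: "'p \<Rightarrow> 'y \<Rightarrow> real"
  assumes S: "S \<in> borel_measurable L" and \<theta>0: "\<theta>0 \<in> \<Theta>"
    and P: "\<And>\<theta>. \<theta> \<in> \<Theta> \<Longrightarrow> prob_space (P \<theta>)" "\<And>\<theta>. \<theta> \<in> \<Theta> \<Longrightarrow> sets (P \<theta>) = sets L"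
    and r: "\<And>\<theta>. \<theta> \<in> \<Theta> \<Longrightarrow> r \<theta> \<in> borel_measurable borel"
    and dens: "\<And>\<theta>. \<theta> \<in> \<Theta> \<Longrightarrow> P \<theta> = density (P \<theta>0) (\<lambda>x. ennreal (r \<theta> (S x)))"
  shows "sufficient \<Theta> L P S"
  unfolding sufficient_def
proof (intro conjI ballI S)
  show "prob_space (P \<theta>)" "sets (P \<theta>) = sets L" if "\<theta> \<in> \<Theta>" for \<theta> using P that by auto
  fix E assume E: "E \<in> sets L"
  interpret P0: prob_space "P \<theta>0" by (rule P(1)[OF \<theta>0])
  have S0: "S \<in> borel_measurable (P \<theta>0)" using S P(2)[OF \<theta>0] by (simp cong: measurable_cong_sets)
  have E0: "E \<in> sets (P \<theta>0)" using E P(2)[OF \<theta>0] by simp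
  define \<nu> where "\<nu> = distr (P \<theta>0) borel S"
  \<comment> \<open>The law of \<open>S\<close> on the event \<open>E\<close>: it gives
    \<open>B\<close> the probability of \<open>E\<close> together with \<open>S \<in> B\<close>
    under the reference law.\<close>
  define \<nu>E where "\<nu>E = distr (density (P \<theta>0) (indicator E)) borel S"
  interpret \<nu>: prob_space \<nu> unfolding \<nu>_def by (rule P0.prob_space_distr[OF S0])
  have SE: "S \<in> borel_measurable (density (P \<theta>0) (indicator E))" using S0 by simp
  have \<nu>E_le: "emeasure \<nu>E B \<le> emeasure \<nu> B" if B: "B \<in> sets borel" for B
  proof -
    have SB: "S -` B \<inter> space (P \<theta>0) \<in> sets (P \<theta>0)" using S0 B by (rule measurable_sets)
    have "emeasure \<nu>E B = (\<integral>\<^sup>+x. indicator E x * indicator (S -` B \<inter> space (P \<theta>0)) x \<partial>P \<theta>0)"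
      unfolding \<nu>E_def using SE B SB E0 by (simp add: emeasure_distr emeasure_density)
    also have "\<dots> \<le> (\<integral>\<^sup>+x. indicator (S -` B \<inter> space (P \<theta>0)) x \<partial>P \<theta>0)"
      by (intro nn_integral_mono) (simp add: indicator_def)
    also have "\<dots> = emeasure \<nu> B"
      unfolding \<nu>_def using S0 B SB by (simp add: emeasure_distr)
    finally show ?thesis .
  qed
  have fin: "finite_measure \<nu>E"
  proof
    have "emeasure \<nu>E (space \<nu>E) \<le> emeasure \<nu> (space \<nu>)"
      using \<nu>E_le[of UNIV] by (simp add: \<nu>_def \<nu>E_def)
    also have "\<dots> < \<infinity>" by (simp add: \<nu>.emeasure_space_1)
    finally show "emeasure \<nu>E (space \<nu>E) \<noteq> \<infinity>" by simp
  qed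
  then interpret \<nu>E: finite_measure \<nu>E .
  have ac: "absolutely_continuous \<nu> \<nu>E"
    unfolding absolutely_continuous_def
  proof
    fix B assume "B \<in> null_sets \<nu>"
    then show "B \<in> null_sets \<nu>E"
      using \<nu>E_le[of B] by (auto simp: null_sets_def \<nu>_def \<nu>E_def)
  qed
  have sets_eq: "sets \<nu>E = sets \<nu>" by (simp add: \<nu>_def \<nu>E_def)
  define \<rho> where "\<rho> = RN_deriv \<nu> \<nu>E"
  have \<rho>m: "\<rho> \<in> borel_measurable borel"
    using borel_measurable_RN_deriv[of \<nu> \<nu>E] by (simp add: \<rho>_def \<nu>_def)
  have \<rho>: "density \<nu> \<rho> = \<nu>E" unfolding \<rho>_def by (rule \<nu>.density_RN_deriv[OF ac sets_eq])
  have "AE y in \<nu>. \<rho> y \<noteq> \<infinity>"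
    unfolding \<rho>_def by (rule \<nu>.RN_deriv_finite[OF \<nu>E.sigma_finite_measure_axioms ac sets_eq])
  then have \<rho>fin: "AE x in P \<theta>0. \<rho> (S x) \<noteq> \<infinity>"
    unfolding \<nu>_def using S0 \<rho>m by (subst (asm) AE_distr_iff) auto
  define \<phi> where "\<phi> y = enn2real (\<rho> y)" for y
  have \<phi>m: "\<phi> \<in> borel_measurable borel" unfolding \<phi>_def using \<rho>m by simp
  \<comment> \<open>Against functions of \<open>S\<close> the indicator of \<open>E\<close> may be
    replaced by \<open>\<rho> (S x)\<close>; this characterizes the conditional probability under
    the reference law.\<close>
  have transfer: "(\<integral>\<^sup>+x. g (S x) * indicator E x \<partial>P \<theta>0) = (\<integral>\<^sup>+x. g (S x) * \<rho> (S x) \<partial>P \<theta>0)"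
    if g: "g \<in> borel_measurable borel" for g :: "'y \<Rightarrow> ennreal"
  proof -
    have gS: "(\<lambda>x. g (S x)) \<in> borel_measurable (P \<theta>0)" by (rule measurable_compose[OF S0 g])
    have "(\<integral>\<^sup>+x. g (S x) * indicator E x \<partial>P \<theta>0) = (\<integral>\<^sup>+x. g (S x) \<partial>density (P \<theta>0) (indicator E))"
      using gS E0 by (subst nn_integral_density) (auto simp: mult.commute)
    also have "\<dots> = (\<integral>\<^sup>+y. g y \<partial>\<nu>E)" unfolding \<nu>E_def by (rule nn_integral_distr[OF SE, symmetric]) (simp add: g)
    also have "\<dots> = (\<integral>\<^sup>+y. \<rho> y * g y \<partial>\<nu>)"
      unfolding \<rho>[symmetric] using \<rho>m g by (intro nn_integral_density) (auto simp: \<nu>_def)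
    also have "\<dots> = (\<integral>\<^sup>+x. \<rho> (S x) * g (S x) \<partial>P \<theta>0)"
      unfolding \<nu>_def using \<rho>m g S0 by (intro nn_integral_distr) auto
    finally show ?thesis by (simp only: mult.commute)
  qed
  show "\<exists>\<phi>\<in>borel_measurable borel. \<forall>\<theta>\<in>\<Theta>. AE x in P \<theta>.
      real_cond_exp (P \<theta>) (vimage_algebra (space L) S borel) (indicator E) x = \<phi> (S x)"
  proof (intro bexI[of _ \<phi>] ballI \<phi>m)
    fix \<theta> assume \<theta>: "\<theta> \<in> \<Theta>"
    let ?Q = "P \<theta>"
    let ?F = "vimage_algebra (space L) S borel"
    interpret Q: prob_space ?Q by (rule P(1)[OF \<theta>])
    have space: "space ?Q = space L" "space (P \<theta>0) = space L"
      using sets_eq_imp_space_eq P(2) \<theta> \<theta>0 by auto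
    have SQ: "S \<in> borel_measurable ?Q" using S P(2)[OF \<theta>] by (simp cong: measurable_cong_sets)
    have EQ: "E \<in> sets ?Q" using E P(2)[OF \<theta>] by simp
    have setsF: "sets ?F = {S -` B \<inter> space L | B. B \<in> sets borel}"
      by (intro sets_vimage_algebra2) auto
    have sub: "subalgebra ?Q ?F"
      unfolding subalgebra_def setsF using SQ by (auto simp: space dest: measurable_sets)
    interpret finite_measure_subalgebra ?Q ?F
      using sub by unfold_locales
    have rS: "(\<lambda>x. ennreal (r \<theta> (S x))) \<in> borel_measurable (P \<theta>0)"
      using measurable_compose[OF S0 r[OF \<theta>]] by simp
    \<comment> \<open>The density \<open>r \<theta> (S x)\<close> is a function of the statistic and
      so can be part of the test function in \<open>transfer\<close>. This is where the parameter
      drops out of the conditional probability.\<close>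
    have key: "(\<integral>\<^sup>+x. indicator (S -` B \<inter> space L) x * ennreal (indicator E x) \<partial>?Q) =
        (\<integral>\<^sup>+x. indicator (S -` B \<inter> space L) x * ennreal (\<phi> (S x)) \<partial>?Q)" if B: "B \<in> sets borel" for B
    proof -
      have SB: "S -` B \<inter> space L \<in> sets (P \<theta>0)" using measurable_sets[OF S0 B] space by simp
      have "(\<integral>\<^sup>+x. indicator (S -` B \<inter> space L) x * ennreal (indicator E x) \<partial>?Q) =
          (\<integral>\<^sup>+x. ennreal (r \<theta> (S x)) * (indicator (S -` B \<inter> space L) x * ennreal (indicator E x)) \<partial>P \<theta>0)"
        unfolding dens[OF \<theta>] using rS SB E0 by (intro nn_integral_density) auto
      also have "\<dots> = (\<integral>\<^sup>+x. (ennreal (r \<theta> (S x)) * indicator B (S x)) * indicator E x \<partial>P \<theta>0)"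
        by (intro nn_integral_cong) (auto simp: space indicator_def)
      also have "\<dots> = (\<integral>\<^sup>+x. (ennreal (r \<theta> (S x)) * indicator B (S x)) * \<rho> (S x) \<partial>P \<theta>0)"
        using r[OF \<theta>] B by (intro transfer[of "\<lambda>y. ennreal (r \<theta> y) * indicator B y"]) auto
      also have "\<dots> = (\<integral>\<^sup>+x. ennreal (r \<theta> (S x)) * (indicator (S -` B \<inter> space L) x * ennreal (\<phi> (S x))) \<partial>P \<theta>0)"
      proof (rule nn_integral_cong_AE)
        show "AE x in P \<theta>0. (ennreal (r \<theta> (S x)) * indicator B (S x)) * \<rho> (S x) =
            ennreal (r \<theta> (S x)) * (indicator (S -` B \<inter> space L) x * ennreal (\<phi> (S x)))"
          using \<rho>fin by (rule AE_mp, intro AE_I2) (auto simp: space \<phi>_def indicator_def ennreal_enn2real less_top)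
      qed
      also have "\<dots> = (\<integral>\<^sup>+x. indicator (S -` B \<inter> space L) x * ennreal (\<phi> (S x)) \<partial>?Q)"
        unfolding dens[OF \<theta>] using rS SB measurable_compose[OF S0 \<phi>m]
        by (intro nn_integral_density[symmetric]) auto
      finally show ?thesis .
    qed
    have \<phi>Q: "(\<lambda>x. \<phi> (S x)) \<in> borel_measurable ?Q" by (rule measurable_compose[OF SQ \<phi>m])
    have iE: "integrable ?Q (indicator E :: 'x \<Rightarrow> real)"
      using EQ by (intro integrable_real_indicator) (auto simp: Q.emeasure_eq_measure)
    show "AE x in ?Q. real_cond_exp ?Q ?F (indicator E) x = \<phi> (S x)"
    proof (rule real_cond_exp_charact)
      show "integrable ?Q (indicator E :: 'x \<Rightarrow> real)" by (rule iE)
      show "integrable ?Q (\<lambda>x. \<phi> (S x))"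
      proof (rule integrableI_nonneg)
        have "(\<integral>\<^sup>+x. ennreal (\<phi> (S x)) \<partial>?Q) = (\<integral>\<^sup>+x. indicator (S -` UNIV \<inter> space L) x * ennreal (\<phi> (S x)) \<partial>?Q)"
          by (intro nn_integral_cong) (simp add: space)
        also have "\<dots> = (\<integral>\<^sup>+x. indicator (S -` UNIV \<inter> space L) x * ennreal (indicator E x) \<partial>?Q)"
          by (rule key[symmetric]) simp
        also have "\<dots> = (\<integral>\<^sup>+x. ennreal (indicator E x) \<partial>?Q)"
          by (intro nn_integral_cong) (simp add: space)
        also have "\<dots> < \<infinity>" using EQ by (simp add: ennreal_indicator Q.emeasure_eq_measure)
        finally show "(\<integral>\<^sup>+x. ennreal (\<phi> (S x)) \<partial>?Q) < \<infinity>" .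
      qed (use \<phi>Q in \<open>auto simp: \<phi>_def\<close>)
      show "(\<lambda>x. \<phi> (S x)) \<in> borel_measurable ?F"
        by (rule measurable_compose[OF measurable_vimage_algebra1 \<phi>m]) simp
      fix A assume "A \<in> sets ?F"
      then obtain B where B: "B \<in> sets borel" "A = S -` B \<inter> space L" unfolding setsF by blast
      have A: "A \<in> sets ?Q" using measurable_sets[OF SQ B(1)] B(2) space by simp
      have I: "(LINT x:A|?Q. f x) = enn2real (\<integral>\<^sup>+x. indicator A x * ennreal (f x) \<partial>?Q)"
        if f: "f \<in> borel_measurable ?Q" "\<And>x. 0 \<le> f x" for f :: "'x \<Rightarrow> real"
      proof -
        have "ennreal (indicator A x *\<^sub>R f x) = indicator A x * ennreal (f x)" for x
          by (simp add: indicator_def)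
        then show ?thesis
          unfolding set_lebesgue_integral_def using A f
          by (subst integral_eq_nn_integral) auto
      qed
      show "(LINT x:A|?Q. indicator E x) = (LINT x:A|?Q. \<phi> (S x))"
        using key[OF B(1)] I[of "indicator E"] I[OF \<phi>Q] EQ by (simp add: B(2)[symmetric] \<phi>_def)
    qed
  qed
qed

lemma trace_sum_outer:
  "(\<Sum>i\<in>I. trace (G ** outer (z i) (z i))) = trace (G ** (\<Sum>i\<in>I. outer (z i) (z i)))"
  for G :: "real^'i^'i"
proof -
  have "trace (0 :: real^'i^'i) = 0" by (simp add: trace_def)
  then show ?thesis
    by (induction I rule: infinite_finite_induct) (simp_all add: matrix_add_ldistrib trace_add)
qed

lemma measurable_exp_trace:
  fixes G :: "real^'i^'i" and f :: "'x::topological_space \<Rightarrow> real^'i^'i"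
  assumes "continuous_on UNIV f"
  shows "(\<lambda>y. exp (- (1 / 2) * trace (G ** f y))) \<in> borel_measurable borel"
  unfolding trace_def matrix_matrix_mult_def
  by (intro borel_measurable_continuous_onI) (simp, intro continuous_intros assms, simp)

context sampling_times
begin

lemma sum_outer_incr: "(\<Sum>i\<in>{1..<n}. outer (incr x i) (incr x i)) = real (n - 1) *\<^sub>R alpha_hat n t x"
  using n_ge_2 by (simp add: alpha_hat_eq emp_cov_def)

text \<open>The Fisher-Neyman factorization with a constant second factor. Positivity of
  \<open>q\<close> permits division by the density of a reference law.\<close>

lemma joint_density_factor:
  fixes a b :: "real^'m^'m"
  assumes ab: "(a, b) \<in> params T" and T: "ereal (t n) < T"
  obtains q where "q \<in> borel_measurable borel" "\<And>y. 0 < q y"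
    "\<And>x. joint_density e n t a b x = q (alpha_hat n t x, beta_hat n t x)"
proof -
  let ?S = "t n *\<^sub>R (a - t n *\<^sub>R b)"
  have a: "pos_def a" and S: "pos_def ?S"
    using params_pos_def(1)[OF ab T] params_pos_def(2)[OF ab T, of n] by (simp_all add: step_cov_def)
  obtain c where c: "0 < c" "\<And>x. gauss_density a x = c * exp (- (1 / 2) * trace (ginv a ** outer x x))"
    using pos_def_gauss_density[OF a] by blast
  obtain d where d: "0 < d" "\<And>x. gauss_density ?S x = d * exp (- (1 / 2) * trace (ginv ?S ** outer x x))"
    using pos_def_gauss_density[OF S] by blast
  define q :: "(real^'m^'m) \<times> (real^'m^'m) \<Rightarrow> real" where
    "q y = det whiten ^ CARD('m) * c ^ (n - 1) * d * exp (- (1 / 2) * trace (ginv a ** (real (n - 1) *\<^sub>R fst y)))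
      * exp (- (1 / 2) * trace (ginv ?S ** (t n *\<^sub>R (fst y - t n *\<^sub>R snd y))))" for y
  show thesis
  proof (rule that[of q])
    show "q \<in> borel_measurable borel"
      unfolding q_def
      by (intro borel_measurable_times borel_measurable_const measurable_exp_trace continuous_intros)
    show "0 < q y" for y
      unfolding q_def using det_whiten_pos c(1) d(1) by simp
    fix x
    have "(\<Prod>i\<in>{1..<n}. gauss_density a (incr x i)) =
        c ^ (n - 1) * exp (- (1 / 2) * (\<Sum>i\<in>{1..<n}. trace (ginv a ** outer (incr x i) (incr x i))))"
      unfolding c(2) prod.distrib sum_distrib_left by (simp add: exp_sum)
    then show "joint_density e n t a b x = q (alpha_hat n t x, beta_hat n t x)"
      unfolding joint_density_eq[OF params_pos_def(3)[OF ab T]] pos_def_rank[OF a] d(2)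
        trace_sum_outer sum_outer_incr q_def fst_conv snd_conv sigma_hat_eq emp_cov_singleton
      by (simp only: mult_ac)
  qed
qed

lemma measurable_alpha_hat: "alpha_hat n t \<in> borel_measurable (sample_measure n :: (nat \<Rightarrow> real^'m) measure)"
proof -
  have "(\<lambda>x. incr x i) \<in> borel_measurable (sample_measure n :: (nat \<Rightarrow> real^'m) measure)" if "i \<in> {1..<n}" for i
    using that by (intro measurable_incr[where k = 1 and f = "\<lambda>x. x"] measurable_sample_component) auto
  then show ?thesis
    unfolding alpha_hat_eq[abs_def] emp_cov_def
    by (intro borel_measurable_scaleR borel_measurable_const borel_measurable_sum measurable_outer)
qed

lemma measurable_beta_hat: "beta_hat n t \<in> borel_measurable (sample_measure n :: (nat \<Rightarrow> real^'m) measure)"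
  unfolding beta_hat_def[abs_def] using n_ge_2
  by (intro borel_measurable_diff borel_measurable_scaleR borel_measurable_const measurable_outer
      measurable_alpha_hat measurable_sample_component) auto

lemma jointly_sufficient_estimates:
  fixes a b :: "real^'m^'m"
  assumes ab: "(a, b) \<in> params T" and T: "ereal (t n) < T"
  shows "jointly_sufficient T e n t (alpha_hat n t :: (nat \<Rightarrow> real^'m) \<Rightarrow> real^'m^'m) (beta_hat n t)"
  unfolding jointly_sufficient_def
proof -
  let ?L = "sample_measure n :: (nat \<Rightarrow> real^'m) measure"
  let ?S = "\<lambda>x :: nat \<Rightarrow> real^'m. (alpha_hat n t x, beta_hat n t x)"
  let ?j = "\<lambda>\<theta>. joint_density e n t (fst \<theta>) (snd \<theta>) :: (nat \<Rightarrow> real^'m) \<Rightarrow> real"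
  have "\<exists>q. q \<in> borel_measurable borel \<and> (\<forall>y. 0 < q y) \<and> (\<forall>x. ?j \<theta> x = q (?S x))" if "\<theta> \<in> params T" for \<theta>
    using joint_density_factor[of "fst \<theta>" "snd \<theta>", OF _ T] that by (metis prod.collapse)
  then obtain q where q: "\<And>\<theta>. \<theta> \<in> params T \<Longrightarrow> q \<theta> \<in> borel_measurable borel"
    "\<And>\<theta> y. \<theta> \<in> params T \<Longrightarrow> 0 < q \<theta> y" "\<And>\<theta> x. \<theta> \<in> params T \<Longrightarrow> ?j \<theta> x = q \<theta> (?S x)"
    by metis
  have jm: "?j \<theta> \<in> borel_measurable ?L" if "\<theta> \<in> params T" for \<theta>
    using measurable_joint_density[of "fst \<theta>" "snd \<theta>", OF _ T] that by simp
  have "sufficient (params T) ?L (\<lambda>\<theta>. density ?L (?j \<theta>)) ?S"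
  \<comment> \<open>The given \<open>(a, b)\<close> serves as reference parameter, and the
    likelihood ratio relative to it is a function of the statistic.\<close>
  proof (rule sufficient_if_densities_factor[OF _ ab, where r = "\<lambda>\<theta> y. q \<theta> y / q (a, b) y"])
    show "?S \<in> borel_measurable ?L"
      by (intro borel_measurable_Pair measurable_alpha_hat measurable_beta_hat)
    fix \<theta> :: "(real^'m^'m) \<times> (real^'m^'m)" assume \<theta>: "\<theta> \<in> params T"
    show "prob_space (density ?L (?j \<theta>))"
      using prob_space_joint_density[of "fst \<theta>" "snd \<theta>", OF _ T] \<theta> by simp
    show "(\<lambda>y. q \<theta> y / q (a, b) y) \<in> borel_measurable borel"
      using q(1) \<theta> ab by (intro borel_measurable_divide)
    have "density (density ?L (?j (a, b))) (\<lambda>x. ennreal (q \<theta> (?S x) / q (a, b) (?S x))) =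
        density ?L (\<lambda>x. ennreal (?j (a, b) x) * ennreal (q \<theta> (?S x) / q (a, b) (?S x)))"
    proof (rule density_density_eq)
      show "(\<lambda>x. ennreal (?j (a, b) x)) \<in> borel_measurable ?L" using jm[OF ab] by simp
      have "(\<lambda>x. ?j \<theta> x / ?j (a, b) x) \<in> borel_measurable ?L"
        using jm \<theta> ab by (intro borel_measurable_divide)
      then show "(\<lambda>x. ennreal (q \<theta> (?S x) / q (a, b) (?S x))) \<in> borel_measurable ?L"
        unfolding q(3)[OF \<theta>] q(3)[OF ab] by (rule measurable_compose[OF _ measurable_ennreal])
    qed
    also have "\<dots> = density ?L (?j \<theta>)"
    proof (intro arg_cong[where f = "density ?L"] ext)
      fix x
      show "ennreal (?j (a, b) x) * ennreal (q \<theta> (?S x) / q (a, b) (?S x)) = ennreal (?j \<theta> x)"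
        unfolding q(3)[OF \<theta>] q(3)[OF ab] using q(2)[OF \<theta>, of "?S x"] q(2)[OF ab, of "?S x"]
        by (subst ennreal_mult[symmetric]) auto
    qed
    finally show "density ?L (?j \<theta>) = density (density ?L (?j (a, b))) (\<lambda>x. ennreal (q \<theta> (?S x) / q (a, b) (?S x)))" ..
  qed simp
  then show "sufficient (params T) ?L (\<lambda>(a, b). density ?L (joint_density e n t a b)) ?S"
    by (simp add: case_prod_unfold)
qed

end

theorem theorem3:
  fixes M :: "'w measure" and X :: "real \<Rightarrow> 'w \<Rightarrow> real^'m"
    and \<alpha> \<beta> :: "real^'m^'m" and T :: ereal
    and n :: nat and t :: "nat \<Rightarrow> real" and e :: "'k::finite \<Rightarrow> nat"
  assumes "0 < T"
    and "pos_def \<beta>"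
    and "\<And>s. 0 < s \<Longrightarrow> ereal s < T \<Longrightarrow> pos_def (\<alpha> - s *\<^sub>R \<beta>)"
    and "centred_gaussian_process M {s. 0 \<le> s \<and> ereal s < T} X (cov_kernel \<alpha> \<beta>)"
    and "AE w in M. X 0 w = 0"
    and "2 \<le> n"
    and "0 < t 1"
    and "\<And>i. 1 \<le> i \<Longrightarrow> i < n \<Longrightarrow> t i < t (i + 1)"
    and "ereal (t n) < T"
    and "bij_betw e UNIV {1..<n}"
  shows "distributed M (sample_measure n) (sample n t X) (joint_density e n t \<alpha> \<beta>) \<and>
    max_likelihood e n t (alpha_hat n t :: (nat \<Rightarrow> real^'m) \<Rightarrow> real^'m^'m) (beta_hat n t) \<and>
    (\<forall>A B :: (nat \<Rightarrow> real^'m) \<Rightarrow> real^'m^'m.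
       max_likelihood e n t A B \<longrightarrow> A = alpha_hat n t \<and> B = beta_hat n t) \<and>
    jointly_sufficient T e n t (alpha_hat n t :: (nat \<Rightarrow> real^'m) \<Rightarrow> real^'m^'m) (beta_hat n t) \<and>
    unbiased M (sample n t X) (alpha_hat n t) \<alpha> \<and>
    unbiased M (sample n t X) (beta_hat n t) \<beta>"
proof -
  interpret gaussian_sample n t e M X \<alpha> \<beta> T
    using assms by unfold_locales (auto simp: params_def)
  show ?thesis
    by (intro conjI allI impI distributed_sample max_likelihood_estimates
        jointly_sufficient_estimates[OF params t_n_less] unbiased_alpha_hat unbiased_beta_hat ext
        max_likelihood_unique)
qed

end
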